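(* Let $G$ be a locally compact $[FC]^-$ group and let $\omega$ be a weight on $G$. Suppose that there exists a non-trivial (i.e. not identically zero) continuous group homomorphism $\Phi:G\to\mathbb{C}$ (into the additive group of $\mathbb{C}$) such that $$\sup_{t\in G}\frac{|\Phi(t)|}{\omega(t)\omega(t^{-1})}<\infty.$$ Then $ZL^1(G,\omega)$ is not weakly amenable.
   Context: A locally compact group $G$ is an $[FC]^-$ group if for every $x\in G$ the conjugacy class $\{gxg^{-1}:g\in G\}$ has compact closure in $G$. A weight on a locally compact group $G$ is a Borel measurable function $\omega:G\to\mathbb{R}^+=(0,\infty)$ with $\omega(xy)\le\omega(x)\omega(y)$ for all $x,y\in G$. The Beurling algebra $L^1(G,\omega)$ is the Banach algebra (under convolution) of (a.e.-classes of) complex Haar measurable functions $f$ on $G$ with $\|f\|_\omega=\int_G|f(x)|\omega(x)\,dx<\infty$, where $dx$ is a fixed left Haar measure. The central Beurling algebra $ZL^1(G,\omega)$ is the closed subalgebra of all $f\in L^1(G,\omega)$ such that $f^g=f$ (a.e.) for all $g\in G$, where $f^g(x)=f(g^{-1}xg)$; it is a commutative Banach algebra and is the center of $L^1(G,\omega)$. A commutative Banach algebra $A$ is weakly amenable if every continuous derivation from $A$ into any symmetric Banach $A$-bimodule is zero (equivalently, every continuous derivation $A\to A^*$ is zero). *)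

theory Defs
  imports "HOL-Analysis.Analysis"
begin

section \<open>Complex Banach spaces, algebras and bimodules with explicit carriers\<close>

text \<open>
  The Banach spaces below depend on a measure and on a weight, hence they are records with an
  explicit carrier set rather than types. All operations are only relevant on the carrier.
\<close>

record 'v cspace =
  vcarrier :: "'v set"
  vzero :: 'v
  vadd :: "'v \<Rightarrow> 'v \<Rightarrow> 'v"
  vscale :: "complex \<Rightarrow> 'v \<Rightarrow> 'v"
  vnorm :: "'v \<Rightarrow> real"

record 'v calgebra = "'v cspace" +
  vmult :: "'v \<Rightarrow> 'v \<Rightarrow> 'v"

definition vdist :: "('v, 'm) cspace_scheme \<Rightarrow> 'v \<Rightarrow> 'v \<Rightarrow> real" where
  "vdist X x y = vnorm X (vadd X x (vscale X (-1) y))"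

locale complex_banach_space =
  fixes X :: "('v, 'm) cspace_scheme"
  assumes zero_closed: "vzero X \<in> vcarrier X"
    and add_closed: "\<lbrakk>x \<in> vcarrier X; y \<in> vcarrier X\<rbrakk> \<Longrightarrow> vadd X x y \<in> vcarrier X"
    and scale_closed: "x \<in> vcarrier X \<Longrightarrow> vscale X c x \<in> vcarrier X"
    and add_assoc: "\<lbrakk>x \<in> vcarrier X; y \<in> vcarrier X; z \<in> vcarrier X\<rbrakk>
          \<Longrightarrow> vadd X (vadd X x y) z = vadd X x (vadd X y z)"
    and add_commute: "\<lbrakk>x \<in> vcarrier X; y \<in> vcarrier X\<rbrakk> \<Longrightarrow> vadd X x y = vadd X y x"
    and add_zero: "x \<in> vcarrier X \<Longrightarrow> vadd X x (vzero X) = x"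
    and add_inverse: "x \<in> vcarrier X \<Longrightarrow> vadd X x (vscale X (-1) x) = vzero X"
    and scale_one: "x \<in> vcarrier X \<Longrightarrow> vscale X 1 x = x"
    and scale_scale: "x \<in> vcarrier X \<Longrightarrow> vscale X c (vscale X d x) = vscale X (c * d) x"
    and scale_add_left: "x \<in> vcarrier X
          \<Longrightarrow> vscale X (c + d) x = vadd X (vscale X c x) (vscale X d x)"
    and scale_add_right: "\<lbrakk>x \<in> vcarrier X; y \<in> vcarrier X\<rbrakk>
          \<Longrightarrow> vscale X c (vadd X x y) = vadd X (vscale X c x) (vscale X c y)"
    and norm_nonneg: "x \<in> vcarrier X \<Longrightarrow> 0 \<le> vnorm X x"
    and norm_eq_zero: "x \<in> vcarrier X \<Longrightarrow> vnorm X x = 0 \<longleftrightarrow> x = vzero X"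
    and norm_scale: "x \<in> vcarrier X \<Longrightarrow> vnorm X (vscale X c x) = cmod c * vnorm X x"
    and norm_triangle: "\<lbrakk>x \<in> vcarrier X; y \<in> vcarrier X\<rbrakk>
          \<Longrightarrow> vnorm X (vadd X x y) \<le> vnorm X x + vnorm X y"
    and complete: "\<lbrakk>\<And>n. s n \<in> vcarrier X;
            \<And>e. e > 0 \<Longrightarrow> \<exists>N. \<forall>m\<ge>N. \<forall>n\<ge>N. vdist X (s m) (s n) < e\<rbrakk>
          \<Longrightarrow> \<exists>x\<in>vcarrier X. (\<lambda>n. vdist X (s n) x) \<longlonglongrightarrow> (0::real)"

definition clinear_on ::
  "('v, 'm) cspace_scheme \<Rightarrow> ('w, 'n) cspace_scheme \<Rightarrow> ('v \<Rightarrow> 'w) \<Rightarrow> bool" where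
  "clinear_on X Y T \<longleftrightarrow>
     (\<forall>x\<in>vcarrier X. T x \<in> vcarrier Y) \<and>
     (\<forall>x\<in>vcarrier X. \<forall>y\<in>vcarrier X. T (vadd X x y) = vadd Y (T x) (T y)) \<and>
     (\<forall>c. \<forall>x\<in>vcarrier X. T (vscale X c x) = vscale Y c (T x))"

definition bounded_clinear_on ::
  "('v, 'm) cspace_scheme \<Rightarrow> ('w, 'n) cspace_scheme \<Rightarrow> ('v \<Rightarrow> 'w) \<Rightarrow> bool" where
  "bounded_clinear_on X Y T \<longleftrightarrow>
     clinear_on X Y T \<and> (\<exists>C. \<forall>x\<in>vcarrier X. vnorm Y (T x) \<le> C * vnorm X x)"

definition bounded_cbilinear_on ::
  "('v, 'm) cspace_scheme \<Rightarrow> ('w, 'n) cspace_scheme \<Rightarrow> ('u, 'k) cspace_scheme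
     \<Rightarrow> ('v \<Rightarrow> 'w \<Rightarrow> 'u) \<Rightarrow> bool" where
  "bounded_cbilinear_on X Y Z b \<longleftrightarrow>
     (\<forall>x\<in>vcarrier X. clinear_on Y Z (b x)) \<and>
     (\<forall>y\<in>vcarrier Y. clinear_on X Z (\<lambda>x. b x y)) \<and>
     (\<exists>C. \<forall>x\<in>vcarrier X. \<forall>y\<in>vcarrier Y. vnorm Z (b x y) \<le> C * vnorm X x * vnorm Y y)"

locale banach_bimodule = complex_banach_space X
  for A :: "('a, 'm) calgebra_scheme" and X :: "('x, 'n) cspace_scheme"
    and lact :: "'a \<Rightarrow> 'x \<Rightarrow> 'x" and ract :: "'x \<Rightarrow> 'a \<Rightarrow> 'x" +
  assumes lact_bilinear: "bounded_cbilinear_on A X X lact"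
    and ract_bilinear: "bounded_cbilinear_on X A X ract"
    and lact_mult: "\<lbrakk>a \<in> vcarrier A; b \<in> vcarrier A; x \<in> vcarrier X\<rbrakk>
          \<Longrightarrow> lact (vmult A a b) x = lact a (lact b x)"
    and ract_mult: "\<lbrakk>a \<in> vcarrier A; b \<in> vcarrier A; x \<in> vcarrier X\<rbrakk>
          \<Longrightarrow> ract x (vmult A a b) = ract (ract x a) b"
    and lact_ract: "\<lbrakk>a \<in> vcarrier A; b \<in> vcarrier A; x \<in> vcarrier X\<rbrakk>
          \<Longrightarrow> ract (lact a x) b = lact a (ract x b)"

locale symmetric_banach_bimodule = banach_bimodule +
  assumes symmetric: "\<lbrakk>a \<in> vcarrier A; x \<in> vcarrier X\<rbrakk> \<Longrightarrow> lact a x = ract x a"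

definition continuous_derivation ::
  "('a, 'm) calgebra_scheme \<Rightarrow> ('x, 'n) cspace_scheme \<Rightarrow> ('a \<Rightarrow> 'x \<Rightarrow> 'x) \<Rightarrow> ('x \<Rightarrow> 'a \<Rightarrow> 'x)
     \<Rightarrow> ('a \<Rightarrow> 'x) \<Rightarrow> bool" where
  "continuous_derivation A X lact ract D \<longleftrightarrow>
     bounded_clinear_on A X D \<and>
     (\<forall>a\<in>vcarrier A. \<forall>b\<in>vcarrier A. D (vmult A a b) = vadd X (lact a (D b)) (ract (D a) b))"

text \<open>
  A definition cannot quantify over all types, so the bimodules range over those whose elements
  are functions from \<open>'a\<close> to \<open>complex\<close>. This class contains (a copy of) the dual module of \<open>A\<close>,
  and for a commutative Banach algebra the vanishing of all continuous derivations into the dual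
  module already implies that of all continuous derivations into arbitrary symmetric Banach
  bimodules. The restriction therefore does not change the notion.
\<close>

definition weakly_amenable :: "'a calgebra \<Rightarrow> bool" where
  "weakly_amenable A \<longleftrightarrow>
     (\<forall>(X :: ('a \<Rightarrow> complex) cspace) lact ract D.
        symmetric_banach_bimodule A X lact ract \<longrightarrow> continuous_derivation A X lact ract D \<longrightarrow>
        (\<forall>a\<in>vcarrier A. D a = vzero X))"


section \<open>Locally compact groups\<close>

text \<open>
  The class \<^class>\<open>topological_group_add\<close> does not require commutativity: groups are written
  additively, with \<open>x + y\<close> for the product, \<open>- x\<close> for the inverse and \<open>g + x - g\<close> for conjugation.
\<close>

class locally_compact_group_add = topological_group_add + t2_space +
  assumes locally_compact: "\<exists>U K. open U \<and> compact K \<and> x \<in> U \<and> U \<subseteq> K"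

definition FC_bar_group :: "'g::locally_compact_group_add itself \<Rightarrow> bool" where
  "FC_bar_group _ \<longleftrightarrow> (\<forall>x::'g. compact (closure {g + x - g | g. True}))"

definition left_haar_measure :: "'g::locally_compact_group_add measure \<Rightarrow> bool" where
  "left_haar_measure \<mu> \<longleftrightarrow>
     sets \<mu> = sets borel \<and>
     (\<forall>K. compact K \<longrightarrow> emeasure \<mu> K < \<infinity>) \<and>
     (\<forall>A\<in>sets borel. emeasure \<mu> A = (INF U\<in>{U. open U \<and> A \<subseteq> U}. emeasure \<mu> U)) \<and>
     (\<forall>U. open U \<longrightarrow> emeasure \<mu> U = (SUP K\<in>{K. compact K \<and> K \<subseteq> U}. emeasure \<mu> K)) \<and>
     (\<forall>g. \<forall>A\<in>sets borel. emeasure \<mu> ((+) g ` A) = emeasure \<mu> A) \<and>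
     emeasure \<mu> UNIV \<noteq> 0"

definition weight :: "('g::locally_compact_group_add \<Rightarrow> real) \<Rightarrow> bool" where
  "weight \<omega> \<longleftrightarrow>
     \<omega> \<in> borel_measurable borel \<and> (\<forall>x. 0 < \<omega> x) \<and> (\<forall>x y. \<omega> (x + y) \<le> \<omega> x * \<omega> y)"


section \<open>Beurling algebras\<close>

text \<open>
  A left Haar measure \<open>\<mu>\<close> lives on the Borel sets; the Haar measurable functions are the
  functions measurable with respect to its completion.
\<close>

definition ae_class ::
  "'g::locally_compact_group_add measure \<Rightarrow> ('g \<Rightarrow> complex) \<Rightarrow> ('g \<Rightarrow> complex) set" where
  "ae_class \<mu> f = {h \<in> borel_measurable (completion \<mu>). AE x in \<mu>. h x = f x}"

definition ae_rep :: "('g \<Rightarrow> complex) set \<Rightarrow> 'g \<Rightarrow> complex" where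
  "ae_rep F = (SOME f. f \<in> F)"

definition beurling_fun ::
  "'g::locally_compact_group_add measure \<Rightarrow> ('g \<Rightarrow> real) \<Rightarrow> ('g \<Rightarrow> complex) set" where
  "beurling_fun \<mu> \<omega> =
     {f \<in> borel_measurable (completion \<mu>). integrable (completion \<mu>) (\<lambda>x. cmod (f x) * \<omega> x)}"

definition convolution ::
  "'g::locally_compact_group_add measure \<Rightarrow> ('g \<Rightarrow> complex) \<Rightarrow> ('g \<Rightarrow> complex) \<Rightarrow> 'g \<Rightarrow> complex"
  where "convolution \<mu> f h x = (LINT y|completion \<mu>. f y * h (- y + x))"

text \<open>
  For integrands in \<open>beurling_fun \<mu> \<omega>\<close> the convolution integral converges for almost every \<open>x\<close>;
  at the other points the value of \<open>convolution\<close> is the default value 0.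
\<close>

definition beurling_algebra ::
  "'g::locally_compact_group_add measure \<Rightarrow> ('g \<Rightarrow> real) \<Rightarrow> ('g \<Rightarrow> complex) set calgebra" where
  "beurling_algebra \<mu> \<omega> =
     \<lparr> vcarrier = ae_class \<mu> ` beurling_fun \<mu> \<omega>,
       vzero = ae_class \<mu> (\<lambda>x. 0),
       vadd = (\<lambda>F H. ae_class \<mu> (\<lambda>x. ae_rep F x + ae_rep H x)),
       vscale = (\<lambda>c F. ae_class \<mu> (\<lambda>x. c * ae_rep F x)),
       vnorm = (\<lambda>F. LINT x|completion \<mu>. cmod (ae_rep F x) * \<omega> x),
       vmult = (\<lambda>F H. ae_class \<mu> (convolution \<mu> (ae_rep F) (ae_rep H))) \<rparr>"

definition central_beurling_algebra ::
  "'g::locally_compact_group_add measure \<Rightarrow> ('g \<Rightarrow> real) \<Rightarrow> ('g \<Rightarrow> complex) set calgebra" where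
  "central_beurling_algebra \<mu> \<omega> =
     (beurling_algebra \<mu> \<omega>)
       \<lparr> vcarrier := {F \<in> vcarrier (beurling_algebra \<mu> \<omega>).
                        \<forall>f\<in>F. \<forall>g. AE x in \<mu>. f (- g + x + g) = f x} \<rparr>"

end

theory Submission
  imports Defs
begin

text \<open>
  Let \<open>\<phi>\<close> be a continuous function supported in a compact set. The growth condition on \<open>\<Phi>\<close> ensures
  that \<open>(D a)(x) = \<integral> a(y) \<Phi>(y) \<phi>(x + y) dy\<close> is bounded by a multiple of \<open>\<parallel>a\<parallel> \<omega>(x)\<close>. The continuous
  functions bounded by a multiple of \<open>\<omega>\<close> form a Banach module under
  \<open>(a \<cdot> \<psi>)(x) = \<integral> a(y) \<psi>(x + y) dy\<close>, and \<open>D\<close> is a derivation into it because \<open>\<Phi>\<close> is additive. That the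
  actions of \<open>a\<close> and \<open>b\<close> commute follows from Fubini's theorem, the centrality of \<open>b\<close> and the
  unimodularity of the group.

  Both unimodularity and \<open>D \<noteq> 0\<close> rest on the existence of a nonempty, relatively compact, conjugation
  invariant open set \<open>P\<close> (\<open>[FC]\<^sup>- \<subseteq> [IN]\<close>), obtained from the Baire category theorem: \<open>P + x = x + P\<close>
  forces the modular function to be \<open>1\<close>, and the indicator function of \<open>P\<close> is a central element on which
  \<open>D\<close> does not vanish if \<open>\<phi>\<close> is concentrated near a point of \<open>P\<close> where \<open>\<Phi> \<noteq> 0\<close>.
\<close>

subsection \<open>Locally compact groups\<close>

text \<open>The group is not assumed \<sigma>-compact or metrizable, and \<omega> is only
  measurable; this shapes most of the development. Haar measure need not be \<sigma>-finite, so
  Fubini's theorem is applied on an open \<sigma>-compact subgroup \<open>H\<close> off which the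
  functions at hand vanish almost everywhere; it has to be a subgroup so that the shift
  \<open>- y + x\<close> in a convolution does not leave it. Local bounds for \<omega> from above
  and below come from a Steinhaus argument. The estimate for the derivation rests on
  \<open>- y = z + - (x + y + z) + x\<close>: while \<open>x + y + z\<close> stays in a compact set,
  \<open>\<omega> (- y)\<close> is at most a constant times \<open>\<omega> x * \<omega> z\<close>,
  so the growth condition bounds \<open>\<Phi> y\<close> by a constant times
  \<open>\<omega> x * \<omega> y * \<omega> z\<close>. The localization of \<phi> prevents
  cancellation: \<Phi> is odd and inversion preserves the measure, so the plain integral of \<Phi>
  over a symmetric \<open>P\<close> is 0.\<close>

lemmas group_simps = add.assoc minus_add diff_conv_add_uminus minus_add_cancel add_minus_cancel

lemma left_translation_vimage:
  fixes g :: "'g::group_add"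
  shows "(+) g ` S = (\<lambda>x. - g + x) -` S"
  by (force simp: add.assoc[symmetric] image_iff intro: bexI[where x = "- g + _"])

lemma open_left_translation:
  fixes S :: "'g::topological_group_add set"
  assumes "open S"
  shows "open ((+) g ` S)"
  unfolding left_translation_vimage
  by (intro open_vimage assms continuous_intros)

lemma Hausdorff_space_euclidean_t2: "Hausdorff_space (euclidean :: 'a::t2_space topology)"
  unfolding Hausdorff_space_def by (simp add: disjnt_def) (metis hausdorff)

lemma locally_compact_space_euclidean:
  "locally_compact_space (euclidean :: 'g::locally_compact_group_add topology)"
  unfolding locally_compact_space_def
  by (simp, meson locally_compact)

text \<open>Locally compact Hausdorff spaces are completely regular. These bump functions produce
  open Baire sets below and, at the end, the localizing function \<phi>.\<close>

lemma completely_regular_group: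
  fixes U :: "'g::locally_compact_group_add set"
  assumes "open U" "x \<in> U"
  obtains f :: "'g \<Rightarrow> real"
  where "continuous_on UNIV f" "f x = 1" "\<And>y. y \<notin> U \<Longrightarrow> f y = 0" "\<And>y. f y \<in> {0..1}"
proof -
  have "completely_regular_space (euclidean :: 'g topology)"
    by (intro locally_compact_regular_imp_completely_regular_space locally_compact_space_euclidean)
       (simp add: Hausdorff_space_euclidean_t2)
  then have "\<exists>f. continuous_map euclidean euclideanreal f \<and> f x = 1 \<and> f ` (topspace euclidean - U) \<subseteq> {0}"
    using assms by (simp add: completely_regular_space_gen_alt'[of "1::real" 0])
  then obtain f :: "'g \<Rightarrow> real"
    where f: "continuous_map euclidean euclidean f" "f x = 1" "\<And>y. y \<notin> U \<Longrightarrow> f y = 0"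
    by (auto simp: image_subset_iff)
  show ?thesis
  proof
    \<comment> \<open>Clipping forces the range into the unit interval and keeps the values 0 and
      1.\<close>
    show "continuous_on UNIV (\<lambda>y. max 0 (min 1 (f y)))"
      using f(1) by (intro continuous_intros) auto
  qed (use f in auto)
qed

text \<open>Borel sets of a product need not be product measurable, so joint measurability is obtained
  for continuous functions on \<open>\<sigma>\<close>-compact squares only, by covering compact sets with finitely many
  open boxes. It extends to functions \<open>b(- y + x)\<close> with \<open>b\<close> measurable for the Baire sets, and up to
  null sets every \<open>b\<close> in the Beurling algebra is of this kind.\<close>

lemma compact_open_box_between:
  fixes F W :: "('a::topological_space \<times> 'a) set"
  assumes "compact F" "open W" "F \<subseteq> W"
  shows "\<exists>R\<in>sets (borel \<Otimes>\<^sub>M borel). F \<subseteq> R \<and> R \<subseteq> W"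
proof -
  have "\<forall>p\<in>F. \<exists>A B. open A \<and> open B \<and> p \<in> A \<times> B \<and> A \<times> B \<subseteq> W"
    using assms(2,3) unfolding open_prod_def by blast
  then obtain A B where AB: "\<And>p. p \<in> F \<Longrightarrow> open (A p) \<and> open (B p) \<and> p \<in> A p \<times> B p \<and> A p \<times> B p \<subseteq> W"
    by metis
  obtain D where D: "D \<subseteq> F" "finite D" "F \<subseteq> (\<Union>p\<in>D. A p \<times> B p)"
  proof (rule compactE_image[OF assms(1)])
    show "open (A p \<times> B p)" if "p \<in> F" for p using AB[OF that] by (simp add: open_Times)
    show "F \<subseteq> (\<Union>p\<in>F. A p \<times> B p)" using AB by blast
  qed
  show ?thesis
  proof (intro bexI[of _ "\<Union>p\<in>D. A p \<times> B p"] conjI)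
    show "(\<Union>p\<in>D. A p \<times> B p) \<subseteq> W" using D(1) AB by blast
    show "(\<Union>p\<in>D. A p \<times> B p) \<in> sets (borel \<Otimes>\<^sub>M borel)"
      using D(1,2) AB by (intro sets.finite_UN pair_measureI borel_open) blast+
  qed (rule D)
qed

lemma continuous_measurable_pair:
  fixes f :: "'a::topological_space \<times> 'a \<Rightarrow> real"
  assumes f: "continuous_on UNIV f" and C: "\<And>n. compact (C n)" "incseq C" "S = (\<Union>n. C n)"
  shows "f \<in> borel_measurable (restrict_space (borel \<Otimes>\<^sub>M borel) (S \<times> S))"
  unfolding borel_measurable_iff_greater
proof
  fix c :: real
  \<comment> \<open>The compact sets \<open>?F n\<close> exhaust the superlevel set inside
    \<open>S \<times> S\<close>: the same \<open>n\<close> enlarges the square and lowers the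
    threshold towards \<open>c\<close>, so one countable union of box covers suffices.\<close>
  let ?F = "\<lambda>n. {p \<in> C n \<times> C n. c + 1 / Suc n \<le> f p}"
  have "\<exists>R\<in>sets (borel \<Otimes>\<^sub>M borel). ?F n \<subseteq> R \<and> R \<subseteq> {p. c < f p}" for n
  proof (rule compact_open_box_between)
    have "?F n = (C n \<times> C n) \<inter> {p. c + 1 / Suc n \<le> f p}" by auto
    moreover have "closed {p. c + 1 / Suc n \<le> f p}"
      by (intro closed_Collect_le continuous_intros f)
    ultimately show "compact (?F n)"
      using C(1) by (metis compact_Int_closed compact_Times)
    show "open {p. c < f p}"
      by (intro open_Collect_less continuous_intros f)
    have "0 < 1 / real (Suc n)" by simp
    then show "?F n \<subseteq> {p. c < f p}"
      by (intro subsetI CollectI) (metis (no_types, lifting) less_add_same_cancel1 mem_Collect_eq order_less_le_trans)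
  qed
  then have "\<forall>n. \<exists>R. R \<in> sets (borel \<Otimes>\<^sub>M borel) \<and> ?F n \<subseteq> R \<and> R \<subseteq> {p. c < f p}"
    by blast
  from choice[OF this] obtain R
    where R: "\<And>n. R n \<in> sets (borel \<Otimes>\<^sub>M borel)" "\<And>n. ?F n \<subseteq> R n" "\<And>n. R n \<subseteq> {p. c < f p}"
    by blast
  have *: "\<exists>n. p \<in> ?F n" if p: "p \<in> S \<times> S" "c < f p" for p
  proof -
    obtain i j where ij: "fst p \<in> C i" "snd p \<in> C j" using p C by auto
    obtain k where k: "1 / Suc k < f p - c"
      using nat_approx_posE[of "f p - c"] p by auto
    let ?n = "max (max i j) k"
    have "C i \<subseteq> C ?n" "C j \<subseteq> C ?n" by (rule incseqD[OF C(2)]; simp)+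
    then have "p \<in> C ?n \<times> C ?n" using ij by (cases p) auto
    moreover have "1 / Suc ?n \<le> 1 / Suc k"
      by (intro divide_left_mono) auto
    ultimately show ?thesis using k by (intro exI[of _ ?n]) auto
  qed
  have "{p \<in> S \<times> S. c < f p} \<subseteq> (\<Union>n. R n) \<inter> (S \<times> S)"
  proof (intro subsetI IntI)
    fix p assume p: "p \<in> {p \<in> S \<times> S. c < f p}"
    then obtain n where "p \<in> ?F n" using * by blast
    then show "p \<in> (\<Union>n. R n)" using R(2) by blast
  qed simp
  moreover have "(\<Union>n. R n) \<inter> (S \<times> S) \<subseteq> {p \<in> S \<times> S. c < f p}"
    using R(3) by fast
  ultimately have "{p \<in> S \<times> S. c < f p} = (\<Union>n. R n) \<inter> (S \<times> S)"
    by (rule equalityI)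
  then have "\<exists>A\<in>sets (borel \<Otimes>\<^sub>M borel). {p \<in> S \<times> S. c < f p} = A \<inter> (S \<times> S)"
    using R(1) by (intro bexI[of _ "\<Union>n. R n"]) auto
  then show "{w \<in> space (restrict_space (borel \<Otimes>\<^sub>M borel) (S \<times> S)). c < f w}
      \<in> sets (restrict_space (borel \<Otimes>\<^sub>M borel) (S \<times> S))"
    by (auto simp: sets_restrict_space space_restrict_space space_pair_measure image_iff Int_commute)
qed

text \<open>Generated by the cozero sets, this is the smallest \<sigma>-algebra that makes all
  continuous real functions measurable. Hence a map into it is measurable as soon as its
  compositions with continuous functions are, which fails for Borel sets in general.\<close>

definition baire :: "'a::topological_space measure" where
  "baire = sigma UNIV {{x. 0 < f x} | f. continuous_on UNIV (f :: 'a \<Rightarrow> real)}"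

lemma space_baire [simp]: "space baire = UNIV"
  by (simp add: baire_def)

lemma cozero_baire:
  fixes f :: "'a::topological_space \<Rightarrow> real"
  assumes "continuous_on UNIV f"
  shows "{x. 0 < f x} \<in> sets baire"
  unfolding baire_def using assms by (auto intro!: in_measure_of)

lemma measurable_baireI:
  assumes "\<And>f :: 'a::topological_space \<Rightarrow> real. continuous_on UNIV f \<Longrightarrow> (\<lambda>x. f (g x)) \<in> borel_measurable M"
  shows "g \<in> measurable M (baire :: 'a measure)"
  unfolding baire_def
proof (rule measurable_measure_of)
  fix y assume "y \<in> {{x. 0 < f x} | f. continuous_on UNIV (f :: 'a \<Rightarrow> real)}"
  then obtain f :: "'a \<Rightarrow> real" where f: "y = {x. 0 < f x}" "continuous_on UNIV f" by auto
  have "{x \<in> space M. 0 < f (g x)} \<in> sets M"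
    using assms[OF f(2)] by measurable
  then show "g -` y \<inter> space M \<in> sets M"
    by (auto simp: f vimage_def Int_def conj_commute)
qed auto

lemma measurable_baire_borel: "(\<lambda>x. x) \<in> measurable borel (baire :: 'a::topological_space measure)"
  by (intro measurable_baireI borel_measurable_continuous_onI)

lemma baire_imp_borel: "A \<in> sets baire \<Longrightarrow> A \<in> sets borel"
  using measurable_sets[OF measurable_baire_borel, of A] by simp

lemma borel_measurable_baire: "f \<in> measurable baire N \<Longrightarrow> f \<in> measurable borel N"
  by (rule measurable_compose[OF measurable_baire_borel])

text \<open>Finitely many cozero sets inside \<open>U\<close> cover \<open>K\<close>. Together with
  the regularity of Haar measure this lets Baire sets stand in for Borel sets.\<close>

lemma baire_between:
  fixes K U :: "'g::locally_compact_group_add set"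
  assumes "compact K" "open U" "K \<subseteq> U"
  obtains V where "open V" "V \<in> sets baire" "K \<subseteq> V" "V \<subseteq> U"
proof -
  have "\<exists>f. continuous_on UNIV f \<and> f x = (1::real) \<and> (\<forall>y. y \<notin> U \<longrightarrow> f y = 0)" if "x \<in> K" for x
    using completely_regular_group[of U x] that assms by (metis subsetD)
  then obtain f :: "'g \<Rightarrow> 'g \<Rightarrow> real" where f: "\<And>x. x \<in> K \<Longrightarrow> continuous_on UNIV (f x)"
      "\<And>x. x \<in> K \<Longrightarrow> f x x = 1" "\<And>x y. x \<in> K \<Longrightarrow> y \<notin> U \<Longrightarrow> f x y = 0"
    by metis
  have op: "open {y. 0 < f x y}" if "x \<in> K" for x
    using f(1)[OF that] by (intro open_Collect_less continuous_intros)
  obtain D where D: "D \<subseteq> K" "finite D" "K \<subseteq> (\<Union>x\<in>D. {y. 0 < f x y})"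
  proof (rule compactE_image[OF assms(1)])
    show "K \<subseteq> (\<Union>x\<in>K. {y. 0 < f x y})" using f(2) by auto
  qed (use op in auto)
  show ?thesis
  proof
    show "open (\<Union>x\<in>D. {y. 0 < f x y})" using op D by auto
    show "(\<Union>x\<in>D. {y. 0 < f x y}) \<in> sets baire"
      using D f by (intro sets.finite_UN cozero_baire) auto
    show "(\<Union>x\<in>D. {y. 0 < f x y}) \<subseteq> U"
      using D f(3) by force
  qed (use D in auto)
qed

subsection \<open>\<open>\<sigma>\<close>-compact open subgroups\<close>

text \<open>The exhaustion is increasing so that the squares \<open>C n \<times> C n\<close> exhaust
  \<open>H \<times> H\<close>.\<close>

definition sigma_compact_subgroup :: "'g::topological_group_add set \<Rightarrow> bool" where
  "sigma_compact_subgroup H \<longleftrightarrow> open H \<and> 0 \<in> H \<and> (\<forall>x\<in>H. \<forall>y\<in>H. x - y \<in> H) \<and>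
     (\<exists>C::nat \<Rightarrow> _. (\<forall>n. compact (C n)) \<and> incseq C \<and> H = (\<Union>n. C n))"

lemma sigma_compact_subgroupE:
  assumes "sigma_compact_subgroup H"
  obtains C :: "nat \<Rightarrow> _" where "\<And>n. compact (C n)" "incseq C" "H = (\<Union>n. C n)"
  using assms unfolding sigma_compact_subgroup_def by auto

lemma
  assumes "sigma_compact_subgroup H"
  shows sigma_compact_subgroup_open: "open H"
    and sigma_compact_subgroup_zero: "0 \<in> H"
    and sigma_compact_subgroup_diff: "\<And>x y. x \<in> H \<Longrightarrow> y \<in> H \<Longrightarrow> x - y \<in> H"
    and sigma_compact_subgroup_uminus: "\<And>x. x \<in> H \<Longrightarrow> - x \<in> H"
    and sigma_compact_subgroup_add: "\<And>x y. x \<in> H \<Longrightarrow> y \<in> H \<Longrightarrow> x + y \<in> H"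
proof -
  show 1: "open H" "0 \<in> H" "\<And>x y. x \<in> H \<Longrightarrow> y \<in> H \<Longrightarrow> x - y \<in> H"
    using assms unfolding sigma_compact_subgroup_def by auto
  show 2: "- x \<in> H" if "x \<in> H" for x using 1(3)[of 0 x] 1(2) that by simp
  show "x + y \<in> H" if "x \<in> H" "y \<in> H" for x y using 1(3)[of x "- y"] 2 that by simp
qed

text \<open>The complement of a subgroup is a union of left cosets, which are open together with
  \<open>H\<close>.\<close>

lemma sigma_compact_subgroup_closed:
  assumes "sigma_compact_subgroup H"
  shows "closed H"
proof -
  note H = sigma_compact_subgroup_open[OF assms] sigma_compact_subgroup_zero[OF assms]
    sigma_compact_subgroup_diff[OF assms] sigma_compact_subgroup_add[OF assms]
  have "- H = (\<Union>x\<in>- H. (+) x ` H)"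
  proof (intro set_eqI iffI)
    fix y assume "y \<in> - H"
    then show "y \<in> (\<Union>x\<in>- H. (+) x ` H)" using H(2) by force
  next
    fix y assume "y \<in> (\<Union>x\<in>- H. (+) x ` H)"
    then obtain x h where "x \<notin> H" "h \<in> H" "y = x + h" by auto
    then show "y \<in> - H" using H(3)[of y h] by auto
  qed
  moreover have "open (\<Union>x\<in>- H. (+) x ` H)"
    using open_left_translation[OF H(1)] by auto
  ultimately show ?thesis by (simp add: closed_def)
qed

text \<open>\<open>H\<close> is open and closed, so its indicator is continuous and \<open>H\<close>
  is a cozero set.\<close>

lemma sigma_compact_subgroup_baire:
  fixes H :: "'g::topological_group_add set"
  assumes "sigma_compact_subgroup H"
  shows "H \<in> sets baire"
proof -
  have "continuous_on (H \<union> - H) (\<lambda>x. if x \<in> H then 1 else (0::real))"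
    using sigma_compact_subgroup_open[OF assms] sigma_compact_subgroup_closed[OF assms]
    by (intro continuous_on_open_Un continuous_on_cases_local[of H "- H"]) (auto simp: continuous_on_def)
  then have "continuous_on UNIV (\<lambda>x. if x \<in> H then 1 else (0::real))"
    by (simp add: Un_commute)
  moreover have "{x. 0 < (if x \<in> H then 1 else (0::real))} = H" by auto
  ultimately show ?thesis using cozero_baire by metis
qed

lemma sigma_compact_subgroup_exists:
  fixes K :: "nat \<Rightarrow> 'g::locally_compact_group_add set"
  assumes K: "\<And>n. compact (K n)"
  obtains H where "sigma_compact_subgroup H" "\<And>n. K n \<subseteq> H"
proof -
  obtain U V :: "'g set" where UV: "open U" "compact V" "0 \<in> U" "U \<subseteq> V"
    using locally_compact by metis
  \<comment> \<open>Starting from the compact neighbourhood \<open>V\<close> of 0 makes the union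
    open. Stage \<open>n\<close> adjoins \<open>K n\<close> and takes all differences, so every
    stage is compact and the union is closed under differences.\<close>
  define C where "C = rec_nat V (\<lambda>n D. (\<lambda>(x, y). x - y) ` ((D \<union> K n) \<times> (D \<union> K n)))"
  have C0: "C 0 = V" and CS: "\<And>n. C (Suc n) = (\<lambda>(x, y). x - y) ` ((C n \<union> K n) \<times> (C n \<union> K n))"
    by (simp_all add: C_def)
  have cC: "compact (C n)" for n
  proof (induction n)
    case (Suc n)
    then show ?case unfolding CS case_prod_beta
      by (intro compact_continuous_image compact_Times compact_Un K continuous_intros)
  qed (simp add: C0 UV)
  have z: "0 \<in> C n" for n
    by (induction n) (use UV in \<open>auto simp: C0 CS intro!: image_eqI[where x="(0,0)"]\<close>)
  have sub: "C n \<union> K n \<subseteq> C (Suc n)" for n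
    using z[of n] by (force simp: CS intro: image_eqI[where x="(_,0)"])
  have inc: "incseq C" using sub by (auto intro: incseq_SucI)
  define H where "H = (\<Union>n. C n)"
  have diff: "x - y \<in> H" if xy: "x \<in> H" "y \<in> H" for x y
  proof -
    obtain i j where ij: "x \<in> C i" "y \<in> C j" using xy unfolding H_def by blast
    then have "x \<in> C (max i j)" "y \<in> C (max i j)" using inc
      by (meson incseqD in_mono max.cobounded1 max.cobounded2)+
    then have "x - y \<in> C (Suc (max i j))" by (force simp: CS)
    then show ?thesis by (auto simp: H_def)
  qed
  have 0: "0 \<in> H" using z by (auto simp: H_def)
  have UH: "U \<subseteq> H" using UV C0 by (auto simp: H_def)
  have "H = (\<Union>x\<in>H. (+) x ` U)"
  proof (intro set_eqI iffI)
    fix y assume "y \<in> H"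
    then show "y \<in> (\<Union>x\<in>H. (+) x ` U)" using UV by force
  next
    fix y assume "y \<in> (\<Union>x\<in>H. (+) x ` U)"
    then obtain x h where xh: "x \<in> H" "h \<in> H" "y = x + h" using UH by auto
    then show "y \<in> H" using diff[of 0 h] diff[of x "- h"] 0 by auto
  qed
  moreover have "open (\<Union>x\<in>H. (+) x ` U)"
    using open_left_translation[OF UV(1)] by auto
  ultimately have "open H" by simp
  then have "sigma_compact_subgroup H"
    unfolding sigma_compact_subgroup_def using cC inc diff 0 H_def by blast
  moreover have "K n \<subseteq> H" for n using sub[of n] by (auto simp: H_def)
  ultimately show ?thesis by (rule that)
qed

lemma continuous_measurable_into_baire:
  fixes H :: "'g::topological_group_add set" and T :: "'g \<times> 'g \<Rightarrow> 'g"
  assumes "sigma_compact_subgroup H" "continuous_on UNIV T"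
  shows "T \<in> measurable (restrict_space (borel \<Otimes>\<^sub>M borel) (H \<times> H)) baire"
proof (rule measurable_baireI)
  fix f :: "'g \<Rightarrow> real" assume f: "continuous_on UNIV f"
  obtain C :: "nat \<Rightarrow> 'g set" where C: "\<And>n. compact (C n)" "incseq C" "H = (\<Union>n. C n)"
    using sigma_compact_subgroupE[OF assms(1)] by metis
  have "continuous_on UNIV (\<lambda>p. f (T p))"
    using continuous_on_compose2[OF f assms(2)] by auto
  from continuous_measurable_pair[OF this C]
  show "(\<lambda>x. f (T x)) \<in> borel_measurable (restrict_space (borel \<Otimes>\<^sub>M borel) (H \<times> H))" .
qed


subsection \<open>Relatively compact conjugation invariant open sets\<close>

text \<open>The Baire category theorem is applied to the sets \<open>B n\<close> of those \<open>x\<close> whose conjugacy class does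
  not contain \<open>n + 1\<close> points separated by a fixed compact neighbourhood \<open>C\<close> of \<open>0\<close>. Near a point
  with a maximal separated family of conjugates, the same conjugators yield such a family.\<close>

lemma FC_bar_invariant_open:
  fixes F :: "'g::locally_compact_group_add set"
  assumes FC: "FC_bar_group TYPE('g)" and F: "closed F" "interior F \<noteq> {}"
  obtains P p where "open P" "p \<in> P" "p \<in> F" "compact (closure P)"
    "\<And>g x. x \<in> P \<Longrightarrow> g + x - g \<in> P"
proof -
  obtain U V :: "'g set" where UV: "open U" "compact V" "0 \<in> U" "U \<subseteq> V"
    using locally_compact by metis
  \<comment> \<open>Symmetrized because exchanging the first two arguments of \<open>d\<close>
    negates its value.\<close>
  define C where "C = V \<union> uminus ` V"
  have cC: "compact C" unfolding C_def
    by (intro compact_Un compact_continuous_image UV continuous_intros)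
  have sC: "- c \<in> C" if "c \<in> C" for c using that by (auto simp: C_def)
  \<comment> \<open>The left quotient of two conjugates of \<open>x\<close>:
    \<open>d g h x \<in> C\<close> means that the conjugate by \<open>h\<close> lies in the
    translate of \<open>C\<close> by the conjugate by \<open>g\<close>.\<close>
  define d where "d = (\<lambda>g h x :: 'g. - (g + x - g) + (h + x - h))"
  have d: "continuous_on UNIV (d g h)" for g h
    unfolding d_def by (intro continuous_intros)
  define B where "B n = {x. \<forall>g::nat \<Rightarrow> 'g. \<exists>i\<in>{..n}. \<exists>j\<in>{..n}. i \<noteq> j \<and> d (g i) (g j) x \<in> C}" for n
  have cB: "closed (B n)" for n
  proof -
    have "B n = (\<Inter>g. \<Union>(i, j)\<in>{p \<in> {..n} \<times> {..n}. fst p \<noteq> snd p}. d (g i) (g j) -` C)"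
      by (fastforce simp: B_def)
    then show ?thesis
      using closed_vimage[OF compact_imp_closed[OF cC] d] by (auto intro!: closed_INT closed_UN)
  qed
  have "\<exists>n. x \<in> B n" for x
  proof -
    \<comment> \<open>Continuity of the quotient at \<open>(0, 0)\<close>: two points in one
      translate of \<open>M \<inter> N\<close> have their left quotient in \<open>U\<close>, hence
      in \<open>C\<close>.\<close>
    have "open ((\<lambda>p :: 'g \<times> 'g. - fst p + snd p) -` U)"
      by (intro open_vimage UV continuous_intros)
    moreover have "(0, 0) \<in> (\<lambda>p :: 'g \<times> 'g. - fst p + snd p) -` U" using UV by simp
    ultimately obtain M N where MN': "open M" "open N" "(0, 0) \<in> M \<times> N"
      "M \<times> N \<subseteq> (\<lambda>p :: 'g \<times> 'g. - fst p + snd p) -` U"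
      by (rule open_prod_elim)
    then have MN: "open M" "open N" "0 \<in> M" "0 \<in> N" "\<And>m n. m \<in> M \<Longrightarrow> n \<in> N \<Longrightarrow> - m + n \<in> U"
      by auto
    have "compact (closure {g + x - g | g. True})"
      using FC by (simp add: FC_bar_group_def)
    then obtain D where D: "finite D"
      "closure {g + x - g | g. True} \<subseteq> (\<Union>c\<in>D. (+) c ` (M \<inter> N))"
    proof (rule compactE_image)
      show "open ((+) c ` (M \<inter> N))" for c by (intro open_left_translation open_Int MN)
      show "closure {g + x - g | g. True} \<subseteq> (\<Union>c\<in>UNIV. (+) c ` (M \<inter> N))"
      proof
        fix y show "y \<in> (\<Union>c\<in>UNIV. (+) c ` (M \<inter> N))"
          using MN by (auto intro!: exI[of _ y] image_eqI[of _ _ 0])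
      qed
    qed auto
    \<comment> \<open>Pigeonhole: \<open>{..card D}\<close> has one index more than there are
      translates.\<close>
    have "\<exists>i\<in>{..card D}. \<exists>j\<in>{..card D}. i \<noteq> j \<and> d (g i) (g j) x \<in> C" for g
    proof -
      have "\<exists>c. c \<in> D \<and> g i + x - g i \<in> (+) c ` (M \<inter> N)" for i
      proof -
        have "g i + x - g i \<in> closure {g + x - g | g. True}"
          by (rule subsetD[OF closure_subset]) auto
        then show ?thesis using D(2) by blast
      qed
      then obtain c where c: "\<And>i. c i \<in> D" "\<And>i. g i + x - g i \<in> (+) (c i) ` (M \<inter> N)"
        by metis
      have "\<not> inj_on c {..card D}"
      proof
        assume "inj_on c {..card D}"
        then have "card {..card D} \<le> card D"
          by (rule card_inj_on_le) (use c D in auto)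
        then show False by simp
      qed
      then obtain i j where ij: "i \<le> card D" "j \<le> card D" "i \<noteq> j" "c i = c j"
        by (auto simp: inj_on_def)
      obtain m where m: "m \<in> M" "g i + x - g i = c i + m" using c(2)[of i] by auto
      obtain n where n: "n \<in> N" "g j + x - g j = c i + n" using c(2)[of j] ij by auto
      have "d (g i) (g j) x = - m + n"
        unfolding d_def m n by (simp add: group_simps del: add_uminus_conv_diff)
      moreover have "- m + n \<in> U" using MN m n by auto
      ultimately show ?thesis using ij UV unfolding C_def
        by (metis (no_types, lifting) UnI1 atMost_iff subsetD)
    qed
    then have "x \<in> B (card D)" by (simp add: B_def)
    then show ?thesis ..
  qed
  then have FB: "(\<Union>n. B n \<inter> F) = F" by auto
  have "\<exists>n. interior (B n \<inter> F) \<noteq> {}"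
  proof (rule ccontr)
    assume "\<not> ?thesis"
    moreover have "locally_compact_space (euclidean :: 'g topology)" "regular_space (euclidean :: 'g topology)"
      using locally_compact_space_euclidean Hausdorff_space_euclidean_t2
        locally_compact_Hausdorff_imp_regular_space by auto
    ultimately have "euclidean interior_of \<Union>(range (\<lambda>n. B n \<inter> F)) = {}"
      by (intro Baire_category_alt) (auto simp: F cB closed_Int)
    then have "interior (\<Union>n. B n \<inter> F) = {}" by simp
    then show False using F(2) unfolding FB by simp
  qed
  \<comment> \<open>With \<open>n = Suc k\<close> least, some interior point \<open>p\<close> lies
    outside \<open>B k\<close>: it has \<open>k + 1\<close> separated conjugates, whereas no point
    of \<open>B n\<close> has \<open>k + 2\<close>.\<close>
  define n where "n = (LEAST n. interior (B n \<inter> F) \<noteq> {})"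
  have n: "interior (B n \<inter> F) \<noteq> {}" "\<And>k. k < n \<Longrightarrow> interior (B k \<inter> F) = {}"
    unfolding n_def using LeastI_ex[OF \<open>\<exists>n. interior (B n \<inter> F) \<noteq> {}\<close>] not_less_Least by blast+
  have "B 0 = {}" by (auto simp: B_def)
  with n(1) obtain k where k: "n = Suc k" by (cases n) auto
  have "\<not> interior (B n \<inter> F) \<subseteq> B k"
  proof
    assume "interior (B n \<inter> F) \<subseteq> B k"
    then have "interior (B n \<inter> F) \<subseteq> interior (B k \<inter> F)"
      using interior_subset[of "B n \<inter> F"] by (intro interior_maximal) auto
    then show False using n k by auto
  qed
  then obtain p where p: "p \<in> interior (B n \<inter> F)" and "p \<notin> B k" by blast
  then obtain g where g: "\<And>i j. i \<le> k \<Longrightarrow> j \<le> k \<Longrightarrow> i \<noteq> j \<Longrightarrow> d (g i) (g j) p \<notin> C"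
    unfolding B_def by auto
  obtain U' V' where UV': "open U'" "compact V'" "p \<in> U'" "U' \<subseteq> V'"
    using locally_compact by metis
  \<comment> \<open>Separation is an open condition since \<open>C\<close> is closed, so the
    conjugators \<open>g\<close> found for \<open>p\<close> also give separated conjugates of every
    point of \<open>W\<close>; \<open>U'\<close> keeps \<open>W\<close> inside the compact set
    \<open>V'\<close>.\<close>
  define W where "W = interior (B n \<inter> F) \<inter> U' \<inter>
    (\<Inter>(i, j)\<in>{p \<in> {..k} \<times> {..k}. fst p \<noteq> snd p}. d (g i) (g j) -` (- C))"
  have "open W"
    unfolding W_def
    by (intro open_Int open_interior UV' open_INT) (auto intro!: open_vimage d compact_imp_closed cC)
  have pW: "p \<in> W" unfolding W_def using p g UV' by auto
  define P where "P = (\<Union>h. (\<lambda>x. - h + x + h) -` W)"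
  show ?thesis
  proof
    show "open P"
      unfolding P_def using \<open>open W\<close> by (auto intro!: open_vimage continuous_intros)
    show "p \<in> P" using pW by (auto simp: P_def intro!: exI[of _ 0])
    show "p \<in> F" using p interior_subset by blast
    show "h + x - h \<in> P" if "x \<in> P" for h x
    proof -
      from that obtain h' where "- h' + x + h' \<in> W" by (auto simp: P_def)
      moreover have "- (h + h') + (h + x - h) + (h + h') = - h' + x + h'"
        by (simp add: group_simps del: add_uminus_conv_diff)
      ultimately show ?thesis unfolding P_def by (intro UN_I[of "h + h'"]) simp_all
    qed
    let ?K = "\<Union>i\<in>{..k}. (\<lambda>p. (g i + fst p - g i) + snd p) ` (V' \<times> C)"
    have cK: "compact ?K"
      by (intro compact_UN finite_atMost compact_continuous_image compact_Times UV' cC continuous_intros)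
    have "P \<subseteq> ?K"
    proof
      fix y assume "y \<in> P"
      then obtain h where h: "- h + y + h \<in> W" by (auto simp: P_def)
      define x where "x = - h + y + h"
      have y: "y = h + x - h" by (simp add: x_def add.assoc diff_conv_add_uminus del: add_uminus_conv_diff)
      have x: "x \<in> B n" "x \<in> V'" "\<And>i j. i \<le> k \<Longrightarrow> j \<le> k \<Longrightarrow> i \<noteq> j \<Longrightarrow> d (g i) (g j) x \<notin> C"
        using h UV' interior_subset[of "B n \<inter> F"] by (auto simp: x_def W_def)
      \<comment> \<open>Appending \<open>h\<close> yields \<open>k + 2\<close> conjugates of
        \<open>x\<close>, too many to be separated. The first \<open>k + 1\<close> are, so the
        conjugate by \<open>h\<close> is \<open>C\<close>-close to one of them, which places
        \<open>y\<close> in one of finitely many compact sets.\<close>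
      have "\<exists>i\<in>{..n}. \<exists>j\<in>{..n}. i \<noteq> j \<and> d ((g(n := h)) i) ((g(n := h)) j) x \<in> C"
        using x(1) unfolding B_def by blast
      then obtain i j where ij: "i \<le> n" "j \<le> n" "i \<noteq> j" "d ((g(n := h)) i) ((g(n := h)) j) x \<in> C"
        by auto
      have "d (g j) h x = - d h (g j) x" for j
        by (simp add: d_def minus_add add.assoc diff_conv_add_uminus del: add_uminus_conv_diff)
      then have "\<exists>i\<le>k. d (g i) h x \<in> C"
        using ij x(3)[of i j] k sC[of "d h (g j) x"] by (auto simp: le_Suc_eq split: if_splits)
      then obtain i where i: "i \<le> k" "d (g i) h x \<in> C" by auto
      have "y = (g i + fst (x, d (g i) h x) - g i) + snd (x, d (g i) h x)"
        unfolding y d_def by (simp add: group_simps del: add_uminus_conv_diff)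
      then show "y \<in> ?K"
        using i x(2) by (intro UN_I[of i] image_eqI[of _ _ "(x, d (g i) h x)"] SigmaI atMost_iff[THEN iffD2])
    qed
    then have "closure P \<subseteq> ?K" by (intro closure_minimal compact_imp_closed cK)
    then have "?K \<inter> closure P = closure P" by (rule Int_absorb1)
    then show "compact (closure P)" using compact_Int_closed[OF cK closed_closure, of P] by argo
  qed
qed

subsection \<open>Regularity and invariance of Haar measure\<close>

lemma uminus_borel:
  fixes A :: "'g::topological_group_add set"
  assumes "A \<in> sets borel"
  shows "uminus ` A \<in> sets borel"
proof -
  have "uminus ` A = uminus -` A" by (force simp: image_iff intro: bexI[of _ "- _"])
  also have "\<dots> \<in> sets borel"
    using measurable_sets[OF borel_measurable_continuous_onI[of "uminus :: 'g \<Rightarrow> 'g"] assms]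
    by (simp add: continuous_on_minus)
  finally show ?thesis .
qed

lemma joint_measurable_ennreal:
  fixes h :: "'g::topological_group_add \<Rightarrow> ennreal" and T :: "'g \<times> 'g \<Rightarrow> 'g"
  assumes "sigma_compact_subgroup H" "continuous_on UNIV T" "h \<in> borel_measurable baire"
  shows "(\<lambda>p. h (T p) * indicator (H \<times> H) p) \<in> borel_measurable (borel \<Otimes>\<^sub>M borel)"
proof -
  have "(\<lambda>p. h (T p)) \<in> borel_measurable (restrict_space (borel \<Otimes>\<^sub>M borel) (H \<times> H))"
    using continuous_measurable_into_baire[OF assms(1,2)] assms(3) by (rule measurable_compose)
  moreover have "H \<in> sets borel" using sigma_compact_subgroup_open[OF assms(1)] by auto
  then have "H \<times> H \<in> sets (borel \<Otimes>\<^sub>M borel)" by (auto intro: pair_measureI)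
  ultimately show ?thesis
    by (subst (asm) borel_measurable_restrict_space_iff_ennreal) (auto simp: space_pair_measure)
qed

lemma joint_measurable_complex:
  fixes h :: "'g::topological_group_add \<Rightarrow> complex" and T :: "'g \<times> 'g \<Rightarrow> 'g"
  assumes "sigma_compact_subgroup H" "continuous_on UNIV T" "h \<in> borel_measurable baire"
  shows "(\<lambda>p. indicator (H \<times> H) p *\<^sub>R h (T p)) \<in> borel_measurable (borel \<Otimes>\<^sub>M borel)"
proof -
  have "(\<lambda>p. h (T p)) \<in> borel_measurable (restrict_space (borel \<Otimes>\<^sub>M borel) (H \<times> H))"
    using continuous_measurable_into_baire[OF assms(1,2)] assms(3) by (rule measurable_compose)
  moreover have "H \<in> sets borel" using sigma_compact_subgroup_open[OF assms(1)] by auto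
  then have "H \<times> H \<in> sets (borel \<Otimes>\<^sub>M borel)" by (auto intro: pair_measureI)
  ultimately show ?thesis
    by (subst (asm) borel_measurable_restrict_space_iff) (auto simp: space_pair_measure)
qed

locale haar_measure =
  fixes \<mu> :: "'g::locally_compact_group_add measure"
  assumes left_haar: "left_haar_measure \<mu>"
begin

lemma sets_haar [simp, measurable_cong]: "sets \<mu> = sets borel"
  and emeasure_compact_finite: "compact K \<Longrightarrow> emeasure \<mu> K < \<infinity>"
  and outer_regular: "A \<in> sets borel \<Longrightarrow> emeasure \<mu> A = (INF U\<in>{U. open U \<and> A \<subseteq> U}. emeasure \<mu> U)"
  and inner_regular: "open U \<Longrightarrow> emeasure \<mu> U = (SUP K\<in>{K. compact K \<and> K \<subseteq> U}. emeasure \<mu> K)"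
  and left_invariant: "A \<in> sets borel \<Longrightarrow> emeasure \<mu> ((+) g ` A) = emeasure \<mu> A"
  and emeasure_UNIV_nonzero: "emeasure \<mu> UNIV \<noteq> 0"
  using left_haar unfolding left_haar_measure_def by (elim conjE; simp)+

lemma space_haar [simp]: "space \<mu> = UNIV"
  using sets_eq_imp_space_eq[OF sets_haar] by simp

lemma measurable_haar_eq: "measurable \<mu> N = measurable borel N" "measurable N \<mu> = measurable N borel"
  by (intro measurable_cong_sets refl sets_haar)+

declare borel_compact [measurable]

text \<open>The translates of a null open set are null, and finitely many of them cover any given
  compact set; by inner regularity the whole group would be null.\<close>

lemma emeasure_open_pos:
  assumes "open U" "U \<noteq> {}"
  shows "0 < emeasure \<mu> U"
proof (rule ccontr)
  assume "\<not> ?thesis"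
  then have 0: "emeasure \<mu> U = 0" by simp
  obtain u where u: "u \<in> U" using assms by auto
  have "emeasure \<mu> K = 0" if K: "compact K" for K
  proof -
    obtain D where D: "D \<subseteq> UNIV" "finite D" "K \<subseteq> (\<Union>c\<in>D. (+) c ` U)"
    proof (rule compactE_image[OF K])
      show "open ((+) c ` U)" for c by (intro open_left_translation assms)
      show "K \<subseteq> (\<Union>c\<in>UNIV. (+) c ` U)"
      proof
        fix y show "y \<in> (\<Union>c\<in>UNIV. (+) c ` U)"
          using u by (intro UN_I[of "y - u"] image_eqI[of _ _ u]) auto
      qed
    qed auto
    have "emeasure \<mu> K \<le> emeasure \<mu> (\<Union>c\<in>D. (+) c ` U)"
      using D assms by (intro emeasure_mono) (auto intro!: open_left_translation borel_open)
    also have "\<dots> \<le> (\<Sum>c\<in>D. emeasure \<mu> ((+) c ` U))"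
      using D assms by (intro emeasure_subadditive_finite) (auto intro!: open_left_translation borel_open)
    also have "\<dots> = 0" using assms by (simp add: left_invariant 0 borel_open)
    finally show ?thesis by simp
  qed
  then have "emeasure \<mu> UNIV = 0"
    by (subst inner_regular) (auto intro!: SUP_eq_const)
  then show False using emeasure_UNIV_nonzero by simp
qed

lemma outer_approx:
  assumes "A \<in> sets borel" "emeasure \<mu> A < \<infinity>" "0 < e"
  obtains U where "open U" "A \<subseteq> U" "emeasure \<mu> (U - A) < e" "emeasure \<mu> U < emeasure \<mu> A + e"
proof -
  have "emeasure \<mu> A < emeasure \<mu> A + e"
    using assms by (simp add: ennreal_add_left_cancel_less[of _ 0, simplified])
  then have "(INF U\<in>{U. open U \<and> A \<subseteq> U}. emeasure \<mu> U) < emeasure \<mu> A + e"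
    using outer_regular[OF assms(1)] by simp
  then obtain U where U: "open U" "A \<subseteq> U" "emeasure \<mu> U < emeasure \<mu> A + e"
    unfolding INF_less_iff by auto
  have "emeasure \<mu> A + emeasure \<mu> (U - A) = emeasure \<mu> U"
    using U assms(1) by (subst plus_emeasure) (auto simp: Un_absorb1)
  then have "emeasure \<mu> (U - A) < e"
    using U(3) by (metis ennreal_add_left_cancel_less)
  with U show ?thesis by (intro that) auto
qed

lemma inner_approx_open:
  assumes "open U" "emeasure \<mu> U < \<infinity>" and e: "0 < (e::real)"
  obtains K where "compact K" "K \<subseteq> U" "emeasure \<mu> (U - K) < e"
proof (cases "emeasure \<mu> U = 0")
  case True
  then show ?thesis using assms by (intro that[of "{}"]) auto
next
  case False
  have "emeasure \<mu> U - ennreal e < emeasure \<mu> U"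
    using False assms by (intro ennreal_between) (auto simp: zero_less_iff_neq_zero)
  then obtain K where K: "compact K" "K \<subseteq> U" "emeasure \<mu> U - e < emeasure \<mu> K"
    using inner_regular[OF assms(1)] by (auto simp: less_SUP_iff)
  have eq: "emeasure \<mu> K + emeasure \<mu> (U - K) = emeasure \<mu> U"
    using K assms(1) by (subst plus_emeasure) (auto simp: Un_absorb1 borel_compact)
  have fin: "emeasure \<mu> K < top" "emeasure \<mu> (U - K) < top"
    using assms(2) unfolding eq[symmetric] by simp_all
  obtain k d where kd: "emeasure \<mu> K = ennreal k" "0 \<le> k" "emeasure \<mu> (U - K) = ennreal d" "0 \<le> d"
    using fin by (metis ennreal_cases less_irrefl)
  have "ennreal (k + d - e) < ennreal k"
    using K(3) e kd unfolding eq[symmetric] by (simp add: ennreal_plus[symmetric] ennreal_minus del: ennreal_plus)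
  then have "d < e" using ennreal_leI[of k "k + d - e"] by (meson add_le_cancel_left leD leI le_diff_eq)
  then have "emeasure \<mu> (U - K) < e" using kd e by (simp add: ennreal_lessI)
  with K show ?thesis by (intro that) auto
qed

text \<open>Inner regularity is postulated for open sets only. A compact subset \<open>L\<close> of
  an open \<open>U \<supseteq> A\<close> is therefore diminished by an open set that covers
  \<open>U - A\<close> with small excess.\<close>

lemma inner_approx:
  assumes A: "A \<in> sets borel" "emeasure \<mu> A < \<infinity>" and e: "0 < (e::real)"
  obtains K where "compact K" "K \<subseteq> A" "emeasure \<mu> (A - K) < e"
proof -
  obtain U where U: "open U" "A \<subseteq> U" "emeasure \<mu> U < emeasure \<mu> A + 1"
    by (rule outer_approx[OF A zero_less_one]) (rule that)
  have Ufin: "emeasure \<mu> U < \<infinity>"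
    using less_trans[OF U(3), of top] A(2) by simp
  have half: "0 < e / 2" using e by simp
  obtain L where L: "compact L" "L \<subseteq> U" "emeasure \<mu> (U - L) < ennreal (e / 2)"
    using inner_approx_open[OF U(1) Ufin half] by blast
  have e2: "0 < ennreal (e / 2)" using e by simp
  have UA: "U - A \<in> sets borel" using A U by auto
  have "emeasure \<mu> (U - A) \<le> emeasure \<mu> U"
    using U by (intro emeasure_mono) auto
  then have UAf: "emeasure \<mu> (U - A) < \<infinity>" using Ufin by (rule le_less_trans)
  obtain O' where O: "open O'" "U - A \<subseteq> O'" "emeasure \<mu> (O' - (U - A)) < ennreal (e / 2)"
    by (rule outer_approx[OF UA UAf e2]) (rule that)
  have "compact (L - O')" using L O by (simp add: compact_diff)
  moreover have "L - O' \<subseteq> A" using L O by auto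
  moreover have "emeasure \<mu> (A - (L - O')) < e"
  proof -
    have "emeasure \<mu> (A - (L - O')) \<le> emeasure \<mu> ((U - L) \<union> (O' - (U - A)))"
      using U L O A by (intro emeasure_mono) (auto simp: borel_compact)
    also have "\<dots> \<le> emeasure \<mu> (U - L) + emeasure \<mu> (O' - (U - A))"
      using U L O A by (intro emeasure_subadditive) (auto simp: borel_compact)
    also have "\<dots> < ennreal (e / 2) + ennreal (e / 2)"
      by (intro add_strict_mono L O)
    also have "\<dots> = e" using e by (subst ennreal_plus[symmetric]) auto
    finally show ?thesis .
  qed
  ultimately show ?thesis by (rule that)
qed

lemma distr_left: "distr \<mu> borel ((+) g) = \<mu>"
proof (rule measure_eqI)
  fix A assume "A \<in> sets (distr \<mu> borel ((+) g))"
  then have A: "A \<in> sets borel" by simp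
  have "(+) g \<in> measurable \<mu> borel"
    unfolding measurable_haar_eq by (intro borel_measurable_continuous_onI continuous_intros)
  then have "emeasure (distr \<mu> borel ((+) g)) A = emeasure \<mu> ((+) g -` A)"
    using A by (simp add: emeasure_distr)
  also have "(+) g -` A = (+) (- g) ` A"
    by (simp add: left_translation_vimage)
  finally show "emeasure (distr \<mu> borel ((+) g)) A = emeasure \<mu> A"
    using left_invariant[OF A] by simp
qed simp

lemma nn_integral_left:
  assumes "f \<in> borel_measurable borel"
  shows "(\<integral>\<^sup>+x. f (g + x) \<partial>\<mu>) = (\<integral>\<^sup>+x. f x \<partial>\<mu>)"
proof -
  have "(\<integral>\<^sup>+x. f x \<partial>distr \<mu> borel ((+) g)) = (\<integral>\<^sup>+x. f (g + x) \<partial>\<mu>)"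
    by (rule nn_integral_distr)
       (auto simp: assms measurable_haar_eq intro!: borel_measurable_continuous_onI continuous_intros)
  then show ?thesis by (simp add: distr_left)
qed

text \<open>The restriction to \<open>H\<close>, written as a density so that the underlying space
  and the measurable sets remain those of the group. For \<sigma>-compact \<open>H\<close> it is
  \<sigma>-finite.\<close>

definition part :: "'g set \<Rightarrow> 'g measure" where
  "part H = density \<mu> (indicator H)"

lemma sets_part [simp, measurable_cong]: "sets (part H) = sets borel"
  by (simp add: part_def)

lemma space_part [simp]: "space (part H) = UNIV"
  by (simp add: part_def)

lemma nn_integral_part:
  assumes "H \<in> sets borel" "f \<in> borel_measurable borel" "\<And>x. x \<notin> H \<Longrightarrow> f x = 0"
  shows "(\<integral>\<^sup>+x. f x \<partial>part H) = (\<integral>\<^sup>+x. f x \<partial>\<mu>)"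
proof -
  have "(\<integral>\<^sup>+x. f x \<partial>part H) = (\<integral>\<^sup>+x. indicator H x * f x \<partial>\<mu>)"
    unfolding part_def using assms by (intro nn_integral_density) (auto simp: measurable_haar_eq)
  also have "\<dots> = (\<integral>\<^sup>+x. f x \<partial>\<mu>)"
    by (intro nn_integral_cong) (auto simp: assms(3) indicator_def)
  finally show ?thesis .
qed

lemma nn_integral_part_indicator:
  assumes "H \<in> sets borel" "V \<in> sets borel" "V \<subseteq> H"
  shows "(\<integral>\<^sup>+x. indicator V x * c \<partial>part H) = emeasure \<mu> V * c"
proof -
  have "indicator V x = (0 :: ennreal)" if "x \<notin> H" for x
    using that assms(3) unfolding indicator_def by (simp add: subset_iff) blast
  then have "(\<integral>\<^sup>+x. indicator V x * c \<partial>part H) = (\<integral>\<^sup>+x. indicator V x * c \<partial>\<mu>)"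
    using assms by (intro nn_integral_part) auto
  also have "\<dots> = emeasure \<mu> V * c"
    using assms by (simp add: nn_integral_multc measurable_haar_eq)
  finally show ?thesis .
qed

lemma sigma_finite_part:
  assumes "sigma_compact_subgroup H"
  shows "sigma_finite_measure (part H)"
proof
  obtain C :: "nat \<Rightarrow> 'g set" where C: "\<And>n. compact (C n)" "incseq C" "H = (\<Union>n. C n)"
    using sigma_compact_subgroupE[OF assms] by metis
  have H: "H \<in> sets borel" using sigma_compact_subgroup_open[OF assms] by auto
  have em: "emeasure (part H) A = emeasure \<mu> (H \<inter> A)" if "A \<in> sets borel" for A
    unfolding part_def using H that
    by (subst emeasure_density) (auto simp: measurable_haar_eq indicator_inter_arith[symmetric])
  have "emeasure (part H) (C n) \<noteq> \<infinity>" for n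
    using emeasure_compact_finite[OF compact_Int_closed[OF C(1) sigma_compact_subgroup_closed[OF assms]], of n]
    by (simp add: em borel_compact C(1) Int_commute)
  \<comment> \<open>The space is still the whole group, so the null set \<open>- H\<close> has to
    complete the countable cover.\<close>
  moreover have "emeasure (part H) (- H) \<noteq> \<infinity>" using H by (simp add: em)
  ultimately show "\<exists>A. countable A \<and> A \<subseteq> sets (part H) \<and> \<Union> A = space (part H) \<and> (\<forall>a\<in>A. emeasure (part H) a \<noteq> \<infinity>)"
    using C H by (intro exI[of _ "insert (- H) (range C)"]) (auto simp: borel_compact)
qed

lemma Fubini_part:
  assumes H: "sigma_compact_subgroup H" and f: "f \<in> borel_measurable (borel \<Otimes>\<^sub>M borel)"
  shows "(\<integral>\<^sup>+y. (\<integral>\<^sup>+x. f (x, y) \<partial>part H) \<partial>part H) = (\<integral>\<^sup>+x. (\<integral>\<^sup>+y. f (x, y) \<partial>part H) \<partial>part H)"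
proof -
  interpret sigma_finite_measure "part H" by (rule sigma_finite_part[OF H])
  interpret pair_sigma_finite "part H" "part H" ..
  have "f \<in> borel_measurable (part H \<Otimes>\<^sub>M part H)"
    using f by (simp cong: measurable_cong_sets sets_pair_measure_cong)
  then show ?thesis by (rule Fubini)
qed

end

section \<open>Unimodularity\<close>

locale FC_haar_measure = haar_measure \<mu> for \<mu> :: "'g::locally_compact_group_add measure" +
  assumes FC: "FC_bar_group TYPE('g)"
begin

text \<open>Both sides come from the measure of the pairs with \<open>x \<in> V\<close> and
  \<open>- y + x \<in> U\<close>. Integrating over \<open>y\<close> first gives the left side
  exactly. Replacing \<open>x\<close> by \<open>y + x\<close> turns the conditions into
  \<open>x \<in> U\<close> and \<open>y + x \<in> V\<close>; invariance of \<open>P\<close> under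
  conjugation then replaces \<open>y + x \<in> P\<close> by \<open>x + y \<in> P\<close>, to which
  left invariance applies.\<close>

lemma emeasure_uminus_aux:
  assumes H: "sigma_compact_subgroup H" and P: "open P" "\<And>g x. x \<in> P \<Longrightarrow> g + x - g \<in> P"
    and V: "V \<in> sets baire" "V \<subseteq> P" "V \<subseteq> H" and U: "U \<in> sets baire" "U \<subseteq> H"
  shows "emeasure \<mu> V * emeasure \<mu> (uminus ` U) \<le> emeasure \<mu> U * emeasure \<mu> P"
proof -
  note Hs = sigma_compact_subgroup_uminus[OF H] sigma_compact_subgroup_add[OF H]
  have Hb: "H \<in> sets borel" using sigma_compact_subgroup_open[OF H] by auto
  note b = baire_imp_borel[OF V(1)] baire_imp_borel[OF U(1)]
  let ?f = "\<lambda>(x, y). indicator V x * (indicator U (- y + x) * indicator (H \<times> H) (x, y)) :: ennreal"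
  let ?g = "\<lambda>(x, y). indicator U x * (indicator V (y + x) * indicator (H \<times> H) (x, y)) :: ennreal"
  have f: "?f \<in> borel_measurable (borel \<Otimes>\<^sub>M borel)"
  proof -
    have [measurable]: "(\<lambda>p. indicator U (- snd p + fst p) * indicator (H \<times> H) p :: ennreal)
        \<in> borel_measurable (borel \<Otimes>\<^sub>M borel)"
      by (rule joint_measurable_ennreal[OF H, of "\<lambda>p. - snd p + fst p"])
         (auto intro!: continuous_intros borel_measurable_indicator U)
    show ?thesis unfolding split_beta' prod.collapse using b by measurable
  qed
  have g: "?g \<in> borel_measurable (borel \<Otimes>\<^sub>M borel)"
  proof -
    have [measurable]: "(\<lambda>p. indicator V (snd p + fst p) * indicator (H \<times> H) p :: ennreal)
        \<in> borel_measurable (borel \<Otimes>\<^sub>M borel)"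
      by (rule joint_measurable_ennreal[OF H, of "\<lambda>p. snd p + fst p"])
         (auto intro!: continuous_intros borel_measurable_indicator V)
    show ?thesis unfolding split_beta' prod.collapse using b by measurable
  qed
  have fx: "(\<integral>\<^sup>+y. ?f (x, y) \<partial>part H) = indicator V x * emeasure \<mu> (uminus ` U)" for x
  proof (cases "x \<in> V")
    case True
    then have x: "x \<in> H" using V by auto
    have "(\<lambda>y. ?f (x, y)) \<in> borel_measurable borel" using f by measurable
    then have "(\<integral>\<^sup>+y. ?f (x, y) \<partial>part H) = (\<integral>\<^sup>+y. ?f (x, y) \<partial>\<mu>)"
      using Hb by (intro nn_integral_part) auto
    also have "\<dots> = (\<integral>\<^sup>+y. indicator ((+) x ` (uminus ` U)) y \<partial>\<mu>)"
    proof (rule nn_integral_cong)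
      fix y
      have "- y + x \<in> U \<longleftrightarrow> y \<in> (+) x ` (uminus ` U)"
        unfolding image_image
        by (auto intro!: image_eqI[of _ _ "- y + x"] simp: group_simps simp del: add_uminus_conv_diff)
      moreover have "y \<in> H" if "- y + x \<in> U"
      proof -
        have "y = x + - (- y + x)" by (simp add: group_simps del: add_uminus_conv_diff)
        then show ?thesis using that x Hs U by (metis subsetD)
      qed
      ultimately show "?f (x, y) = indicator ((+) x ` (uminus ` U)) y"
        using True x by (auto simp: indicator_def)
    qed
    also have "\<dots> = emeasure \<mu> ((+) x ` (uminus ` U))"
    proof (rule nn_integral_indicator)
      have "(+) x ` (uminus ` U) = (\<lambda>y. - x + y) -` (uminus ` U)" by (rule left_translation_vimage)
      also have "\<dots> \<in> sets borel"
        using measurable_sets[OF borel_measurable_continuous_onI[of "\<lambda>y. - x + y"] uminus_borel[OF b(2)]]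
        by (simp add: continuous_on_add)
      finally show "(+) x ` (uminus ` U) \<in> sets \<mu>" by simp
    qed
    also have "\<dots> = emeasure \<mu> (uminus ` U)" by (rule left_invariant[OF uminus_borel[OF b(2)]])
    finally show ?thesis using True by simp
  qed simp
  have "emeasure \<mu> V * emeasure \<mu> (uminus ` U) = (\<integral>\<^sup>+x. indicator V x * emeasure \<mu> (uminus ` U) \<partial>part H)"
    using Hb b V by (simp add: nn_integral_part_indicator)
  also have "\<dots> = (\<integral>\<^sup>+x. \<integral>\<^sup>+y. ?f (x, y) \<partial>part H \<partial>part H)"
    by (simp only: fx)
  also have "\<dots> = (\<integral>\<^sup>+y. \<integral>\<^sup>+x. ?f (x, y) \<partial>part H \<partial>part H)"
    by (rule Fubini_part[OF H f, symmetric])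
  also have "\<dots> = (\<integral>\<^sup>+y. \<integral>\<^sup>+x. ?g (x, y) \<partial>part H \<partial>part H)"
  proof (rule nn_integral_cong)
    fix y
    have m: "(\<lambda>x. ?f (x, y)) \<in> borel_measurable borel" "(\<lambda>x. ?g (x, y)) \<in> borel_measurable borel"
      using f g by measurable
    then have "(\<integral>\<^sup>+x. ?f (x, y) \<partial>part H) = (\<integral>\<^sup>+x. ?f (x, y) \<partial>\<mu>)"
      using Hb by (intro nn_integral_part) auto
    also have "\<dots> = (\<integral>\<^sup>+x. ?f (y + x, y) \<partial>\<mu>)"
      by (rule nn_integral_left[OF m(1), symmetric])
    also have "\<dots> = (\<integral>\<^sup>+x. ?g (x, y) \<partial>\<mu>)"
      by (intro nn_integral_cong)
         (use U V Hs in \<open>auto simp: indicator_def add.assoc[symmetric] subset_iff\<close>)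
    also have "\<dots> = (\<integral>\<^sup>+x. ?g (x, y) \<partial>part H)"
      using Hb m by (intro nn_integral_part[symmetric]) auto
    finally show "(\<integral>\<^sup>+x. ?f (x, y) \<partial>part H) = (\<integral>\<^sup>+x. ?g (x, y) \<partial>part H)" .
  qed
  also have "\<dots> = (\<integral>\<^sup>+x. \<integral>\<^sup>+y. ?g (x, y) \<partial>part H \<partial>part H)"
    by (rule Fubini_part[OF H g])
  also have "\<dots> \<le> (\<integral>\<^sup>+x. indicator U x * emeasure \<mu> P \<partial>part H)"
  proof (rule nn_integral_mono)
    fix x
    have "(\<lambda>y. ?g (x, y)) \<in> borel_measurable borel" using g by measurable
    then have "(\<integral>\<^sup>+y. ?g (x, y) \<partial>part H) = (\<integral>\<^sup>+y. ?g (x, y) \<partial>\<mu>)"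
      using Hb by (intro nn_integral_part) auto
    also have "\<dots> \<le> (\<integral>\<^sup>+y. indicator U x * indicator P (x + y) \<partial>\<mu>)"
    proof (rule nn_integral_mono)
      fix y
      have "x + y \<in> P" if "y + x \<in> P"
        using P(2)[OF that, of x] by (simp add: group_simps del: add_uminus_conv_diff)
      then show "?g (x, y) \<le> indicator U x * indicator P (x + y)"
        using V by (auto simp: indicator_def)
    qed
    also have "\<dots> = indicator U x * (\<integral>\<^sup>+y. indicator P (x + y) \<partial>\<mu>)"
    proof (rule nn_integral_cmult)
      have "(+) x \<in> measurable borel borel"
        by (intro borel_measurable_continuous_onI continuous_intros)
      from measurable_compose[OF this, of "indicator P :: _ \<Rightarrow> ennreal" borel]
      show "(\<lambda>y. indicator P (x + y) :: ennreal) \<in> borel_measurable \<mu>"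
        using P(1) by (simp add: measurable_haar_eq)
    qed
    also have "(\<integral>\<^sup>+y. indicator P (x + y) \<partial>\<mu>) = emeasure \<mu> P"
      using P(1) nn_integral_left[of "indicator P" x] by simp
    finally show "(\<integral>\<^sup>+y. ?g (x, y) \<partial>part H) \<le> indicator U x * emeasure \<mu> P" .
  qed
  also have "\<dots> = emeasure \<mu> U * emeasure \<mu> P"
    using Hb b U by (simp add: nn_integral_part_indicator)
  finally show ?thesis .
qed

text \<open>The modular function is trivial since the relatively compact open set \<open>P\<close> satisfies
  \<open>P + x = x + P\<close>.\<close>

lemma emeasure_uminus:
  assumes A: "A \<in> sets borel"
  shows "emeasure \<mu> (uminus ` A) = emeasure \<mu> A"
proof -
  obtain P :: "'g set" and p where P: "open P" "p \<in> P" "compact (closure P)" "\<And>g x. x \<in> P \<Longrightarrow> g + x - g \<in> P"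
    using FC_bar_invariant_open[OF FC, of UNIV] by auto
  have Pfin: "emeasure \<mu> P < \<infinity>"
    using emeasure_mono[OF closure_subset, of P \<mu>] emeasure_compact_finite[OF P(3)] by (auto intro: le_less_trans)
  have Ppos: "emeasure \<mu> P \<noteq> 0" using emeasure_open_pos[OF P(1)] P(2) by (metis empty_iff less_irrefl)
  \<comment> \<open>Between a compact and an open set there is room for a Baire set
    \<open>U'\<close>, to which the estimate applies. Compact sets \<open>L \<subseteq> P\<close>
    approximate the measure of \<open>P\<close>, which cancels because it is positive and
    finite.\<close>
  have 1: "emeasure \<mu> (uminus ` K) \<le> emeasure \<mu> U" if K: "compact K" "open U" "K \<subseteq> U" for K U
  proof -
    obtain H where H: "sigma_compact_subgroup H" "closure P \<union> K \<subseteq> H"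
      using sigma_compact_subgroup_exists[of "\<lambda>_. closure P \<union> K"] P K by auto
    obtain U' where U': "open U'" "U' \<in> sets baire" "K \<subseteq> U'" "U' \<subseteq> U \<inter> H"
      using baire_between[of K "U \<inter> H"] K H sigma_compact_subgroup_open[OF H(1)] by auto
    have "emeasure \<mu> L * emeasure \<mu> (uminus ` U') \<le> emeasure \<mu> U' * emeasure \<mu> P"
      if L: "compact L" "L \<subseteq> P" for L
    proof -
      obtain V where V: "open V" "V \<in> sets baire" "L \<subseteq> V" "V \<subseteq> P"
        using baire_between[of L P] L P by auto
      have "emeasure \<mu> L * emeasure \<mu> (uminus ` U') \<le> emeasure \<mu> V * emeasure \<mu> (uminus ` U')"
        using V by (intro mult_right_mono emeasure_mono) auto
      also have "\<dots> \<le> emeasure \<mu> U' * emeasure \<mu> P"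
        using V U' H closure_subset[of P] by (intro emeasure_uminus_aux[OF H(1) P(1,4)]) auto
      finally show ?thesis .
    qed
    then have "(SUP L\<in>{L. compact L \<and> L \<subseteq> P}. emeasure \<mu> L * emeasure \<mu> (uminus ` U')) \<le> emeasure \<mu> U' * emeasure \<mu> P"
      by (intro SUP_least) auto
    then have "emeasure \<mu> P * emeasure \<mu> (uminus ` U') \<le> emeasure \<mu> P * emeasure \<mu> U'"
      by (subst inner_regular[OF P(1)]) (simp add: SUP_mult_right_ennreal[symmetric] mult.commute)
    then have "emeasure \<mu> (uminus ` U') \<le> emeasure \<mu> U'"
      using Ppos Pfin by (simp add: ennreal_mult_le_mult_iff)
    moreover have "emeasure \<mu> (uminus ` K) \<le> emeasure \<mu> (uminus ` U')"
      using U' by (intro emeasure_mono image_mono) (auto intro: uminus_borel)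
    moreover have "emeasure \<mu> U' \<le> emeasure \<mu> U" using U' K by (intro emeasure_mono) auto
    ultimately show ?thesis by simp
  qed
  \<comment> \<open>Inner regularity leads from compact to open sets, outer regularity then from
    open to Borel sets. Applied to \<open>A\<close> and to its reflection, the inequality becomes an
    equality.\<close>
  have 2: "emeasure \<mu> (uminus ` U) \<le> emeasure \<mu> U" if "open U" for U
  proof -
    have "uminus ` U = uminus -` U" by (force simp: image_iff intro: bexI[of _ "- _"])
    then have o: "open (uminus ` U)" using that by (auto intro!: open_vimage continuous_intros)
    show ?thesis
      unfolding inner_regular[OF o]
    proof (intro SUP_least)
      fix K assume "K \<in> {K. compact K \<and> K \<subseteq> uminus ` U}"
      then have "compact (uminus ` K)" "uminus ` K \<subseteq> U"
        by (auto intro!: compact_continuous_image continuous_intros)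
      from 1[OF this(1) that this(2)] show "emeasure \<mu> K \<le> emeasure \<mu> U" by (simp add: image_image)
    qed
  qed
  have 3: "emeasure \<mu> (uminus ` A) \<le> emeasure \<mu> A" if "A \<in> sets borel" for A
    unfolding outer_regular[OF that]
  proof (intro INF_greatest)
    fix U assume U: "U \<in> {U. open U \<and> A \<subseteq> U}"
    then have "emeasure \<mu> (uminus ` A) \<le> emeasure \<mu> (uminus ` U)"
      by (intro emeasure_mono image_mono) (auto intro: uminus_borel)
    also have "\<dots> \<le> emeasure \<mu> U" using U 2 by auto
    finally show "emeasure \<mu> (uminus ` A) \<le> emeasure \<mu> U" .
  qed
  show ?thesis
    using 3[OF A] 3[OF uminus_borel[OF A]] by (simp add: image_image)
qed

lemma distr_uminus: "distr \<mu> borel uminus = \<mu>"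
proof (rule measure_eqI)
  fix A assume "A \<in> sets (distr \<mu> borel uminus)"
  then have A: "A \<in> sets borel" by simp
  have "uminus \<in> measurable \<mu> borel"
    unfolding measurable_haar_eq by (intro borel_measurable_continuous_onI continuous_intros)
  then have "emeasure (distr \<mu> borel uminus) A = emeasure \<mu> (uminus -` A)"
    using A by (simp add: emeasure_distr)
  also have "uminus -` A = uminus ` A" by (force simp: image_iff intro: bexI[of _ "- _"])
  finally show "emeasure (distr \<mu> borel uminus) A = emeasure \<mu> A"
    using emeasure_uminus[OF A] by simp
qed simp

text \<open>Right translation is left translation conjugated by inversion.\<close>

lemma distr_right: "distr \<mu> borel (\<lambda>x. x + g) = \<mu>"
proof -
  have m: "uminus \<in> measurable borel (borel :: 'g measure)" "(+) (- g) \<in> measurable borel (borel :: 'g measure)"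
    by (intro borel_measurable_continuous_onI continuous_intros)+
  have m': "uminus \<in> measurable \<mu> borel" "(+) (- g) \<circ> uminus \<in> measurable \<mu> borel"
    unfolding measurable_haar_eq using m by (auto intro: measurable_comp)
  have "\<mu> = distr (distr (distr \<mu> borel uminus) borel ((+) (- g))) borel uminus"
    by (simp add: distr_uminus distr_left)
  also have "\<dots> = distr \<mu> borel (uminus \<circ> ((+) (- g) \<circ> uminus))"
    unfolding distr_distr[OF m(2) m'(1)] distr_distr[OF m(1) m'(2)] ..
  also have "uminus \<circ> ((+) (- g) \<circ> uminus) = (\<lambda>x. x + g)"
    by (auto simp: group_simps simp del: add_uminus_conv_diff)
  finally show ?thesis by (rule sym)
qed

end

subsection \<open>Local boundedness of weights\<close>

context haar_measure
begin

text \<open>Take an open \<open>W \<supseteq> K\<close> of measure less than twice that of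
  \<open>K\<close>. For \<open>g\<close> near 0 the translate of \<open>K\<close> stays in
  \<open>W\<close> by compactness, and two disjoint copies of \<open>K\<close> do not fit
  there.\<close>

lemma steinhaus:
  assumes K: "compact K" "0 < emeasure \<mu> K"
  obtains U where "open U" "0 \<in> U" "\<And>g. g \<in> U \<Longrightarrow> \<exists>x\<in>K. g + x \<in> K"
proof -
  have Kb: "K \<in> sets borel" using K by (simp add: borel_compact)
  obtain W where W: "open W" "K \<subseteq> W" "emeasure \<mu> W < emeasure \<mu> K + emeasure \<mu> K"
    by (rule outer_approx[OF Kb emeasure_compact_finite[OF K(1)] K(2)]) (rule that)
  have "open ((\<lambda>p :: 'g \<times> 'g. fst p + snd p) -` W)"
    by (intro open_vimage W continuous_intros)
  then obtain U where U: "0 \<in> U" "open U" "U \<times> K \<subseteq> (\<lambda>p. fst p + snd p) -` W"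
    using Elementary_Topology.tube_lemma[OF K(1), of _ 0] W(2) by (force simp: subset_iff)
  show ?thesis
  proof (rule that[OF U(2,1)], rule ccontr)
    fix g assume g: "g \<in> U" "\<not> (\<exists>x\<in>K. g + x \<in> K)"
    have gK: "(+) g ` K \<in> sets borel"
      using K by (auto intro!: borel_compact compact_continuous_image continuous_intros)
    have "emeasure \<mu> K + emeasure \<mu> K = emeasure \<mu> ((+) g ` K) + emeasure \<mu> K"
      by (simp add: left_invariant[OF Kb])
    also have "\<dots> = emeasure \<mu> ((+) g ` K \<union> K)"
      using g gK Kb by (intro plus_emeasure) auto
    also have "\<dots> \<le> emeasure \<mu> W"
      using U(3) W g by (intro emeasure_mono) auto
    finally show False using W(3) by simp
  qed
qed

end

lemma weight_ge_1:
  assumes "weight \<omega>"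
  shows "1 \<le> \<omega> 0" "1 \<le> \<omega> x * \<omega> (- x)"
proof -
  have w: "0 < \<omega> x" "\<omega> (x + y) \<le> \<omega> x * \<omega> y" for x y using assms by (auto simp: weight_def)
  show 1: "1 \<le> \<omega> 0" using w(2)[of 0 0] w(1)[of 0] by simp
  show "1 \<le> \<omega> x * \<omega> (- x)" using w(2)[of x "- x"] 1 by simp
qed

context haar_measure
begin

text \<open>By measurability, \<omega> and its reflection are bounded by some \<open>n\<close> on a
  set of positive measure. By Steinhaus every \<open>g\<close> near 0 is
  \<open>(g + x) + (- x)\<close> with \<open>g + x\<close> and \<open>x\<close> in that set, so
  \<omega> is at most \<open>n * n\<close> near 0; finitely many translates of this neighbourhood
  cover \<open>K\<close>.\<close>

lemma weight_bounded:
  fixes \<omega> :: "'g \<Rightarrow> real"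
  assumes w: "weight \<omega>" and K: "compact K"
  obtains M where "0 < M" "\<And>x. x \<in> K \<Longrightarrow> \<omega> x \<le> M"
proof -
  have w': "\<omega> \<in> borel_measurable borel" "\<And>x. 0 < \<omega> x" "\<And>x y. \<omega> (x + y) \<le> \<omega> x * \<omega> y"
    using w by (auto simp: weight_def)
  obtain U V :: "'g set" where UV: "open U" "compact V" "0 \<in> U" "U \<subseteq> V"
    using locally_compact by metis
  have Vb: "V \<in> sets borel" using UV by (simp add: borel_compact)
  have "0 < emeasure \<mu> V"
    using emeasure_open_pos[OF UV(1)] emeasure_mono[OF UV(4), of \<mu>] UV Vb by (auto intro: less_le_trans)
  define E where "E n = {x \<in> V. \<omega> x \<le> real n \<and> \<omega> (- x) \<le> real n}" for n
  have [measurable]: "\<omega> \<in> borel_measurable borel" "(\<lambda>x. \<omega> (- x)) \<in> borel_measurable borel" "V \<in> sets borel"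
    using w'(1) Vb measurable_compose[OF borel_measurable_continuous_onI[OF continuous_on_minus[OF continuous_on_id]] w'(1)]
    by auto
  have Eb: "E n \<in> sets borel" for n unfolding E_def by measurable
  have "\<exists>n. emeasure \<mu> (E n) \<noteq> 0"
  proof (rule ccontr)
    assume "\<not> ?thesis"
    then have "emeasure \<mu> (\<Union>n. E n) = 0" using Eb by (intro emeasure_UN_eq_0) auto
    moreover have "V = (\<Union>n. E n)"
    proof -
      have "x \<in> E (nat \<lceil>max (\<omega> x) (\<omega> (- x))\<rceil>)" if "x \<in> V" for x
        using that real_nat_ceiling_ge[of "max (\<omega> x) (\<omega> (- x))"] by (auto simp: E_def)
      then show ?thesis by (auto simp: E_def)
    qed
    ultimately show False using \<open>0 < emeasure \<mu> V\<close> by simp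
  qed
  then obtain n where n: "emeasure \<mu> (E n) \<noteq> 0" by auto
  have "emeasure \<mu> (E n) \<le> emeasure \<mu> V" using Vb by (intro emeasure_mono) (auto simp: E_def)
  then have Ef: "emeasure \<mu> (E n) < \<infinity>" using emeasure_compact_finite[OF UV(2)] by (rule le_less_trans)
  then obtain r where r: "emeasure \<mu> (E n) = ennreal r" "0 < r"
    using n by (cases "emeasure \<mu> (E n)") (auto simp: less_le)
  obtain L where L: "compact L" "L \<subseteq> E n" "emeasure \<mu> (E n - L) < ennreal r"
    by (rule inner_approx[OF Eb Ef r(2)]) (rule that)
  have "0 < emeasure \<mu> L"
  proof (rule ccontr)
    assume "\<not> ?thesis"
    then have "emeasure \<mu> L = 0" by simp
    then have "emeasure \<mu> (E n - L) = emeasure \<mu> (E n)"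
      using L Eb by (intro emeasure_Diff_null_set) (auto simp: null_sets_def borel_compact)
    then show False using L(3) r by simp
  qed
  then obtain W where W: "open W" "0 \<in> W" "\<And>g. g \<in> W \<Longrightarrow> \<exists>x\<in>L. g + x \<in> L"
    using steinhaus[OF L(1)] by metis
  have Wn: "\<omega> g \<le> real n * real n" if g: "g \<in> W" for g
  proof -
    obtain x where x: "x \<in> L" "g + x \<in> L" using W(3)[OF g] by auto
    have "\<omega> g \<le> \<omega> (g + x) * \<omega> (- x)" using w'(3)[of "g + x" "- x"] by (simp add: add.assoc)
    also have "\<dots> \<le> real n * real n"
      using x L(2) w'(2) by (intro mult_mono) (auto simp: E_def less_imp_le)
    finally show ?thesis .
  qed
  obtain D where D: "D \<subseteq> UNIV" "finite D" "K \<subseteq> (\<Union>c\<in>D. (+) c ` W)"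
  proof (rule compactE_image[OF K])
    show "open ((+) c ` W)" for c by (intro open_left_translation W)
    show "K \<subseteq> (\<Union>c\<in>UNIV. (+) c ` W)"
    proof
      fix y show "y \<in> (\<Union>c\<in>UNIV. (+) c ` W)"
        using W by (intro UN_I[of y] image_eqI[of _ _ 0]) auto
    qed
  qed auto
  show ?thesis
  proof
    \<comment> \<open>The summand 1 keeps the bound positive even if \<open>D\<close> is
      empty.\<close>
    show "0 < (\<Sum>c\<in>D. \<omega> c) * (real n * real n) + 1"
      using w'(2) by (intro add_nonneg_pos mult_nonneg_nonneg sum_nonneg) (auto simp: less_imp_le)
    fix x assume "x \<in> K"
    then obtain c g where c: "c \<in> D" "g \<in> W" "x = c + g" using D by auto
    have "\<omega> x \<le> \<omega> c * \<omega> g" using w'(3) c by simp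
    also have "\<dots> \<le> (\<Sum>c\<in>D. \<omega> c) * (real n * real n)"
      using c D w'(2) Wn[OF c(2)]
      by (intro mult_mono member_le_sum sum_nonneg) (auto simp: less_imp_le)
    finally show "\<omega> x \<le> (\<Sum>c\<in>D. \<omega> c) * (real n * real n) + 1" by simp
  qed
qed

text \<open>Combines \<open>1 \<le> \<omega> x * \<omega> (- x)\<close> with the upper bound on the
  reflected compact set.\<close>

lemma weight_bounded_below:
  fixes \<omega> :: "'g \<Rightarrow> real"
  assumes w: "weight \<omega>" and K: "compact K"
  obtains m where "0 < m" "\<And>x. x \<in> K \<Longrightarrow> m \<le> \<omega> x"
proof -
  have "compact (uminus ` K)" using K by (intro compact_continuous_image continuous_intros)
  then obtain M where M: "0 < M" "\<And>x. x \<in> uminus ` K \<Longrightarrow> \<omega> x \<le> M"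
    using weight_bounded[OF w] by metis
  show ?thesis
  proof
    show "0 < 1 / M" using M by simp
    fix x assume "x \<in> K"
    then have "\<omega> (- x) \<le> M" using M by auto
    moreover have "0 < \<omega> x" using w by (simp add: weight_def)
    ultimately have "\<omega> x * \<omega> (- x) \<le> \<omega> x * M" by (intro mult_left_mono) auto
    then have "1 \<le> \<omega> x * M" using weight_ge_1(2)[OF w, of x] by linarith
    then show "1 / M \<le> \<omega> x" using M by (simp add: divide_le_eq mult.commute)
  qed
qed

subsection \<open>Baire representatives\<close>

text \<open>Sandwich \<open>A\<close> between compact and open sets with gaps of measure below
  \<open>(1/2) ^ n\<close> and insert Baire sets \<open>V n\<close>. By Borel-Cantelli almost every
  point lies in only finitely many gaps; outside the gaps \<open>V n\<close> agrees with
  \<open>A\<close>, so the limit superior of the sets \<open>V n\<close> serves.\<close>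

lemma baire_version_finite:
  assumes A: "A \<in> sets borel" "emeasure \<mu> A < \<infinity>"
  shows "\<exists>A'\<in>sets baire. AE x in \<mu>. x \<in> A \<longleftrightarrow> x \<in> A'"
proof -
  define P where "P n K U V \<longleftrightarrow> compact K \<and> open U \<and> V \<in> sets baire \<and> K \<subseteq> V \<and> V \<subseteq> U \<and> K \<subseteq> A \<and>
      A \<subseteq> U \<and> emeasure \<mu> (U - K) < ennreal ((1/2) ^ n)" for n :: nat and K U V
  have "\<forall>n. \<exists>K U V. P n K U V"
  proof
    fix n
    have p: "0 < (1/2 :: real) ^ Suc n" "0 < ennreal ((1/2) ^ Suc n)" by simp_all
    obtain K where K: "compact K" "K \<subseteq> A" "emeasure \<mu> (A - K) < ennreal ((1/2) ^ Suc n)"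
      by (rule inner_approx[OF A p(1)]) (rule that)
    obtain U where U: "open U" "A \<subseteq> U" "emeasure \<mu> (U - A) < ennreal ((1/2) ^ Suc n)"
      by (rule outer_approx[OF A p(2)]) (rule that)
    have KU: "K \<subseteq> U" by (rule order_trans[OF K(2) U(2)])
    obtain V where V: "V \<in> sets baire" "K \<subseteq> V" "V \<subseteq> U"
      by (rule baire_between[OF K(1) U(1) KU]) (rule that)
    have "emeasure \<mu> (U - K) \<le> emeasure \<mu> ((U - A) \<union> (A - K))"
      using A K U by (intro emeasure_mono) (auto simp: borel_compact)
    also have "\<dots> \<le> emeasure \<mu> (U - A) + emeasure \<mu> (A - K)"
      using A K U by (intro emeasure_subadditive) (auto simp: borel_compact)
    also have "\<dots> < ennreal ((1/2) ^ Suc n) + ennreal ((1/2) ^ Suc n)"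
      by (intro add_strict_mono K U)
    also have "\<dots> = ennreal ((1/2) ^ n)" by (subst ennreal_plus[symmetric]) auto
    finally have "P n K U V" unfolding P_def by (intro conjI K U V)
    then show "\<exists>K U V. P n K U V" by blast
  qed
  from choice[OF this] obtain K where "\<forall>n. \<exists>U V. P n (K n) U V" by blast
  from choice[OF this] obtain U where "\<forall>n. \<exists>V. P n (K n) (U n) V" by blast
  from choice[OF this] obtain V where "\<forall>n. P n (K n) (U n) (V n)" by blast
  then have KUV: "\<And>n. compact (K n)" "\<And>n. open (U n)" "\<And>n. V n \<in> sets baire"
    "\<And>n. K n \<subseteq> V n" "\<And>n. V n \<subseteq> U n" "\<And>n. K n \<subseteq> A" "\<And>n. A \<subseteq> U n"
    "\<And>n. emeasure \<mu> (U n - K n) < ennreal ((1/2) ^ n)"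
    unfolding P_def by blast+
  have ae: "AE x in \<mu>. eventually (\<lambda>n. x \<in> space \<mu> - (U n - K n)) sequentially"
  proof (rule borel_cantelli_AE1)
    show "U n - K n \<in> sets \<mu>" for n using KUV by (auto simp: borel_compact)
    show "emeasure \<mu> (U n - K n) < \<infinity>" for n
      using less_trans[OF KUV(8)[of n], of top] by simp
    have "measure \<mu> (U n - K n) \<le> (1/2) ^ n" for n
      using KUV(8)[of n] unfolding measure_def by (intro enn2real_leI) auto
    then show "summable (\<lambda>n. measure \<mu> (U n - K n))"
      by (intro summable_comparison_test'[OF summable_geometric[of "1/2"], of 0]) auto
  qed
  show ?thesis
  proof (intro bexI)
    show "(\<Inter>m. \<Union>n\<in>{m..}. V n) \<in> sets baire" using KUV(3) by auto
    show "AE x in \<mu>. x \<in> A \<longleftrightarrow> x \<in> (\<Inter>m. \<Union>n\<in>{m..}. V n)"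
      using ae
    proof eventually_elim
      case (elim x)
      then obtain N where N: "\<And>n. n \<ge> N \<Longrightarrow> x \<notin> U n \<or> x \<in> K n"
        by (auto simp: eventually_sequentially)
      then have V: "x \<in> V n \<longleftrightarrow> x \<in> A" if "n \<ge> N" for n
        using KUV(4,5,6,7)[of n] N[OF that] by blast
      show ?case
      proof
        assume "x \<in> A"
        then have "x \<in> (\<Union>n\<in>{m..}. V n)" for m
          using V by (intro UN_I[of "max N m"]) auto
        then show "x \<in> (\<Inter>m. \<Union>n\<in>{m..}. V n)" by blast
      next
        assume "x \<in> (\<Inter>m. \<Union>n\<in>{m..}. V n)"
        then obtain n where "n \<ge> N" "x \<in> V n" by blast
        then show "x \<in> A" using V by simp
      qed
    qed
  qed
qed

lemma baire_version_set:
  assumes H: "sigma_compact_subgroup H" and A: "A \<in> sets borel"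
  shows "\<exists>A'\<in>sets baire. AE x in \<mu>. x \<in> H \<longrightarrow> (x \<in> A \<longleftrightarrow> x \<in> A')"
proof -
  obtain C :: "nat \<Rightarrow> 'g set" where C: "\<And>n. compact (C n)" "incseq C" "H = (\<Union>n. C n)"
    using sigma_compact_subgroupE[OF H] by metis
  have "\<exists>A'\<in>sets baire. AE x in \<mu>. x \<in> A \<inter> C n \<longleftrightarrow> x \<in> A'" for n
  proof (rule baire_version_finite)
    show "A \<inter> C n \<in> sets borel" using A C by (auto simp: borel_compact)
    have "emeasure \<mu> (A \<inter> C n) \<le> emeasure \<mu> (C n)" using C by (intro emeasure_mono) (auto simp: borel_compact)
    then show "emeasure \<mu> (A \<inter> C n) < \<infinity>" using emeasure_compact_finite[OF C(1)] by (rule le_less_trans)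
  qed
  then obtain B where B: "\<And>n. B n \<in> sets baire" "\<And>n. AE x in \<mu>. x \<in> A \<inter> C n \<longleftrightarrow> x \<in> B n"
    by metis
  have "AE x in \<mu>. \<forall>n. x \<in> A \<inter> C n \<longleftrightarrow> x \<in> B n" using B(2) by (subst AE_all_countable) auto
  then have "AE x in \<mu>. x \<in> H \<longrightarrow> (x \<in> A \<longleftrightarrow> x \<in> (\<Union>n. B n))"
    by eventually_elim (auto simp: C(3))
  moreover have "(\<Union>n. B n) \<in> sets baire" using B by auto
  ultimately show ?thesis by (rule bexI)
qed

lemma baire_version_ennreal:
  fixes f :: "'g \<Rightarrow> ennreal"
  assumes H: "sigma_compact_subgroup H" and f: "f \<in> borel_measurable borel"
  shows "\<exists>f'\<in>borel_measurable baire. AE x in \<mu>. x \<in> H \<longrightarrow> f x = f' x"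
  using f
proof (induction rule: borel_measurable_induct)
  case (cong f g)
  then show ?case by simp
next
  case (set A)
  then obtain A' where A': "A' \<in> sets baire" "AE x in \<mu>. x \<in> H \<longrightarrow> (x \<in> A \<longleftrightarrow> x \<in> A')"
    using baire_version_set[OF H] by auto
  from A'(2) have "AE x in \<mu>. x \<in> H \<longrightarrow> indicator A x = (indicator A' x :: ennreal)"
    by eventually_elim (auto simp: indicator_def)
  then show ?case using A'(1) by (intro bexI[of _ "indicator A'"]) auto
next
  case (mult u c)
  then obtain u' where u': "u' \<in> borel_measurable baire" "AE x in \<mu>. x \<in> H \<longrightarrow> u x = u' x" by auto
  from u'(2) have "AE x in \<mu>. x \<in> H \<longrightarrow> c * u x = c * u' x" by eventually_elim auto
  then show ?case using u'(1) by (intro bexI[of _ "\<lambda>x. c * u' x"]) auto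
next
  case (add u v)
  then obtain u' v' where u': "u' \<in> borel_measurable baire" "AE x in \<mu>. x \<in> H \<longrightarrow> u x = u' x"
    and v': "v' \<in> borel_measurable baire" "AE x in \<mu>. x \<in> H \<longrightarrow> v x = v' x" by auto
  from u'(2) v'(2) have "AE x in \<mu>. x \<in> H \<longrightarrow> v x + u x = v' x + u' x" by eventually_elim auto
  then show ?case using u'(1) v'(1) by (intro bexI[of _ "\<lambda>x. v' x + u' x"]) auto
next
  case (seq U)
  then have "\<forall>i. \<exists>u'. u' \<in> borel_measurable baire \<and> (AE x in \<mu>. x \<in> H \<longrightarrow> U i x = u' x)" by blast
  from choice[OF this] obtain U' where U': "\<And>i. U' i \<in> borel_measurable baire"
    "\<And>i. AE x in \<mu>. x \<in> H \<longrightarrow> U i x = U' i x" by blast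
  have "AE x in \<mu>. \<forall>i. x \<in> H \<longrightarrow> U i x = U' i x" using U'(2) by (subst AE_all_countable) auto
  then have "AE x in \<mu>. x \<in> H \<longrightarrow> (SUP i. U i) x = (SUP i. U' i x)"
    by eventually_elim (auto simp: SUP_apply image_image)
  then show ?case using U'(1) by (intro bexI[of _ "\<lambda>x. SUP i. U' i x"]) auto
qed

lemma baire_version_real:
  fixes f :: "'g \<Rightarrow> real"
  assumes H: "sigma_compact_subgroup H" and f: "f \<in> borel_measurable (completion \<mu>)"
  shows "\<exists>f'\<in>borel_measurable baire. AE x in \<mu>. x \<in> H \<longrightarrow> f x = f' x"
proof -
  obtain g where g: "g \<in> borel_measurable \<mu>" "AE x in \<mu>. f x = g x"
    using completion_ex_borel_measurable_real[OF f] by auto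
  \<comment> \<open>\<open>ennreal\<close> sends negative numbers to 0, so these are the positive
    and the negative part of \<open>g\<close>.\<close>
  have "(\<lambda>x. ennreal (g x)) \<in> borel_measurable borel" "(\<lambda>x. ennreal (- g x)) \<in> borel_measurable borel"
    using g(1) by (simp_all add: measurable_haar_eq)
  from this[THEN baire_version_ennreal[OF H]] obtain p q
    where p: "p \<in> borel_measurable baire" "AE x in \<mu>. x \<in> H \<longrightarrow> ennreal (g x) = p x"
      and q: "q \<in> borel_measurable baire" "AE x in \<mu>. x \<in> H \<longrightarrow> ennreal (- g x) = q x"
    by auto
  from g(2) p(2) q(2) have "AE x in \<mu>. x \<in> H \<longrightarrow> f x = enn2real (p x) - enn2real (q x)"
  proof eventually_elim
    case (elim x)
    show ?case
    proof
      assume "x \<in> H"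
      then have "p x = ennreal (g x)" "q x = ennreal (- g x)" "f x = g x" using elim by auto
      then show "f x = enn2real (p x) - enn2real (q x)"
        by (cases "0 \<le> g x") (auto simp: ennreal_neg)
    qed
  qed
  then show ?thesis using p(1) q(1) by (intro bexI[of _ "\<lambda>x. enn2real (p x) - enn2real (q x)"]) auto
qed

lemma baire_version:
  fixes f :: "'g \<Rightarrow> complex"
  assumes H: "sigma_compact_subgroup H" and f: "f \<in> borel_measurable (completion \<mu>)"
  shows "\<exists>f'\<in>borel_measurable baire. (\<forall>x. x \<notin> H \<longrightarrow> f' x = 0) \<and> (AE x in \<mu>. x \<in> H \<longrightarrow> f x = f' x)"
proof -
  have "(\<lambda>x. Re (f x)) \<in> borel_measurable (completion \<mu>)" "(\<lambda>x. Im (f x)) \<in> borel_measurable (completion \<mu>)"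
    using f by measurable
  from this[THEN baire_version_real[OF H]] obtain p q
    where p: "p \<in> borel_measurable baire" "AE x in \<mu>. x \<in> H \<longrightarrow> Re (f x) = p x"
      and q: "q \<in> borel_measurable baire" "AE x in \<mu>. x \<in> H \<longrightarrow> Im (f x) = q x"
    by auto
  let ?f = "\<lambda>x. indicator H x *\<^sub>R Complex (p x) (q x)"
  from p(2) q(2) have "AE x in \<mu>. x \<in> H \<longrightarrow> f x = ?f x"
    by eventually_elim (auto simp: complex_eq_iff)
  moreover have "(\<lambda>x. Complex (p x) (q x)) \<in> borel_measurable baire"
    unfolding Complex_eq using p(1) q(1) by measurable
  then have "?f \<in> borel_measurable baire"
    using sigma_compact_subgroup_baire[OF H] by measurable
  ultimately show ?thesis by (intro bexI[of _ ?f]) auto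
qed

text \<open>By Markov's inequality the sets where the function is at least
  \<open>1 / (n + 1)\<close> in absolute value have finite measure, so each is \<sigma>-compact up
  to a null set. This is what allows an integrable function to be placed on a \<sigma>-compact
  subgroup.\<close>

lemma integrable_sigma_compact_support:
  fixes f :: "'g \<Rightarrow> real"
  assumes f: "integrable (completion \<mu>) f"
  obtains K :: "nat \<Rightarrow> 'g set" where "\<And>n. compact (K n)" "AE x in \<mu>. x \<notin> (\<Union>n. K n) \<longrightarrow> f x = 0"
proof -
  obtain g where g: "g \<in> borel_measurable \<mu>" "AE x in \<mu>. f x = g x"
    using completion_ex_borel_measurable_real[of f \<mu>] f by auto
  then have "AE x in completion \<mu>. f x = g x" by (simp add: AE_completion)
  then have "integrable (completion \<mu>) g"
    using f g(1) by (subst integrable_cong_AE[symmetric, of f]) (auto intro: measurable_completion)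
  then have gi: "integrable \<mu> g" using g(1) by (simp add: integrable_completion)
  define A where "A n = {x. 1 / real (Suc n) \<le> \<bar>g x\<bar>}" for n
  have gm[measurable]: "g \<in> borel_measurable borel" using g(1) by (simp add: measurable_haar_eq)
  have Ab: "A n \<in> sets borel" for n unfolding A_def by measurable
  have Af: "emeasure \<mu> (A n) < \<infinity>" for n
  proof -
    have "emeasure \<mu> {x \<in> space \<mu>. 1 / real (Suc n) \<le> \<bar>g x\<bar>}
        \<le> ennreal (1 / (1 / real (Suc n)) * (\<integral>x. \<bar>g x\<bar> \<partial>\<mu>))"
      using gi by (intro integral_Markov_inequality) auto
    also have "\<dots> < top" by simp
    finally show ?thesis by (simp add: A_def)
  qed
  have "\<exists>K. compact K \<and> K \<subseteq> A n \<and> emeasure \<mu> (A n - K) < ennreal (1 / real (Suc m))" for n m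
  proof -
    have p: "0 < 1 / real (Suc m)" by simp
    show ?thesis by (rule inner_approx[OF Ab Af p, of n]) blast
  qed
  then obtain K where K: "\<And>n m. compact (K n m)" "\<And>n m. K n m \<subseteq> A n"
    "\<And>n m. emeasure \<mu> (A n - K n m) < ennreal (1 / real (Suc m))"
    by metis
  have "emeasure \<mu> (A n - (\<Union>m. K n m)) = 0" for n
  proof -
    have le: "emeasure \<mu> (A n - (\<Union>m. K n m)) \<le> ennreal e" if e: "0 < e" for e
    proof -
      obtain m where m: "1 / real (Suc m) < e" using nat_approx_posE[OF e] by auto
      have "emeasure \<mu> (A n - (\<Union>m. K n m)) \<le> emeasure \<mu> (A n - K n m)"
        using Ab K(1) by (intro emeasure_mono) (auto simp: borel_compact)
      also have "\<dots> \<le> ennreal (1 / real (Suc m))" using K(3) by (simp add: less_imp_le)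
      also have "\<dots> \<le> ennreal e" using m by (intro ennreal_leI) simp
      finally show ?thesis .
    qed
    have "emeasure \<mu> (A n - (\<Union>m. K n m)) \<le> 0"
      by (rule ennreal_le_epsilon) (use le in simp)
    then show ?thesis by simp
  qed
  then have "A n - (\<Union>m. K n m) \<in> null_sets \<mu>" for n
    using Ab K(1) by (auto simp: null_sets_def borel_compact)
  then have "AE x in \<mu>. \<forall>n. x \<notin> A n - (\<Union>m. K n m)"
    by (subst AE_all_countable) (intro allI AE_not_in)
  \<comment> \<open>\<open>prod_decode\<close> lists the double sequence \<open>K n m\<close> as a
    single one.\<close>
  then have ae: "AE x in \<mu>. x \<notin> (\<Union>i. case_prod K (prod_decode i)) \<longrightarrow> f x = 0"
    using g(2)
  proof eventually_elim
    case (elim x)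
    show ?case
    proof (rule impI, rule ccontr)
      assume x: "x \<notin> (\<Union>i. case_prod K (prod_decode i))" "f x \<noteq> 0"
      then have "0 < \<bar>g x\<bar>" using elim by simp
      then obtain n where "1 / real (Suc n) < \<bar>g x\<bar>" by (rule nat_approx_posE)
      then have "x \<in> A n" by (simp add: A_def)
      moreover have "x \<notin> A n - (\<Union>m. K n m)" using elim(1) by (rule spec)
      ultimately obtain m where "x \<in> K n m" by blast
      then have "x \<in> case_prod K (prod_decode (prod_encode (n, m)))" by simp
      then have "x \<in> (\<Union>i. case_prod K (prod_decode i))" by (rule UN_I[OF UNIV_I])
      then show False using x(1) by contradiction
    qed
  qed
  show ?thesis
  proof (rule that)
    show "compact (case_prod K (prod_decode i))" for i by (simp add: split_beta K(1))
  qed (rule ae)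
qed

end

subsection \<open>Fubini's theorem and convolution\<close>

text \<open>The preimages under \<open>f\<close> and \<open>g\<close> differ by a subset of a null
  set, which the completion absorbs.\<close>

lemma measurable_completion_AE:
  assumes g: "g \<in> measurable (completion M) N" and ae: "AE x in M. f x = g x"
    and f: "\<And>x. x \<in> space M \<Longrightarrow> f x \<in> space N"
  shows "f \<in> measurable (completion M) N"
proof (rule measurableI)
  fix A assume A: "A \<in> sets N"
  have "AE x in completion M. x \<in> g -` A \<inter> space (completion M) \<longleftrightarrow> x \<in> f -` A \<inter> space (completion M)"
    using AE_completion[OF ae] by eventually_elim auto
  then show "f -` A \<inter> space (completion M) \<in> sets (completion M)"
    by (rule completion.in_sets_AE) (use measurable_sets[OF g A] in auto)
qed (use f in simp)

lemma beurling_funD: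
  assumes "a \<in> beurling_fun \<mu> \<omega>"
  shows "a \<in> borel_measurable (completion \<mu>)" "integrable (completion \<mu>) (\<lambda>x. cmod (a x) * \<omega> x)"
  using assms by (auto simp: beurling_fun_def)

lemma weightD:
  assumes "weight \<omega>"
  shows "\<omega> \<in> borel_measurable borel" "0 < \<omega> x" "\<omega> (x + y) \<le> \<omega> x * \<omega> y"
  using assms by (auto simp: weight_def)

context haar_measure
begin

lemma AE_translate:
  assumes "T \<in> measurable borel borel" "distr \<mu> borel T = \<mu>" "AE x in \<mu>. P x"
  shows "AE x in \<mu>. P (T x)"
proof -
  have "T \<in> measurable \<mu> borel" using assms(1) unfolding measurable_haar_eq .
  from AE_distrD[OF this, of P] show ?thesis unfolding assms(2) using assms(3) by blast
qed

lemma integral_translate: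
  fixes f :: "'g \<Rightarrow> complex"
  assumes "T \<in> measurable borel borel" "distr \<mu> borel T = \<mu>" "f \<in> borel_measurable borel"
  shows "(\<integral>x. f (T x) \<partial>\<mu>) = (\<integral>x. f x \<partial>\<mu>)"
  using integral_distr[of T \<mu> borel f] assms by (simp add: measurable_haar_eq)

lemma borel_imp_completion: "f \<in> measurable borel N \<Longrightarrow> f \<in> measurable (completion \<mu>) N"
  by (intro measurable_completion) (simp add: measurable_haar_eq)

text \<open>Passes from integrals over the completion, in which the algebra is phrased, to Borel
  representatives. For non-integrable functions both integrals take the default value 0.\<close>

lemma integral_completion_AE:
  fixes f g :: "'g \<Rightarrow> complex"
  assumes g: "g \<in> borel_measurable borel" and ae: "AE x in \<mu>. f x = g x"
  shows "(LINT x|completion \<mu>. f x) = (\<integral>x. g x \<partial>\<mu>)"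
proof -
  have "f \<in> borel_measurable (completion \<mu>)"
    using borel_imp_completion[OF g] ae by (rule measurable_completion_AE) simp
  then have "(LINT x|completion \<mu>. f x) = (LINT x|completion \<mu>. g x)"
    using borel_imp_completion[OF g] AE_completion[OF ae] by (intro integral_cong_AE) auto
  also have "\<dots> = (\<integral>x. g x \<partial>\<mu>)"
    using g by (intro integral_completion) (simp add: measurable_haar_eq)
  finally show ?thesis .
qed

lemma beurling_support:
  assumes w: "weight \<omega>" and a: "a \<in> beurling_fun \<mu> \<omega>"
  obtains K :: "nat \<Rightarrow> 'g set" where "\<And>n. compact (K n)" "AE x in \<mu>. x \<notin> (\<Union>n. K n) \<longrightarrow> a x = 0"
proof -
  obtain K :: "nat \<Rightarrow> 'g set"
    where K: "\<And>n. compact (K n)" "AE x in \<mu>. x \<notin> (\<Union>n. K n) \<longrightarrow> cmod (a x) * \<omega> x = 0"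
    by (rule integrable_sigma_compact_support[OF beurling_funD(2)[OF a]]) (rule that)
  have "AE x in \<mu>. x \<notin> (\<Union>n. K n) \<longrightarrow> a x = 0"
    using K(2) by eventually_elim (use weightD(2)[OF w] in \<open>auto simp: less_le\<close>)
  with K(1) show ?thesis by (rule that)
qed

text \<open>Vanishing off \<open>H\<close> is demanded at every point so that kernels built from
  \<open>a'\<close> vanish off \<open>H \<times> H\<close> everywhere. Baire measurability is what
  survives composition with \<open>- y + x\<close>.\<close>

definition beurling_rep :: "('g \<Rightarrow> real) \<Rightarrow> 'g set \<Rightarrow> ('g \<Rightarrow> complex) \<Rightarrow> ('g \<Rightarrow> complex) \<Rightarrow> bool" where
  "beurling_rep \<omega> H a a' \<longleftrightarrow> a' \<in> borel_measurable baire \<and> (\<forall>x. x \<notin> H \<longrightarrow> a' x = 0) \<and>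
     (AE x in \<mu>. a x = a' x) \<and> integrable \<mu> (\<lambda>x. cmod (a' x) * \<omega> x)"

lemma beurling_repD:
  assumes "beurling_rep \<omega> H a a'"
  shows "a' \<in> borel_measurable baire" "a' \<in> borel_measurable borel" "x \<notin> H \<Longrightarrow> a' x = 0"
    "AE x in \<mu>. a x = a' x" "integrable \<mu> (\<lambda>x. cmod (a' x) * \<omega> x)"
  using assms borel_measurable_baire unfolding beurling_rep_def by auto

lemma beurling_rep_exists:
  assumes w: "weight \<omega>" and a: "a \<in> beurling_fun \<mu> \<omega>" and H: "sigma_compact_subgroup H"
    and supp: "AE x in \<mu>. x \<notin> H \<longrightarrow> a x = 0"
  shows "\<exists>a'. beurling_rep \<omega> H a a'"
proof -
  obtain a' where a': "a' \<in> borel_measurable baire" "\<forall>x. x \<notin> H \<longrightarrow> a' x = 0"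
    "AE x in \<mu>. x \<in> H \<longrightarrow> a x = a' x"
    using baire_version[OF H beurling_funD(1)[OF a]] by auto
  have ae: "AE x in \<mu>. a x = a' x"
    using a'(3) supp by eventually_elim (use a'(2) in auto)
  have [measurable]: "a' \<in> borel_measurable borel" "\<omega> \<in> borel_measurable borel"
    using borel_measurable_baire[OF a'(1)] weightD[OF w] by auto
  have "integrable (completion \<mu>) (\<lambda>x. cmod (a' x) * \<omega> x)"
  proof (rule integrable_cong_AE_imp[OF beurling_funD(2)[OF a]])
    show "(\<lambda>x. cmod (a' x) * \<omega> x) \<in> borel_measurable (completion \<mu>)"
      by (intro borel_imp_completion) measurable
    show "AE x in completion \<mu>. cmod (a x) * \<omega> x = cmod (a' x) * \<omega> x"
      using AE_completion[OF ae] by eventually_elim simp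
  qed
  moreover have "(\<lambda>x. cmod (a' x) * \<omega> x) \<in> borel_measurable \<mu>"
    unfolding measurable_haar_eq by measurable
  ultimately have "integrable \<mu> (\<lambda>x. cmod (a' x) * \<omega> x)" by (simp add: integrable_completion)
  then show ?thesis using a' ae unfolding beurling_rep_def by blast
qed

lemma beurling_reps:
  assumes w: "weight \<omega>" and a: "a \<in> beurling_fun \<mu> \<omega>" and b: "b \<in> beurling_fun \<mu> \<omega>"
  obtains H a' b' where "sigma_compact_subgroup H" "beurling_rep \<omega> H a a'" "beurling_rep \<omega> H b b'"
proof -
  obtain K :: "nat \<Rightarrow> 'g set" where K: "\<And>n. compact (K n)" "AE x in \<mu>. x \<notin> (\<Union>n. K n) \<longrightarrow> a x = 0"
    by (rule beurling_support[OF w a]) (rule that)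
  obtain L :: "nat \<Rightarrow> 'g set" where L: "\<And>n. compact (L n)" "AE x in \<mu>. x \<notin> (\<Union>n. L n) \<longrightarrow> b x = 0"
    by (rule beurling_support[OF w b]) (rule that)
  obtain H where H: "sigma_compact_subgroup H" "\<And>n. K n \<union> L n \<subseteq> H"
  proof (rule sigma_compact_subgroup_exists)
    show "compact (K n \<union> L n)" for n using K L by (intro compact_Un)
  qed (rule that)
  have "AE x in \<mu>. x \<notin> H \<longrightarrow> a x = 0" using K(2) by eventually_elim (use H in auto)
  moreover have "AE x in \<mu>. x \<notin> H \<longrightarrow> b x = 0" using L(2) by eventually_elim (use H in auto)
  ultimately show ?thesis
    using beurling_rep_exists[OF w a H(1)] beurling_rep_exists[OF w b H(1)] that[OF H(1)] by auto
qed

lemma integral_part: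
  fixes f :: "'g \<Rightarrow> complex"
  assumes "H \<in> sets borel" "f \<in> borel_measurable borel" "\<And>x. x \<notin> H \<Longrightarrow> f x = 0"
  shows "(\<integral>x. f x \<partial>part H) = (\<integral>x. f x \<partial>\<mu>)"
proof -
  have "part H = density \<mu> (\<lambda>x. ennreal (indicator H x))"
    unfolding part_def by (simp add: ennreal_indicator)
  then have "(\<integral>x. f x \<partial>part H) = (\<integral>x. indicator H x *\<^sub>R f x \<partial>\<mu>)"
    using assms by (simp add: integral_density measurable_haar_eq)
  also have "\<dots> = (\<integral>x. f x \<partial>\<mu>)"
    by (intro Bochner_Integration.integral_cong) (auto simp: assms(3) indicator_def)
  finally show ?thesis .
qed

text \<open>Since \<open>k\<close> vanishes off \<open>H \<times> H\<close>, all integrals may be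
  taken over the \<sigma>-finite measure \<open>part H\<close>, where the classical theorem
  applies.\<close>

lemma
  fixes k :: "'g \<times> 'g \<Rightarrow> complex"
  assumes H: "sigma_compact_subgroup H" and k: "k \<in> borel_measurable (borel \<Otimes>\<^sub>M borel)"
    and k0: "\<And>y z. y \<notin> H \<or> z \<notin> H \<Longrightarrow> k (y, z) = 0"
  shows borel_measurable_integral_part: "(\<lambda>y. \<integral>z. k (y, z) \<partial>\<mu>) \<in> borel_measurable borel"
      "(\<lambda>z. \<integral>y. k (y, z) \<partial>\<mu>) \<in> borel_measurable borel"
    and Fubini_integral_part: "(\<integral>\<^sup>+y. \<integral>\<^sup>+z. ennreal (cmod (k (y, z))) \<partial>\<mu> \<partial>\<mu>) < \<infinity> \<Longrightarrow>
      (\<integral>y. \<integral>z. k (y, z) \<partial>\<mu> \<partial>\<mu>) = (\<integral>z. \<integral>y. k (y, z) \<partial>\<mu> \<partial>\<mu>)"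
proof -
  interpret S: sigma_finite_measure "part H" by (rule sigma_finite_part[OF H])
  interpret P: pair_sigma_finite "part H" "part H" ..
  have Hb: "H \<in> sets borel" using sigma_compact_subgroup_open[OF H] by auto
  have eq: "measurable (part H \<Otimes>\<^sub>M part H) N = measurable (borel \<Otimes>\<^sub>M borel) N"
    "measurable (borel \<Otimes>\<^sub>M part H) N = measurable (borel \<Otimes>\<^sub>M borel) N" for N :: "'z measure"
    by (intro measurable_cong_sets sets_pair_measure_cong refl; simp)+
  have km: "k \<in> borel_measurable (part H \<Otimes>\<^sub>M part H)" unfolding eq by (rule k)
  have s1: "(\<lambda>z. k (y, z)) \<in> borel_measurable borel" for y using k by measurable
  have s2: "(\<lambda>y. k (y, z)) \<in> borel_measurable borel" for z using k by measurable
  have i1: "(\<integral>z. k (y, z) \<partial>\<mu>) = (\<integral>z. k (y, z) \<partial>part H)" for y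
    by (rule integral_part[OF Hb s1, symmetric]) (simp add: k0)
  have i2: "(\<integral>y. k (y, z) \<partial>\<mu>) = (\<integral>y. k (y, z) \<partial>part H)" for z
    by (rule integral_part[OF Hb s2, symmetric]) (simp add: k0)
  show m1: "(\<lambda>y. \<integral>z. k (y, z) \<partial>\<mu>) \<in> borel_measurable borel"
    unfolding i1 by (rule S.borel_measurable_lebesgue_integral) (simp add: eq k)
  have "(\<lambda>p. k (snd p, fst p)) \<in> borel_measurable (borel \<Otimes>\<^sub>M borel)"
    using k by measurable
  then show m2: "(\<lambda>z. \<integral>y. k (y, z) \<partial>\<mu>) \<in> borel_measurable borel"
    unfolding i2 by (intro S.borel_measurable_lebesgue_integral) (simp add: eq split_beta')
  assume fin: "(\<integral>\<^sup>+y. \<integral>\<^sup>+z. ennreal (cmod (k (y, z))) \<partial>\<mu> \<partial>\<mu>) < \<infinity>"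
  have nm: "(\<lambda>p. ennreal (cmod (k p))) \<in> borel_measurable (part H \<Otimes>\<^sub>M part H)"
    using km by measurable
  have n1: "(\<integral>\<^sup>+z. ennreal (cmod (k (y, z))) \<partial>\<mu>) = (\<integral>\<^sup>+z. ennreal (cmod (k (y, z))) \<partial>part H)" for y
    using s1 by (intro nn_integral_part[OF Hb, symmetric]) (auto simp: k0)
  have nb: "(\<lambda>y. \<integral>\<^sup>+z. ennreal (cmod (k (y, z))) \<partial>part H) \<in> borel_measurable borel"
    using S.borel_measurable_nn_integral_fst[OF nm] by (simp cong: measurable_cong_sets)
  have "(\<integral>\<^sup>+p. ennreal (cmod (k p)) \<partial>(part H \<Otimes>\<^sub>M part H)) = (\<integral>\<^sup>+y. \<integral>\<^sup>+z. ennreal (cmod (k (y, z))) \<partial>part H \<partial>part H)"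
    using S.nn_integral_fst[OF nm] by simp
  also have "\<dots> = (\<integral>\<^sup>+y. \<integral>\<^sup>+z. ennreal (cmod (k (y, z))) \<partial>part H \<partial>\<mu>)"
    using nb by (intro nn_integral_part[OF Hb]) (auto simp: k0)
  finally have int: "integrable (part H \<Otimes>\<^sub>M part H) k"
    using fin km unfolding n1[symmetric] by (intro integrableI_bounded) auto
  have "(\<integral>y. \<integral>z. k (y, z) \<partial>\<mu> \<partial>\<mu>) = (\<integral>y. \<integral>z. k (y, z) \<partial>part H \<partial>part H)"
    unfolding i1[symmetric] by (intro integral_part[OF Hb m1, symmetric]) (simp add: k0)
  also have "\<dots> = (\<integral>z. \<integral>y. k (y, z) \<partial>part H \<partial>part H)"
    using P.Fubini_integral[of "\<lambda>y z. k (y, z)"] int by simp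
  also have "\<dots> = (\<integral>z. \<integral>y. k (y, z) \<partial>\<mu> \<partial>\<mu>)"
    unfolding i2[symmetric] by (intro integral_part[OF Hb m2]) (simp add: k0)
  finally show "(\<integral>y. \<integral>z. k (y, z) \<partial>\<mu> \<partial>\<mu>) = (\<integral>z. \<integral>y. k (y, z) \<partial>\<mu> \<partial>\<mu>)" .
qed

lemma continuous_kernel_measurable:
  fixes K :: "'g \<times> 'g \<Rightarrow> complex"
  assumes H: "sigma_compact_subgroup H" and K: "continuous_on UNIV K"
  shows "(\<lambda>p. indicator (H \<times> H) p *\<^sub>R K p) \<in> borel_measurable (borel \<Otimes>\<^sub>M borel)"
proof -
  obtain C :: "nat \<Rightarrow> 'g set" where C: "\<And>n. compact (C n)" "incseq C" "H = (\<Union>n. C n)"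
    using sigma_compact_subgroupE[OF H] by metis
  have "(\<lambda>p. Re (K p)) \<in> borel_measurable (restrict_space (borel \<Otimes>\<^sub>M borel) (H \<times> H))"
    "(\<lambda>p. Im (K p)) \<in> borel_measurable (restrict_space (borel \<Otimes>\<^sub>M borel) (H \<times> H))"
    by (intro continuous_measurable_pair[OF _ C] continuous_intros K)+
  then have "K \<in> borel_measurable (restrict_space (borel \<Otimes>\<^sub>M borel) (H \<times> H))"
    by (simp add: borel_measurable_complex_iff)
  moreover have "H \<in> sets borel" using sigma_compact_subgroup_open[OF H] by auto
  then have "H \<times> H \<in> sets (borel \<Otimes>\<^sub>M borel)" by (auto intro: pair_measureI)
  ultimately show ?thesis
    by (subst (asm) borel_measurable_restrict_space_iff) (auto simp: space_pair_measure)
qed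

lemma nn_integral_product_finite:
  fixes \<alpha> \<beta> :: "'g \<Rightarrow> real"
  assumes \<alpha>: "integrable \<mu> \<alpha>" "\<And>x. 0 \<le> \<alpha> x" and \<beta>: "integrable \<mu> \<beta>" "\<And>x. 0 \<le> \<beta> x" and C: "0 \<le> C"
  shows "(\<integral>\<^sup>+y. \<integral>\<^sup>+z. ennreal (C * \<alpha> y * \<beta> z) \<partial>\<mu> \<partial>\<mu>) < \<infinity>"
proof -
  have m: "(\<lambda>x. ennreal (\<alpha> x)) \<in> borel_measurable \<mu>" "(\<lambda>x. ennreal (\<beta> x)) \<in> borel_measurable \<mu>"
    using \<alpha>(1) \<beta>(1) by auto
  have "(\<integral>\<^sup>+y. \<integral>\<^sup>+z. ennreal (C * \<alpha> y * \<beta> z) \<partial>\<mu> \<partial>\<mu>)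
      = (\<integral>\<^sup>+y. \<integral>\<^sup>+z. ennreal C * ennreal (\<alpha> y) * ennreal (\<beta> z) \<partial>\<mu> \<partial>\<mu>)"
    using C \<alpha>(2) \<beta>(2) by (simp add: ennreal_mult)
  also have "\<dots> = ennreal C * (\<integral>\<^sup>+y. ennreal (\<alpha> y) \<partial>\<mu>) * (\<integral>\<^sup>+z. ennreal (\<beta> z) \<partial>\<mu>)"
    using m by (simp add: nn_integral_cmult nn_integral_multc)
  also have "\<dots> = ennreal C * ennreal (\<integral>y. \<alpha> y \<partial>\<mu>) * ennreal (\<integral>z. \<beta> z \<partial>\<mu>)"
    using \<alpha> \<beta> by (simp add: nn_integral_eq_integral)
  also have "\<dots> < \<infinity>" by (simp add: ennreal_mult_less_top)
  finally show ?thesis .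
qed

lemma Fubini_beurling:
  assumes w: "weight \<omega>" and a: "a \<in> beurling_fun \<mu> \<omega>" and b: "b \<in> beurling_fun \<mu> \<omega>"
    and K: "continuous_on UNIV K" and C: "0 \<le> C" "\<And>y z. cmod (K (y, z)) \<le> C * \<omega> y * \<omega> z"
  shows "(LINT y|completion \<mu>. a y * (LINT z|completion \<mu>. b z * K (y, z)))
    = (LINT z|completion \<mu>. b z * (LINT y|completion \<mu>. a y * K (y, z)))"
proof -
  obtain H a' b' where H: "sigma_compact_subgroup H"
    and a'b': "beurling_rep \<omega> H a a'" "beurling_rep \<omega> H b b'"
    by (rule beurling_reps[OF w a b]) (rule that)
  note a' = beurling_repD[OF a'b'(1)] and b' = beurling_repD[OF a'b'(2)]
  \<comment> \<open>The indicator leaves the values unchanged because \<open>a'\<close> and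
    \<open>b'\<close> vanish off \<open>H\<close>, but it makes \<open>K\<close> jointly
    measurable.\<close>
  define k where "k = (\<lambda>p. a' (fst p) * b' (snd p) * (indicator (H \<times> H) p *\<^sub>R K p))"
  have k: "k (y, z) = a' y * b' z * K (y, z)" for y z
    using a'(3)[of y] b'(3)[of z] by (auto simp: k_def indicator_def)
  have [measurable]: "a' \<in> borel_measurable borel" "b' \<in> borel_measurable borel" "\<omega> \<in> borel_measurable borel"
    using a'(2) b'(2) weightD(1)[OF w] by auto
  have km: "k \<in> borel_measurable (borel \<Otimes>\<^sub>M borel)"
    unfolding k_def using continuous_kernel_measurable[OF H K] by measurable
  have k0: "k (y, z) = 0" if "y \<notin> H \<or> z \<notin> H" for y z
    using that a'(3)[of y] b'(3)[of z] by (auto simp: k)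
  have fin: "(\<integral>\<^sup>+y. \<integral>\<^sup>+z. ennreal (cmod (k (y, z))) \<partial>\<mu> \<partial>\<mu>) < \<infinity>"
  proof -
    have "cmod (k (y, z)) \<le> C * (cmod (a' y) * \<omega> y) * (cmod (b' z) * \<omega> z)" for y z
      using mult_left_mono[OF C(2)[of y z], of "cmod (a' y * b' z)"]
      by (simp add: k norm_mult algebra_simps)
    then have "(\<integral>\<^sup>+y. \<integral>\<^sup>+z. ennreal (cmod (k (y, z))) \<partial>\<mu> \<partial>\<mu>)
        \<le> (\<integral>\<^sup>+y. \<integral>\<^sup>+z. ennreal (C * (cmod (a' y) * \<omega> y) * (cmod (b' z) * \<omega> z)) \<partial>\<mu> \<partial>\<mu>)"
      by (intro nn_integral_mono ennreal_leI)
    also have "\<dots> < \<infinity>"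
      using a'(5) b'(5) C(1) weightD(2)[OF w] by (intro nn_integral_product_finite) (auto simp: less_imp_le)
    finally show ?thesis .
  qed
  have Ks: "(\<lambda>z. K (y, z)) \<in> borel_measurable borel" "(\<lambda>y. K (y, z)) \<in> borel_measurable borel" for y z
    by (intro borel_measurable_continuous_onI continuous_on_compose2[OF K] continuous_intros; simp)+
  have 1: "(LINT z|completion \<mu>. b z * K (y, z)) = (\<integral>z. b' z * K (y, z) \<partial>\<mu>)" for y
    by (rule integral_completion_AE) (use b'(4) Ks in \<open>auto elim!: eventually_mono\<close>)
  have 2: "(LINT y|completion \<mu>. a y * K (y, z)) = (\<integral>y. a' y * K (y, z) \<partial>\<mu>)" for z
    by (rule integral_completion_AE) (use a'(4) Ks in \<open>auto elim!: eventually_mono\<close>)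
  have k1: "(\<integral>z. k (y, z) \<partial>\<mu>) = a' y * (\<integral>z. b' z * K (y, z) \<partial>\<mu>)" for y
    by (simp add: k mult.assoc)
  have k2: "(\<integral>y. k (y, z) \<partial>\<mu>) = b' z * (\<integral>y. a' y * K (y, z) \<partial>\<mu>)" for z
    by (simp add: k mult.assoc mult.left_commute[of _ "b' z"])
  have "(LINT y|completion \<mu>. a y * (LINT z|completion \<mu>. b z * K (y, z))) = (\<integral>y. \<integral>z. k (y, z) \<partial>\<mu> \<partial>\<mu>)"
    unfolding 1
    by (rule integral_completion_AE[OF borel_measurable_integral_part(1)[OF H km k0]])
       (use a'(4) in \<open>auto simp: k1 elim!: eventually_mono\<close>)
  also have "\<dots> = (\<integral>z. \<integral>y. k (y, z) \<partial>\<mu> \<partial>\<mu>)"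
    by (rule Fubini_integral_part[OF H km k0 fin])
  also have "\<dots> = (LINT z|completion \<mu>. b z * (LINT y|completion \<mu>. a y * K (y, z)))"
    unfolding 2
    by (rule integral_completion_AE[OF borel_measurable_integral_part(2)[OF H km k0], symmetric])
       (use b'(4) in \<open>auto simp: k2 elim!: eventually_mono\<close>)
  finally show ?thesis .
qed

lemma kernel_integrable:
  assumes w: "weight \<omega>" and a: "a \<in> beurling_fun \<mu> \<omega>"
    and K: "continuous_on UNIV K" and C: "\<And>y. cmod (K y) \<le> C * \<omega> y"
  shows "integrable (completion \<mu>) (\<lambda>y. a y * K y)"
    "cmod (LINT y|completion \<mu>. a y * K y) \<le> C * (LINT y|completion \<mu>. cmod (a y) * \<omega> y)"
proof -
  have m: "(\<lambda>y. a y * K y) \<in> borel_measurable (completion \<mu>)"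
    using beurling_funD(1)[OF a] borel_imp_completion[OF borel_measurable_continuous_onI[OF K]]
    by measurable
  have le: "norm (a y * K y) \<le> C * (cmod (a y) * \<omega> y)" for y
    using mult_left_mono[OF C[of y], of "cmod (a y)"] by (simp add: norm_mult algebra_simps)
  have iC: "integrable (completion \<mu>) (\<lambda>y. C * (cmod (a y) * \<omega> y))"
    using beurling_funD(2)[OF a] by simp
  have C0: "0 \<le> C * \<omega> 0" by (rule order_trans[OF norm_ge_zero C])
  show i: "integrable (completion \<mu>) (\<lambda>y. a y * K y)"
    by (rule Bochner_Integration.integrable_bound[OF iC m]) (use le in \<open>auto intro!: AE_I2 order_trans[OF le]\<close>)
  have "cmod (LINT y|completion \<mu>. a y * K y) \<le> (LINT y|completion \<mu>. norm (a y * K y))"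
    by (rule integral_norm_bound)
  also have "\<dots> \<le> (LINT y|completion \<mu>. C * (cmod (a y) * \<omega> y))"
    by (rule integral_mono) (use i iC le in auto)
  finally show "cmod (LINT y|completion \<mu>. a y * K y) \<le> C * (LINT y|completion \<mu>. cmod (a y) * \<omega> y)"
    by simp
qed

text \<open>Continuity cannot be obtained from dominated convergence since the group need not be first
  countable; instead \<open>a\<close> is concentrated on a compact set, on which the kernel varies
  uniformly little.\<close>

lemma kernel_integral_continuous:
  assumes w: "weight \<omega>" and a: "a \<in> beurling_fun \<mu> \<omega>"
    and K: "continuous_on UNIV K" and C: "0 \<le> C" "\<And>x y. cmod (K (x, y)) \<le> C * \<omega> x * \<omega> y"
  shows "continuous_on UNIV (\<lambda>x. LINT y|completion \<mu>. a y * K (x, y))"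
proof -
  obtain H a' where H: "sigma_compact_subgroup H" and a'': "beurling_rep \<omega> H a a'"
    using beurling_reps[OF w a a] by metis
  note a' = beurling_repD[OF a'']
  have wpos: "0 < \<omega> x" for x by (rule weightD(2)[OF w])
  define \<theta> where "\<theta> = (\<lambda>x. cmod (a' x) * \<omega> x)"
  have \<theta>: "integrable \<mu> \<theta>" "\<And>x. 0 \<le> \<theta> x"
    using a'(5) wpos by (auto simp: \<theta>_def less_imp_le)
  obtain L :: "nat \<Rightarrow> 'g set" where L: "\<And>n. compact (L n)" "incseq L" "H = (\<Union>n. L n)"
    using sigma_compact_subgroupE[OF H] by metis
  have [measurable]: "a' \<in> borel_measurable \<mu>" "\<omega> \<in> borel_measurable \<mu>" "\<theta> \<in> borel_measurable \<mu>" "L n \<in> sets \<mu>" for n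
    using a'(2) weightD(1)[OF w] \<theta>(1) L(1) by (auto simp: measurable_haar_eq borel_compact)
  have tail: "(\<lambda>n. \<integral>x. \<theta> x * indicator (- L n) x \<partial>\<mu>) \<longlonglongrightarrow> (\<integral>x. 0 \<partial>\<mu>)"
  proof (rule integral_dominated_convergence[where w = \<theta>])
    show "AE x in \<mu>. (\<lambda>n. \<theta> x * indicator (- L n) x) \<longlonglongrightarrow> 0"
    proof (rule AE_I2)
      fix x
      show "(\<lambda>n. \<theta> x * indicator (- L n) x) \<longlonglongrightarrow> 0"
      proof (cases "x \<in> H")
        case True
        then obtain m where "x \<in> L m" using L by auto
        then have "\<And>n. n \<ge> m \<Longrightarrow> x \<in> L n" using incseqD[OF L(2)] by blast
        then show ?thesis
          by (intro tendsto_eventually) (auto simp: eventually_sequentially intro!: exI[of _ m])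
      qed (simp add: \<theta>_def a'(3))
    qed
  qed (use \<theta> in \<open>auto simp: indicator_def\<close>)
  have Ks: "(\<lambda>y. K (x, y)) \<in> borel_measurable \<mu>" for x
    unfolding measurable_haar_eq
    by (intro borel_measurable_continuous_onI continuous_on_compose2[OF K] continuous_intros; simp)
  have T: "(LINT y|completion \<mu>. a y * K (x, y)) = (\<integral>y. a' y * K (x, y) \<partial>\<mu>)" for x
    by (rule integral_completion_AE)
       (use a'(2,4) Ks[of x] in \<open>auto simp: measurable_haar_eq elim!: eventually_mono\<close>)
  have "isCont (\<lambda>x. \<integral>y. a' y * K (x, y) \<partial>\<mu>) x0" for x0
    unfolding isCont_def
  proof (rule tendstoI)
    fix e :: real assume e: "0 < e"
    obtain U1 V1 where UV: "open U1" "compact V1" "x0 \<in> U1" "U1 \<subseteq> V1"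
      using locally_compact by metis
    obtain M where M: "0 < M" "\<And>x. x \<in> V1 \<Longrightarrow> \<omega> x \<le> M" using weight_bounded[OF w UV(2)] by metis
    \<comment> \<open>The part outside \<open>L n\<close> will cost at most
      \<open>2 * C * M * e1\<close>, where \<open>M\<close> bounds \<omega> near \<open>x0\<close>.
      The added 1 makes the divisor positive and the cost strictly less than
      \<open>e / 2\<close>.\<close>
    define e1 where "e1 = e / (2 * (2 * C * M + 1))"
    have p: "0 < 2 * C * M + 1" using C M by (simp add: add_nonneg_pos)
    have e1: "0 < e1" using e p by (simp add: e1_def)
    then have "eventually (\<lambda>n. (\<integral>x. \<theta> x * indicator (- L n) x \<partial>\<mu>) < e1) sequentially"
      using tail by (intro order_tendstoD(2)) auto
    then obtain n where n: "(\<integral>x. \<theta> x * indicator (- L n) x \<partial>\<mu>) < e1"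
      by (auto simp: eventually_sequentially)
    \<comment> \<open>A lower bound for \<omega> on \<open>L n\<close> turns weighted integrability
      of \<open>a'\<close> into integrability on \<open>L n\<close>.\<close>
    obtain m where m: "0 < m" "\<And>x. x \<in> L n \<Longrightarrow> m \<le> \<omega> x" using weight_bounded_below[OF w L(1)] by metis
    have iL: "integrable \<mu> (\<lambda>y. cmod (a' y) * indicator (L n) y)"
    proof (rule Bochner_Integration.integrable_bound)
      show "integrable \<mu> (\<lambda>y. \<theta> y / m)" using \<theta> by simp
      show "AE x in \<mu>. norm (cmod (a' x) * indicator (L n) x) \<le> norm (\<theta> x / m)"
      proof (rule AE_I2)
        fix x show "norm (cmod (a' x) * indicator (L n) x) \<le> norm (\<theta> x / m)"
          using m(1) m(2)[of x] wpos[of x] mult_left_mono[OF m(2)[of x], of "cmod (a' x)"]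
          by (cases "x \<in> L n") (auto simp: \<theta>_def abs_mult field_simps)
      qed
    qed measurable
    define A where "A = (\<integral>y. cmod (a' y) * indicator (L n) y \<partial>\<mu>)"
    have A: "0 \<le> A" unfolding A_def by (intro integral_nonneg_AE AE_I2) auto
    \<comment> \<open>The part inside \<open>L n\<close> will cost \<open>d * A\<close>, less than
      the other \<open>e / 2\<close>.\<close>
    define d where "d = e / (2 * (A + 1))"
    have d: "0 < d" using e A by (simp add: d_def)
    obtain X where X: "x0 \<in> X" "open X" "\<forall>x\<in>X \<inter> UNIV. \<forall>t\<in>L n. dist (K (x, t)) (K (x0, t)) \<le> d"
    proof (rule continuous_on_prod_compactE[where U = UNIV and C = "L n" and e = d])
      show "continuous_on (UNIV \<times> L n) K" using K by (rule continuous_on_subset) auto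
    qed (use L(1) d in auto)
    have iK: "integrable \<mu> (\<lambda>y. a' y * K (x, y))" for x
    proof (rule Bochner_Integration.integrable_bound)
      show "integrable \<mu> (\<lambda>y. C * \<omega> x * \<theta> y)" using \<theta> by simp
      show "AE y in \<mu>. norm (a' y * K (x, y)) \<le> norm (C * \<omega> x * \<theta> y)"
      proof (rule AE_I2)
        fix y show "norm (a' y * K (x, y)) \<le> norm (C * \<omega> x * \<theta> y)"
          using mult_left_mono[OF C(2)[of x y], of "cmod (a' y)"] C(1) wpos[of x] wpos[of y]
          by (simp add: \<theta>_def norm_mult abs_mult algebra_simps)
      qed
    qed (use Ks in measurable)
    have "dist (\<integral>y. a' y * K (x, y) \<partial>\<mu>) (\<integral>y. a' y * K (x0, y) \<partial>\<mu>) < e" if x: "x \<in> X \<inter> U1" for x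
    proof -
      have wx: "\<omega> x \<le> M" "\<omega> x0 \<le> M" using x UV M by auto
      have pt: "norm (a' y * K (x, y) - a' y * K (x0, y))
          \<le> d * (cmod (a' y) * indicator (L n) y) + 2 * C * M * (\<theta> y * indicator (- L n) y)" for y
      proof (cases "y \<in> L n")
        case True
        then have "cmod (K (x, y) - K (x0, y)) \<le> d" using X x by (auto simp: dist_norm)
        then have "cmod (a' y) * cmod (K (x, y) - K (x0, y)) \<le> cmod (a' y) * d" by (intro mult_left_mono) auto
        then show ?thesis using True
          by (simp add: right_diff_distrib[symmetric] norm_mult mult.commute)
      next
        case False
        have "cmod (K (x, y) - K (x0, y)) \<le> C * \<omega> x * \<omega> y + C * \<omega> x0 * \<omega> y"
          by (rule order_trans[OF norm_triangle_ineq4 add_mono[OF C(2) C(2)]])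
        also have "\<dots> \<le> C * M * \<omega> y + C * M * \<omega> y"
          using wx C(1) wpos by (intro add_mono mult_right_mono mult_left_mono) (auto simp: less_imp_le)
        finally have "cmod (a' y) * cmod (K (x, y) - K (x0, y)) \<le> cmod (a' y) * (2 * C * M * \<omega> y)"
          by (intro mult_left_mono) auto
        moreover have "norm (a' y * K (x, y) - a' y * K (x0, y)) = cmod (a' y) * cmod (K (x, y) - K (x0, y))"
          by (simp add: right_diff_distrib[symmetric] norm_mult)
        moreover have "d * (cmod (a' y) * indicator (L n) y) + 2 * C * M * (\<theta> y * indicator (- L n) y)
            = cmod (a' y) * (2 * C * M * \<omega> y)"
          using False by (simp add: \<theta>_def)
        ultimately show ?thesis by simp
      qed
      have it: "integrable \<mu> (\<lambda>y. \<theta> y * indicator (- L n) y)"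
        using \<theta>(1) L(1) by (intro integrable_real_mult_indicator) (simp_all add: borel_compact borel_comp)
      have "dist (\<integral>y. a' y * K (x, y) \<partial>\<mu>) (\<integral>y. a' y * K (x0, y) \<partial>\<mu>)
          = norm (\<integral>y. a' y * K (x, y) - a' y * K (x0, y) \<partial>\<mu>)"
        by (simp add: dist_norm iK)
      also have "\<dots> \<le> (\<integral>y. norm (a' y * K (x, y) - a' y * K (x0, y)) \<partial>\<mu>)"
        by (rule integral_norm_bound)
      also have "\<dots> \<le> (\<integral>y. d * (cmod (a' y) * indicator (L n) y) + 2 * C * M * (\<theta> y * indicator (- L n) y) \<partial>\<mu>)"
        by (rule integral_mono) (use iK iL it pt in auto)
      also have "\<dots> = d * A + 2 * C * M * (\<integral>y. \<theta> y * indicator (- L n) y \<partial>\<mu>)"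
        unfolding A_def using iL it by simp
      also have "\<dots> \<le> d * A + 2 * C * M * e1"
        using n C M by (intro add_left_mono mult_left_mono) auto
      also have "\<dots> < e"
      proof -
        have "d * A < e / 2" using e A by (simp add: d_def divide_simps)
        moreover have "2 * C * M * e1 < e / 2" using e p by (simp add: e1_def divide_simps)
        ultimately show ?thesis by simp
      qed
      finally show ?thesis .
    qed
    then show "\<forall>\<^sub>F x in at x0. dist (\<integral>y. a' y * K (x, y) \<partial>\<mu>) (\<integral>y. a' y * K (x0, y) \<partial>\<mu>) < e"
      unfolding eventually_at_topological using X UV by (intro exI[of _ "X \<inter> U1"]) auto
  qed
  then show ?thesis unfolding T by (intro continuous_at_imp_continuous_on) auto
qed

end

context FC_haar_measure
begin

text \<open>Here unimodularity enters the convolution: null sets stay null under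
  \<open>y \<mapsto> - y + x\<close>, so for every \<open>x\<close> the factor \<open>b\<close> may
  be replaced by a representative.\<close>

lemma distr_reflect: "distr \<mu> borel (\<lambda>y. - y + x) = \<mu>"
proof -
  have m: "uminus \<in> measurable \<mu> borel" "(\<lambda>z. z + x) \<in> measurable borel (borel :: 'g measure)"
    unfolding measurable_haar_eq by (intro borel_measurable_continuous_onI continuous_intros)+
  have "\<mu> = distr (distr \<mu> borel uminus) borel (\<lambda>z. z + x)"
    by (simp add: distr_uminus distr_right)
  also have "\<dots> = distr \<mu> borel ((\<lambda>z. z + x) \<circ> uminus)" by (rule distr_distr[OF m(2,1)])
  also have "(\<lambda>z. z + x) \<circ> uminus = (\<lambda>y. - y + x)" by auto
  finally show ?thesis by (rule sym)
qed

text \<open>Submultiplicativity of \<omega> makes the double integral against a continuous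
  \<open>F\<close> dominated by \<omega> absolutely convergent; then Fubini's theorem and the
  substitution \<open>x = y + z\<close> apply.\<close>

lemma
  assumes w: "weight \<omega>" and a: "a \<in> beurling_fun \<mu> \<omega>" and b: "b \<in> beurling_fun \<mu> \<omega>"
  shows convolution_measurable: "convolution \<mu> a b \<in> borel_measurable (completion \<mu>)"
    and integral_convolution: "\<lbrakk>continuous_on UNIV F; 0 \<le> C; \<And>x. cmod (F x) \<le> C * \<omega> x\<rbrakk> \<Longrightarrow>
      (LINT x|completion \<mu>. convolution \<mu> a b x * F x)
        = (LINT y|completion \<mu>. a y * (LINT z|completion \<mu>. b z * F (y + z)))"
proof -
  obtain H a' b' where H: "sigma_compact_subgroup H"
    and a'b': "beurling_rep \<omega> H a a'" "beurling_rep \<omega> H b b'"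
    by (rule beurling_reps[OF w a b]) (rule that)
  note a' = beurling_repD[OF a'b'(1)] and b' = beurling_repD[OF a'b'(2)]
  have [measurable]: "a' \<in> borel_measurable borel" "b' \<in> borel_measurable borel" "\<omega> \<in> borel_measurable borel"
    using a'(2) b'(2) weightD(1)[OF w] by auto
  have T: "(\<lambda>y. - y + x) \<in> measurable borel (borel :: 'g measure)"
    "(\<lambda>z. x + z) \<in> measurable borel (borel :: 'g measure)"
    "(\<lambda>z. - x + z) \<in> measurable borel (borel :: 'g measure)" for x
    by (intro borel_measurable_continuous_onI continuous_intros)+
  have conv: "convolution \<mu> a b x = (\<integral>y. a' y * b' (- y + x) \<partial>\<mu>)" for x
    unfolding convolution_def
  proof (rule integral_completion_AE)
    show "(\<lambda>y. a' y * b' (- y + x)) \<in> borel_measurable borel"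
      using measurable_compose[OF T(1) b'(2)] a'(2) by measurable
    show "AE y in \<mu>. a y * b (- y + x) = a' y * b' (- y + x)"
      using a'(4) AE_translate[OF T(1)[of x] distr_reflect b'(4)] by eventually_elim simp
  qed
  define k0 where "k0 = (\<lambda>p. a' (fst p) * (indicator (H \<times> H) p *\<^sub>R b' (- fst p + snd p)))"
  have k0m: "k0 \<in> borel_measurable (borel \<Otimes>\<^sub>M borel)"
  proof -
    have "(\<lambda>p. indicator (H \<times> H) p *\<^sub>R b' (- fst p + snd p)) \<in> borel_measurable (borel \<Otimes>\<^sub>M borel)"
      by (rule joint_measurable_complex[OF H _ b'(1)]) (intro continuous_intros)
    then show ?thesis unfolding k0_def by measurable
  qed
  \<comment> \<open>The case that needs an argument is \<open>y \<in> H\<close>,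
    \<open>x \<notin> H\<close>: there \<open>- y + x\<close> lies outside the subgroup, so
    \<open>b'\<close> vanishes.\<close>
  have k0: "k0 (y, x) = a' y * b' (- y + x)" for y x
  proof (cases "y \<in> H \<and> x \<notin> H")
    case True
    have "- y + x \<notin> H"
    proof
      assume "- y + x \<in> H"
      then have "y + (- y + x) \<in> H" using True sigma_compact_subgroup_add[OF H] by blast
      then show False using True by (simp add: add.assoc[symmetric])
    qed
    then show ?thesis using True b'(3) by (simp add: k0_def)
  qed (use a'(3)[of y] in \<open>auto simp: k0_def indicator_def\<close>)
  have k00: "k0 (y, x) = 0" if "y \<notin> H \<or> x \<notin> H" for y x
    using that a'(3)[of y] by (auto simp: k0_def)
  have cm: "(\<lambda>x. \<integral>y. k0 (y, x) \<partial>\<mu>) \<in> borel_measurable borel"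
    by (rule borel_measurable_integral_part(2)[OF H k0m k00])
  have conv': "convolution \<mu> a b = (\<lambda>x. \<integral>y. k0 (y, x) \<partial>\<mu>)"
    by (rule ext) (simp add: conv k0)
  show "convolution \<mu> a b \<in> borel_measurable (completion \<mu>)"
    unfolding conv' by (rule borel_imp_completion[OF cm])
  assume F: "continuous_on UNIV F" and C: "0 \<le> C" "\<And>x. cmod (F x) \<le> C * \<omega> x"
  have Fm[measurable]: "F \<in> borel_measurable borel" by (rule borel_measurable_continuous_onI[OF F])
  define k where "k = (\<lambda>p. k0 p * F (snd p))"
  have km: "k \<in> borel_measurable (borel \<Otimes>\<^sub>M borel)" unfolding k_def using k0m by measurable
  have kz: "k (y, x) = 0" if "y \<notin> H \<or> x \<notin> H" for y x using k00[OF that] by (simp add: k_def)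
  have k: "k (y, x) = a' y * (b' (- y + x) * F x)" for y x by (simp add: k_def k0)
  have fin: "(\<integral>\<^sup>+y. \<integral>\<^sup>+x. ennreal (cmod (k (y, x))) \<partial>\<mu> \<partial>\<mu>) < \<infinity>"
  proof -
    have "(\<integral>\<^sup>+x. ennreal (cmod (k (y, x))) \<partial>\<mu>)
        \<le> (\<integral>\<^sup>+x. ennreal (C * (cmod (a' y) * \<omega> y) * (cmod (b' x) * \<omega> x)) \<partial>\<mu>)" for y
    proof -
      have "(\<lambda>x. ennreal (cmod (k (y, x)))) \<in> borel_measurable borel" using km by measurable
      from nn_integral_left[OF this, of y]
      have "(\<integral>\<^sup>+x. ennreal (cmod (k (y, x))) \<partial>\<mu>) = (\<integral>\<^sup>+x. ennreal (cmod (k (y, y + x))) \<partial>\<mu>)" by simp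
      also have "\<dots> \<le> (\<integral>\<^sup>+x. ennreal (C * (cmod (a' y) * \<omega> y) * (cmod (b' x) * \<omega> x)) \<partial>\<mu>)"
      proof (intro nn_integral_mono ennreal_leI)
        fix x
        have "cmod (F (y + x)) \<le> C * (\<omega> y * \<omega> x)"
          using C(2)[of "y + x"] mult_left_mono[OF weightD(3)[OF w, of y x] C(1)] by linarith
        then have "cmod (a' y * b' x) * cmod (F (y + x)) \<le> cmod (a' y * b' x) * (C * (\<omega> y * \<omega> x))"
          by (intro mult_left_mono) auto
        then show "cmod (k (y, y + x)) \<le> C * (cmod (a' y) * \<omega> y) * (cmod (b' x) * \<omega> x)"
          by (simp add: k norm_mult add.assoc[symmetric] mult_ac)
      qed
      finally show ?thesis .
    qed
    then have "(\<integral>\<^sup>+y. \<integral>\<^sup>+x. ennreal (cmod (k (y, x))) \<partial>\<mu> \<partial>\<mu>)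
        \<le> (\<integral>\<^sup>+y. \<integral>\<^sup>+x. ennreal (C * (cmod (a' y) * \<omega> y) * (cmod (b' x) * \<omega> x)) \<partial>\<mu> \<partial>\<mu>)"
      by (rule nn_integral_mono)
    also have "\<dots> < \<infinity>"
      using a'(5) b'(5) C(1) weightD(2)[OF w] by (intro nn_integral_product_finite) (auto simp: less_imp_le)
    finally show ?thesis .
  qed
  have k1: "(\<integral>x. k (y, x) \<partial>\<mu>) = a' y * (\<integral>z. b' z * F (y + z) \<partial>\<mu>)" for y
  proof -
    have "(\<lambda>x. b' (- y + x) * F x) \<in> borel_measurable borel"
      using measurable_compose[OF T(3) b'(2)] by measurable
    from integral_translate[OF T(2) distr_left this, of y]
    have "(\<integral>x. b' (- y + x) * F x \<partial>\<mu>) = (\<integral>z. b' z * F (y + z) \<partial>\<mu>)" by (simp add: add.assoc[symmetric])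
    then show ?thesis by (simp add: k)
  qed
  have k2: "(\<integral>y. k (y, x) \<partial>\<mu>) = convolution \<mu> a b x * F x" for x by (simp add: conv' k_def)
  have inner: "(LINT z|completion \<mu>. b z * F (y + z)) = (\<integral>z. b' z * F (y + z) \<partial>\<mu>)" for y
  proof (rule integral_completion_AE)
    show "(\<lambda>z. b' z * F (y + z)) \<in> borel_measurable borel"
      using measurable_compose[OF T(2) Fm] by measurable
  qed (use b'(4) in \<open>auto elim!: eventually_mono\<close>)
  have "(LINT x|completion \<mu>. convolution \<mu> a b x * F x) = (\<integral>x. \<integral>y. k (y, x) \<partial>\<mu> \<partial>\<mu>)"
    by (rule integral_completion_AE[OF borel_measurable_integral_part(2)[OF H km kz]]) (simp_all add: k2)
  also have "\<dots> = (\<integral>y. \<integral>x. k (y, x) \<partial>\<mu> \<partial>\<mu>)"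
    by (rule Fubini_integral_part[OF H km kz fin, symmetric])
  also have "\<dots> = (LINT y|completion \<mu>. a y * (LINT z|completion \<mu>. b z * F (y + z)))"
    unfolding inner
    by (rule integral_completion_AE[OF borel_measurable_integral_part(1)[OF H km kz], symmetric])
       (use a'(4) in \<open>auto simp: k1 elim!: eventually_mono\<close>)
  finally show "(LINT x|completion \<mu>. convolution \<mu> a b x * F x)
        = (LINT y|completion \<mu>. a y * (LINT z|completion \<mu>. b z * F (y + z)))" .
qed

text \<open>Left and right translation move \<open>y\<close> from \<open>F\<close> to
  \<open>b\<close>: the two sides pair \<open>F z\<close> with \<open>b (- y + z)\<close> and with
  \<open>b (z - y)\<close>, whose arguments are conjugate by \<open>y\<close>.\<close>

lemma integral_central:
  assumes w: "weight \<omega>" and b: "b \<in> beurling_fun \<mu> \<omega>"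
    and central: "\<And>g. AE x in \<mu>. b (- g + x + g) = b x" and F: "continuous_on UNIV F"
  shows "(LINT z|completion \<mu>. b z * F (y + z)) = (LINT z|completion \<mu>. b z * F (z + y))"
proof -
  obtain H b' where "sigma_compact_subgroup H" and b'': "beurling_rep \<omega> H b b'"
    using beurling_reps[OF w b b] by metis
  note b' = beurling_repD[OF b'']
  have T: "(\<lambda>z. y + z) \<in> measurable borel (borel :: 'g measure)"
    "(\<lambda>z. - y + z) \<in> measurable borel (borel :: 'g measure)"
    "(\<lambda>z. z + y) \<in> measurable borel (borel :: 'g measure)"
    "(\<lambda>z. z + - y) \<in> measurable borel (borel :: 'g measure)"
    by (intro borel_measurable_continuous_onI continuous_intros)+
  have Fm[measurable]: "F \<in> borel_measurable borel" by (rule borel_measurable_continuous_onI[OF F])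
  have [measurable]: "b' \<in> borel_measurable borel" by (rule b'(2))
  have m: "(\<lambda>z. b' (- y + z) * F z) \<in> borel_measurable borel" "(\<lambda>z. b' (z + - y) * F z) \<in> borel_measurable borel"
    using measurable_compose[OF T(2) b'(2)] measurable_compose[OF T(4) b'(2)] by measurable
  have m': "(\<lambda>z. b' z * F (y + z)) \<in> borel_measurable borel" "(\<lambda>z. b' z * F (z + y)) \<in> borel_measurable borel"
    using measurable_compose[OF T(1) Fm] measurable_compose[OF T(3) Fm] by measurable
  have "AE z in \<mu>. b (- y + (z + - y) + y) = b (z + - y)"
    by (rule AE_translate[OF T(4) distr_right central])
  moreover have "AE z in \<mu>. b (z + - y) = b' (z + - y)"
    by (rule AE_translate[OF T(4) distr_right b'(4)])
  moreover have "AE z in \<mu>. b (- y + z) = b' (- y + z)"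
    by (rule AE_translate[OF T(2) distr_left b'(4)])
  ultimately have ae: "AE z in \<mu>. b' (- y + z) * F z = b' (z + - y) * F z"
    by eventually_elim (simp add: group_simps del: add_uminus_conv_diff)
  have "(LINT z|completion \<mu>. b z * F (y + z)) = (\<integral>z. b' z * F (y + z) \<partial>\<mu>)"
    by (rule integral_completion_AE[OF m'(1)]) (use b'(4) in \<open>auto elim!: eventually_mono\<close>)
  also have "\<dots> = (\<integral>z. b' (- y + z) * F z \<partial>\<mu>)"
    using integral_translate[OF T(1) distr_left m(1)] by (simp add: add.assoc[symmetric])
  also have "\<dots> = (\<integral>z. b' (z + - y) * F z \<partial>\<mu>)"
    using ae m by (intro integral_cong_AE) (auto simp: measurable_haar_eq)
  also have "\<dots> = (\<integral>z. b' z * F (z + y) \<partial>\<mu>)"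
    using integral_translate[OF T(3) distr_right m(2)] by (simp add: add.assoc)
  also have "\<dots> = (LINT z|completion \<mu>. b z * F (z + y))"
    by (rule integral_completion_AE[OF m'(2), symmetric]) (use b'(4) in \<open>auto elim!: eventually_mono\<close>)
  finally show ?thesis .
qed

end

subsection \<open>The module of weighted continuous functions\<close>

lemma ae_rep_class:
  assumes "f \<in> borel_measurable (completion \<mu>)"
  shows "ae_rep (ae_class \<mu> f) \<in> ae_class \<mu> f"
    "ae_rep (ae_class \<mu> f) \<in> borel_measurable (completion \<mu>)" "AE x in \<mu>. ae_rep (ae_class \<mu> f) x = f x"
proof -
  have "f \<in> ae_class \<mu> f" using assms by (simp add: ae_class_def)
  from someI[where P = "\<lambda>h. h \<in> ae_class \<mu> f", OF this]
  show *: "ae_rep (ae_class \<mu> f) \<in> ae_class \<mu> f" by (simp only: ae_rep_def)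
  then show "ae_rep (ae_class \<mu> f) \<in> borel_measurable (completion \<mu>)" "AE x in \<mu>. ae_rep (ae_class \<mu> f) x = f x"
    by (auto simp: ae_class_def)
qed

text \<open>The bimodules in the definition of weak amenability consist of functions on the carrier type
  of the algebra; a function on the group becomes such a function through the following code of
  the points of the group.\<close>

definition point_code :: "'g \<Rightarrow> ('g \<Rightarrow> complex) set" where
  "point_code x = {\<lambda>t. if t = x then 1 else 0}"

definition point_decode :: "('g \<Rightarrow> complex) set \<Rightarrow> 'g" where
  "point_decode = inv point_code"

lemma point_decode_code [simp]: "point_decode (point_code x) = x"
proof -
  have "inj (point_code :: 'g \<Rightarrow> _)"
  proof (rule injI)
    fix x y :: 'g assume "point_code x = point_code y"
    then have "(\<lambda>t. if t = x then 1 else 0 :: complex) = (\<lambda>t. if t = y then 1 else 0)"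
      by (simp add: point_code_def)
    from fun_cong[OF this, of x] show "x = y" by (simp split: if_splits)
  qed
  then show ?thesis unfolding point_decode_def by (rule inv_f_f)
qed

section \<open>Representatives and kernel integrals for the central Beurling algebra\<close>

locale FC_beurling = FC_haar_measure \<mu> for \<mu> :: "'g::locally_compact_group_add measure" +
  fixes \<omega> :: "'g \<Rightarrow> real"
  assumes w: "weight \<omega>"
begin

abbreviation "ZL1 \<equiv> central_beurling_algebra \<mu> \<omega>"

lemma omega_pos [simp]: "0 < \<omega> x" and omega_add: "\<omega> (x + y) \<le> \<omega> x * \<omega> y"
  using weightD[OF w] by auto

lemma omega_nonneg [simp]: "0 \<le> \<omega> x" and omega_nonzero [simp]: "\<omega> x \<noteq> 0"
  by (metis less_imp_le omega_pos, metis less_irrefl omega_pos)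

lemma ZL1_rep:
  assumes "F \<in> vcarrier ZL1"
  shows "ae_rep F \<in> beurling_fun \<mu> \<omega>" "AE x in \<mu>. ae_rep F (- g + x + g) = ae_rep F x"
proof -
  from assms obtain f where f: "f \<in> beurling_fun \<mu> \<omega>" "F = ae_class \<mu> f"
    and c: "\<forall>f\<in>F. \<forall>g. AE x in \<mu>. f (- g + x + g) = f x"
    by (auto simp: central_beurling_algebra_def beurling_algebra_def)
  note r = ae_rep_class[OF beurling_funD(1)[OF f(1)], folded f(2)]
  show "AE x in \<mu>. ae_rep F (- g + x + g) = ae_rep F x" using c r(1) by blast
  have [measurable]: "ae_rep F \<in> borel_measurable (completion \<mu>)" "\<omega> \<in> borel_measurable (completion \<mu>)"
    using r(2) borel_imp_completion[OF weightD(1)[OF w]] by auto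
  have "integrable (completion \<mu>) (\<lambda>x. cmod (ae_rep F x) * \<omega> x)"
  proof (rule integrable_cong_AE_imp[OF beurling_funD(2)[OF f(1)]])
    show "AE x in completion \<mu>. cmod (f x) * \<omega> x = cmod (ae_rep F x) * \<omega> x"
      using AE_completion[OF r(3)] by eventually_elim simp
  qed measurable
  then show "ae_rep F \<in> beurling_fun \<mu> \<omega>" using r(2) by (simp add: beurling_fun_def)
qed

abbreviation "rep \<equiv> ae_rep :: ('g \<Rightarrow> complex) set \<Rightarrow> _"

lemma
  assumes a: "a \<in> vcarrier ZL1" and b: "b \<in> vcarrier ZL1"
  shows rep_add: "AE x in \<mu>. rep (vadd ZL1 a b) x = rep a x + rep b x"
    and rep_scale: "AE x in \<mu>. rep (vscale ZL1 c a) x = c * rep a x"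
    and rep_mult: "AE x in \<mu>. rep (vmult ZL1 a b) x = convolution \<mu> (rep a) (rep b) x"
    and rep_add_measurable: "rep (vadd ZL1 a b) \<in> borel_measurable (completion \<mu>)"
    and rep_scale_measurable: "rep (vscale ZL1 c a) \<in> borel_measurable (completion \<mu>)"
    and rep_mult_measurable: "rep (vmult ZL1 a b) \<in> borel_measurable (completion \<mu>)"
proof -
  note ab = beurling_funD(1)[OF ZL1_rep(1)[OF a]] beurling_funD(1)[OF ZL1_rep(1)[OF b]]
  have s: "(\<lambda>x. rep a x + rep b x) \<in> borel_measurable (completion \<mu>)"
    "(\<lambda>x. c * rep a x) \<in> borel_measurable (completion \<mu>)"
    using ab by measurable
  note p = convolution_measurable[OF w ZL1_rep(1)[OF a] ZL1_rep(1)[OF b]]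
  show "AE x in \<mu>. rep (vadd ZL1 a b) x = rep a x + rep b x"
    "AE x in \<mu>. rep (vscale ZL1 c a) x = c * rep a x"
    "AE x in \<mu>. rep (vmult ZL1 a b) x = convolution \<mu> (rep a) (rep b) x"
    "rep (vadd ZL1 a b) \<in> borel_measurable (completion \<mu>)"
    "rep (vscale ZL1 c a) \<in> borel_measurable (completion \<mu>)"
    "rep (vmult ZL1 a b) \<in> borel_measurable (completion \<mu>)"
    using ae_rep_class[OF s(1)] ae_rep_class[OF s(2)] ae_rep_class[OF p]
    by (simp_all add: central_beurling_algebra_def beurling_algebra_def)
qed

lemma norm_ZL1: "vnorm ZL1 a = (LINT x|completion \<mu>. cmod (rep a x) * \<omega> x)"
  by (simp add: central_beurling_algebra_def beurling_algebra_def)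

lemma integral_kernel_cong:
  assumes "f \<in> borel_measurable (completion \<mu>)" "g \<in> borel_measurable (completion \<mu>)"
    and "AE x in \<mu>. f x = g x" "continuous_on UNIV K"
  shows "(LINT y|completion \<mu>. f y * K y) = (LINT y|completion \<mu>. g y * (K y :: complex))"
proof (rule integral_cong_AE)
  have [measurable]: "K \<in> borel_measurable (completion \<mu>)"
    using assms(4) by (intro borel_imp_completion borel_measurable_continuous_onI)
  show "(\<lambda>y. f y * K y) \<in> borel_measurable (completion \<mu>)" "(\<lambda>y. g y * K y) \<in> borel_measurable (completion \<mu>)"
    using assms(1,2) by measurable
  show "AE x in completion \<mu>. f x * K x = g x * K x"
    using AE_completion[OF assms(3)] by eventually_elim simp
qed

lemma
  assumes K: "continuous_on UNIV K" "\<And>y. cmod (K y) \<le> C * \<omega> y"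
    and a: "a \<in> vcarrier ZL1" and b: "b \<in> vcarrier ZL1"
  shows integral_kernel_add: "(LINT y|completion \<mu>. rep (vadd ZL1 a b) y * K y)
      = (LINT y|completion \<mu>. rep a y * K y) + (LINT y|completion \<mu>. rep b y * K y)"
    and integral_kernel_scale: "(LINT y|completion \<mu>. rep (vscale ZL1 c a) y * K y)
      = c * (LINT y|completion \<mu>. rep a y * K y)"
    and integral_kernel_bound: "cmod (LINT y|completion \<mu>. rep a y * K y) \<le> C * vnorm ZL1 a"
proof -
  note i = kernel_integrable[OF w ZL1_rep(1)[OF a] K] kernel_integrable[OF w ZL1_rep(1)[OF b] K]
  note ab = beurling_funD(1)[OF ZL1_rep(1)[OF a]] beurling_funD(1)[OF ZL1_rep(1)[OF b]]
  have m: "(\<lambda>x. rep a x + rep b x) \<in> borel_measurable (completion \<mu>)"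
    "(\<lambda>x. c * rep a x) \<in> borel_measurable (completion \<mu>)"
    using ab by measurable
  have "(LINT y|completion \<mu>. rep (vadd ZL1 a b) y * K y) = (LINT y|completion \<mu>. (rep a y + rep b y) * K y)"
    by (rule integral_kernel_cong[OF rep_add_measurable[OF a b] m(1) rep_add[OF a b] K(1)])
  also have "\<dots> = (LINT y|completion \<mu>. rep a y * K y) + (LINT y|completion \<mu>. rep b y * K y)"
    using i by (simp add: distrib_right)
  finally show "(LINT y|completion \<mu>. rep (vadd ZL1 a b) y * K y)
      = (LINT y|completion \<mu>. rep a y * K y) + (LINT y|completion \<mu>. rep b y * K y)" .
  have "(LINT y|completion \<mu>. rep (vscale ZL1 c a) y * K y) = (LINT y|completion \<mu>. (c * rep a y) * K y)"
    by (rule integral_kernel_cong[OF rep_scale_measurable[OF a b] m(2) rep_scale[OF a b] K(1)])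
  also have "\<dots> = c * (LINT y|completion \<mu>. rep a y * K y)"
    by (simp add: mult.assoc)
  finally show "(LINT y|completion \<mu>. rep (vscale ZL1 c a) y * K y)
      = c * (LINT y|completion \<mu>. rep a y * K y)" .
  show "cmod (LINT y|completion \<mu>. rep a y * K y) \<le> C * vnorm ZL1 a"
    using i(2) by (simp add: norm_ZL1)
qed

lemma integral_kernel_mult:
  assumes K: "continuous_on UNIV K" "\<And>y. cmod (K y) \<le> C * \<omega> y" and C: "0 \<le> C"
    and a: "a \<in> vcarrier ZL1" and b: "b \<in> vcarrier ZL1"
  shows "(LINT y|completion \<mu>. rep (vmult ZL1 a b) y * K y)
    = (LINT y|completion \<mu>. rep a y * (LINT z|completion \<mu>. rep b z * K (y + z)))"
  using integral_kernel_cong[OF rep_mult_measurable[OF a b]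
      convolution_measurable[OF w ZL1_rep(1)[OF a] ZL1_rep(1)[OF b]] rep_mult[OF a b] K(1)]
    integral_convolution[OF w ZL1_rep(1)[OF a] ZL1_rep(1)[OF b] K(1) C K(2)] by simp

text \<open>Such functions pair with the Beurling algebra by integration. They have values at
  points, unlike functionals or almost-everywhere classes, and the derivation will be evaluated at
  0.\<close>

definition weighted_continuous :: "('g \<Rightarrow> complex) set" where
  "weighted_continuous = {\<phi>. continuous_on UNIV \<phi> \<and> (\<exists>C. \<forall>x. cmod (\<phi> x) \<le> C * \<omega> x)}"

definition wnorm :: "('g \<Rightarrow> complex) \<Rightarrow> real" where
  "wnorm \<phi> = (SUP x. cmod (\<phi> x) / \<omega> x)"

lemma weighted_continuousI:
  "continuous_on UNIV \<phi> \<Longrightarrow> (\<And>x. cmod (\<phi> x) \<le> C * \<omega> x) \<Longrightarrow> \<phi> \<in> weighted_continuous"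
  by (auto simp: weighted_continuous_def)

lemma weighted_continuousD: "\<phi> \<in> weighted_continuous \<Longrightarrow> continuous_on UNIV \<phi>"
  by (auto simp: weighted_continuous_def)

lemma wnorm_least: "(\<And>x. cmod (\<phi> x) \<le> C * \<omega> x) \<Longrightarrow> wnorm \<phi> \<le> C"
  unfolding wnorm_def by (intro cSUP_least) (auto simp: divide_le_eq)

lemma wnorm_bound:
  assumes "\<phi> \<in> weighted_continuous"
  shows "cmod (\<phi> x) \<le> wnorm \<phi> * \<omega> x"
proof -
  obtain C where "\<forall>x. cmod (\<phi> x) \<le> C * \<omega> x" using assms by (auto simp: weighted_continuous_def)
  then have "bdd_above (range (\<lambda>x. cmod (\<phi> x) / \<omega> x))"
    by (intro bdd_aboveI[of _ C]) (auto simp: divide_le_eq)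
  then have "cmod (\<phi> x) / \<omega> x \<le> wnorm \<phi>" unfolding wnorm_def by (intro cSUP_upper) auto
  then show ?thesis by (simp add: divide_le_eq)
qed

lemma wnorm_nonneg:
  assumes "\<phi> \<in> weighted_continuous"
  shows "0 \<le> wnorm \<phi>"
proof -
  have "0 \<le> wnorm \<phi> * \<omega> 0" using order_trans[OF norm_ge_zero wnorm_bound[OF assms]] .
  then show ?thesis using omega_pos[of 0] by (simp add: zero_le_mult_iff)
qed

lemma weighted_continuous_add:
  assumes "\<phi> \<in> weighted_continuous" "\<psi> \<in> weighted_continuous"
  shows "(\<lambda>x. \<phi> x + \<psi> x) \<in> weighted_continuous" "wnorm (\<lambda>x. \<phi> x + \<psi> x) \<le> wnorm \<phi> + wnorm \<psi>"
proof -
  have le: "cmod (\<phi> x + \<psi> x) \<le> (wnorm \<phi> + wnorm \<psi>) * \<omega> x" for x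
    using norm_triangle_le[OF add_mono[OF wnorm_bound[OF assms(1)] wnorm_bound[OF assms(2)]]]
    by (simp add: distrib_right)
  then show "wnorm (\<lambda>x. \<phi> x + \<psi> x) \<le> wnorm \<phi> + wnorm \<psi>" by (rule wnorm_least)
  show "(\<lambda>x. \<phi> x + \<psi> x) \<in> weighted_continuous"
    using le by (intro weighted_continuousI continuous_intros assms[THEN weighted_continuousD])
qed

lemma weighted_continuous_scale:
  assumes "\<phi> \<in> weighted_continuous"
  shows "(\<lambda>x. c * \<phi> x) \<in> weighted_continuous" "wnorm (\<lambda>x. c * \<phi> x) = cmod c * wnorm \<phi>"
proof -
  have 1: "(\<lambda>x. c * \<phi> x) \<in> weighted_continuous \<and> wnorm (\<lambda>x. c * \<phi> x) \<le> cmod c * wnorm \<phi>"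
    if "\<phi> \<in> weighted_continuous" for c \<phi>
  proof -
    have le: "cmod (c * \<phi> x) \<le> (cmod c * wnorm \<phi>) * \<omega> x" for x
      using mult_left_mono[OF wnorm_bound[OF that], of "cmod c" x] by (simp add: norm_mult mult.assoc)
    then show ?thesis
      by (intro conjI wnorm_least weighted_continuousI continuous_intros weighted_continuousD[OF that])
  qed
  show 2: "(\<lambda>x. c * \<phi> x) \<in> weighted_continuous" using 1[OF assms] by simp
  show "wnorm (\<lambda>x. c * \<phi> x) = cmod c * wnorm \<phi>"
  proof (cases "c = 0")
    case True
    then show ?thesis by (simp add: wnorm_def)
  next
    case False
    \<comment> \<open>The reverse inequality is the first estimate applied to the factor
      \<open>1 / c\<close>.\<close>
    then have "wnorm \<phi> \<le> cmod (1 / c) * wnorm (\<lambda>x. c * \<phi> x)"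
      using 1[OF 2, of "1 / c"] by (simp add: mult.assoc[symmetric])
    then have "cmod c * wnorm \<phi> \<le> wnorm (\<lambda>x. c * \<phi> x)"
      using False by (simp add: norm_divide divide_simps mult.commute)
    then show ?thesis using 1[OF assms, of c] by simp
  qed
qed

text \<open>As \<omega> is locally bounded, convergence relative to \<omega> is locally uniform, so
  the limit is continuous although \<omega> itself need not be.\<close>

lemma weighted_continuous_complete:
  assumes s: "\<And>n. s n \<in> weighted_continuous"
    and cauchy: "\<And>e. e > 0 \<Longrightarrow> \<exists>N. \<forall>m\<ge>N. \<forall>n\<ge>N. wnorm (\<lambda>x. s m x - s n x) < e"
  shows "\<exists>\<phi>\<in>weighted_continuous. (\<lambda>n. wnorm (\<lambda>x. s n x - \<phi> x)) \<longlonglongrightarrow> 0"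
proof -
  have d: "(\<lambda>x. s m x - s n x) \<in> weighted_continuous" for m n
    using weighted_continuous_add(1)[OF s weighted_continuous_scale(1)[OF s, of "-1"], of m n] by simp
  have c1: "\<exists>N. \<forall>m\<ge>N. \<forall>n\<ge>N. \<forall>x. cmod (s m x - s n x) \<le> e * \<omega> x" if e: "e > 0" for e
  proof -
    obtain N where N: "\<forall>m\<ge>N. \<forall>n\<ge>N. wnorm (\<lambda>x. s m x - s n x) < e" using cauchy[OF e] by auto
    have "cmod (s m x - s n x) \<le> e * \<omega> x" if "m \<ge> N" "n \<ge> N" for m n x
    proof -
      have "wnorm (\<lambda>x. s m x - s n x) * \<omega> x \<le> e * \<omega> x"
        using N that by (intro mult_right_mono less_imp_le) auto
      with wnorm_bound[OF d] show ?thesis by (rule order_trans)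
    qed
    then show ?thesis by blast
  qed
  have "Cauchy (\<lambda>n. s n x)" for x
  proof (rule metric_CauchyI)
    fix e :: real assume "0 < e"
    then have "0 < e / 2 / \<omega> x" by simp
    from c1[OF this] obtain N where N: "\<And>m n. m \<ge> N \<Longrightarrow> n \<ge> N \<Longrightarrow> cmod (s m x - s n x) \<le> e / 2 / \<omega> x * \<omega> x"
      by blast
    have "dist (s m x) (s n x) < e" if "m \<ge> N" "n \<ge> N" for m n
      using N[OF that] \<open>0 < e\<close> by (simp add: dist_norm)
    then show "\<exists>N. \<forall>m\<ge>N. \<forall>n\<ge>N. dist (s m x) (s n x) < e" by blast
  qed
  then have "\<forall>x. \<exists>l. (\<lambda>n. s n x) \<longlonglongrightarrow> l"
    using Cauchy_convergent unfolding convergent_def by blast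
  from choice[OF this] obtain \<phi> where \<phi>: "\<And>x. (\<lambda>n. s n x) \<longlonglongrightarrow> \<phi> x" by blast
  have c2: "\<exists>N. \<forall>n\<ge>N. \<forall>x. cmod (s n x - \<phi> x) \<le> e * \<omega> x" if e: "e > 0" for e
  proof -
    obtain N where N: "\<And>m n x. m \<ge> N \<Longrightarrow> n \<ge> N \<Longrightarrow> cmod (s m x - s n x) \<le> e * \<omega> x" using c1[OF e] by blast
    have "cmod (s n x - \<phi> x) \<le> e * \<omega> x" if "n \<ge> N" for n x
    proof (rule Lim_bounded)
      show "(\<lambda>m. cmod (s n x - s m x)) \<longlonglongrightarrow> cmod (s n x - \<phi> x)" by (intro tendsto_intros \<phi>)
      show "\<forall>m\<ge>N. cmod (s n x - s m x) \<le> e * \<omega> x" using N that by blast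
    qed
    then show ?thesis by blast
  qed
  have "isCont \<phi> x0" for x0
  proof -
    obtain U V where UV: "open U" "compact V" "x0 \<in> U" "U \<subseteq> V" using locally_compact by metis
    obtain M where M: "0 < M" "\<And>x. x \<in> V \<Longrightarrow> \<omega> x \<le> M" using weight_bounded[OF w UV(2)] by metis
    have "continuous_on U \<phi>"
    proof (rule uniform_limit_theorem)
      show "\<forall>\<^sub>F n in sequentially. continuous_on U (s n)"
        using continuous_on_subset[OF weighted_continuousD[OF s]] by auto
      show "uniform_limit U s \<phi> sequentially"
      proof (rule uniform_limitI)
        fix e :: real assume e: "0 < e"
        then obtain N where N: "\<And>n x. n \<ge> N \<Longrightarrow> cmod (s n x - \<phi> x) \<le> e / (2 * M) * \<omega> x"
          using c2[of "e / (2 * M)"] M(1) by auto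
        have "dist (s n x) (\<phi> x) < e" if "n \<ge> N" "x \<in> U" for n x
        proof -
          have "cmod (s n x - \<phi> x) \<le> e / (2 * M) * \<omega> x" by (rule N[OF that(1)])
          also have "\<dots> \<le> e / (2 * M) * M" using that UV M e by (intro mult_left_mono) auto
          also have "\<dots> < e" using M e by simp
          finally show ?thesis by (simp add: dist_norm)
        qed
        then show "\<forall>\<^sub>F n in sequentially. \<forall>x\<in>U. dist (s n x) (\<phi> x) < e"
          unfolding eventually_sequentially by blast
      qed
    qed auto
    then show ?thesis using UV by (simp add: continuous_on_eq_continuous_at)
  qed
  then have cont: "continuous_on UNIV \<phi>" by (intro continuous_at_imp_continuous_on) auto
  have dW: "(\<lambda>x. s n x - \<phi> x) \<in> weighted_continuous" if "\<forall>x. cmod (s n x - \<phi> x) \<le> e * \<omega> x" for n e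
    using that by (intro weighted_continuousI[of _ e] continuous_intros cont weighted_continuousD[OF s]) auto
  obtain N where "\<forall>x. cmod (s N x - \<phi> x) \<le> 1 * \<omega> x" using c2[of 1] by auto
  from weighted_continuous_add(1)[OF s weighted_continuous_scale(1)[OF dW[OF this], of "-1"], of N]
  have W: "\<phi> \<in> weighted_continuous" by simp
  have "(\<lambda>n. wnorm (\<lambda>x. s n x - \<phi> x)) \<longlonglongrightarrow> 0"
  proof (rule LIMSEQ_I)
    fix e :: real assume e: "0 < e"
    then obtain N where N: "\<And>n x. n \<ge> N \<Longrightarrow> cmod (s n x - \<phi> x) \<le> e / 2 * \<omega> x" using c2[of "e / 2"] by auto
    have "norm (wnorm (\<lambda>x. s n x - \<phi> x) - 0) < e" if "n \<ge> N" for n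
    proof -
      have "wnorm (\<lambda>x. s n x - \<phi> x) \<le> e / 2" using N[OF that] by (rule wnorm_least)
      moreover have "0 \<le> wnorm (\<lambda>x. s n x - \<phi> x)"
        by (intro wnorm_nonneg dW[of _ "e / 2"]) (use N that in blast)
      ultimately show ?thesis using e by simp
    qed
    then show "\<exists>N. \<forall>n\<ge>N. norm (wnorm (\<lambda>x. s n x - \<phi> x) - 0) < e" by blast
  qed
  with W show ?thesis by blast
qed

text \<open>Composition with a decoding defined everywhere makes \<open>enc\<close> commute with the
  pointwise operations, so these stay in its range.\<close>

definition enc :: "('g \<Rightarrow> complex) \<Rightarrow> ('g \<Rightarrow> complex) set \<Rightarrow> complex" where
  "enc \<phi> = (\<lambda>F. \<phi> (point_decode F))"

definition dec :: "(('g \<Rightarrow> complex) set \<Rightarrow> complex) \<Rightarrow> 'g \<Rightarrow> complex" where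
  "dec S = (\<lambda>x. S (point_code x))"

lemma dec_enc [simp]: "dec (enc \<phi>) = \<phi>"
  by (simp add: dec_def enc_def)

definition wspace :: "(('g \<Rightarrow> complex) set \<Rightarrow> complex) cspace" where
  "wspace = \<lparr> vcarrier = enc ` weighted_continuous, vzero = (\<lambda>F. 0), vadd = (\<lambda>S T F. S F + T F),
     vscale = (\<lambda>c S F. c * S F), vnorm = (\<lambda>S. wnorm (dec S)) \<rparr>"

lemma wspace_simps [simp]:
  "vcarrier wspace = enc ` weighted_continuous" "vzero wspace = (\<lambda>F. 0)"
  "vadd wspace S T = (\<lambda>F. S F + T F)" "vscale wspace c S = (\<lambda>F. c * S F)"
  "vnorm wspace S = wnorm (dec S)"
  by (simp_all add: wspace_def)

lemma enc_add: "(\<lambda>F. enc \<phi> F + enc \<psi> F) = enc (\<lambda>x. \<phi> x + \<psi> x)"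
  and enc_scale: "(\<lambda>F. c * enc \<phi> F) = enc (\<lambda>x. c * \<phi> x)"
  and enc_zero: "(\<lambda>F. 0) = enc (\<lambda>x. 0)"
  by (simp_all add: enc_def)

lemma enc_inject: "enc \<phi> = enc \<psi> \<longleftrightarrow> \<phi> = \<psi>"
  by (metis dec_enc)

lemma weighted_continuous_zero: "(\<lambda>x. 0) \<in> weighted_continuous"
  by (rule weighted_continuousI[of _ 0]) auto

lemma wspace_banach: "complex_banach_space wspace"
proof
  show "vzero wspace \<in> vcarrier wspace"
    using weighted_continuous_zero by (simp add: enc_zero)
next
  fix S T assume "S \<in> vcarrier wspace" "T \<in> vcarrier wspace"
  then show "vadd wspace S T \<in> vcarrier wspace"
    by (auto simp: enc_add weighted_continuous_add)
next
  fix S c assume "S \<in> vcarrier wspace"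
  then show "vscale wspace c S \<in> vcarrier wspace"
    by (auto simp: enc_scale weighted_continuous_scale)
next
  fix S assume "S \<in> vcarrier wspace"
  then obtain \<phi> where \<phi>: "\<phi> \<in> weighted_continuous" "S = enc \<phi>" by auto
  show "0 \<le> vnorm wspace S" using \<phi> by (simp add: wnorm_nonneg)
  show "vnorm wspace S = 0 \<longleftrightarrow> S = vzero wspace"
  proof
    assume "vnorm wspace S = 0"
    then have "\<phi> x = 0" for x using wnorm_bound[OF \<phi>(1), of x] \<phi> by simp
    then have "\<phi> = (\<lambda>x. 0)" by auto
    then show "S = vzero wspace" by (simp add: \<phi> enc_def)
  next
    assume "S = vzero wspace"
    then have "\<phi> = (\<lambda>x. 0)" by (simp add: \<phi> enc_zero enc_inject)
    then show "vnorm wspace S = 0" by (simp add: \<phi> wnorm_def)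
  qed
  show "vnorm wspace (vscale wspace c S) = cmod c * vnorm wspace S" for c
    using \<phi> by (simp add: enc_scale weighted_continuous_scale)
next
  fix S T assume "S \<in> vcarrier wspace" "T \<in> vcarrier wspace"
  then show "vnorm wspace (vadd wspace S T) \<le> vnorm wspace S + vnorm wspace T"
    by (auto simp: enc_add weighted_continuous_add)
next
  fix s :: "nat \<Rightarrow> ('g \<Rightarrow> complex) set \<Rightarrow> complex"
  assume s: "\<And>n. s n \<in> vcarrier wspace"
    and c: "\<And>e. e > 0 \<Longrightarrow> \<exists>N. \<forall>m\<ge>N. \<forall>n\<ge>N. vdist wspace (s m) (s n) < e"
  have "\<forall>n. \<exists>\<phi>. \<phi> \<in> weighted_continuous \<and> s n = enc \<phi>" using s by auto
  from choice[OF this] obtain \<phi> where \<phi>: "\<And>n. \<phi> n \<in> weighted_continuous" "\<And>n. s n = enc (\<phi> n)" by auto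
  have vd: "vdist wspace (enc \<phi>) (enc \<psi>) = wnorm (\<lambda>x. \<phi> x - \<psi> x)" for \<phi> \<psi>
    by (simp add: vdist_def dec_def enc_def)
  have "\<exists>\<psi>\<in>weighted_continuous. (\<lambda>n. wnorm (\<lambda>x. \<phi> n x - \<psi> x)) \<longlonglongrightarrow> 0"
    by (rule weighted_continuous_complete[OF \<phi>(1)]) (use c in \<open>simp add: \<phi>(2) vd\<close>)
  then show "\<exists>x\<in>vcarrier wspace. (\<lambda>n. vdist wspace (s n) x) \<longlonglongrightarrow> 0"
    by (auto simp: \<phi>(2) vd)
qed (auto simp: algebra_simps)

definition act :: "('g \<Rightarrow> complex) set \<Rightarrow> (('g \<Rightarrow> complex) set \<Rightarrow> complex) \<Rightarrow> ('g \<Rightarrow> complex) set \<Rightarrow> complex" where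
  "act a S = enc (\<lambda>x. LINT y|completion \<mu>. rep a y * dec S (x + y))"

lemma translate_kernel:
  assumes "\<phi> \<in> weighted_continuous"
  shows "continuous_on UNIV (\<lambda>y. \<phi> (x + y))" "continuous_on UNIV (\<lambda>p. \<phi> (fst p + snd p))"
    "cmod (\<phi> (x + y)) \<le> wnorm \<phi> * \<omega> x * \<omega> y"
proof -
  note c = weighted_continuousD[OF assms]
  show "continuous_on UNIV (\<lambda>y. \<phi> (x + y))" "continuous_on UNIV (\<lambda>p. \<phi> (fst p + snd p))"
    by (intro continuous_on_compose2[OF c] continuous_intros; simp)+
  have "cmod (\<phi> (x + y)) \<le> wnorm \<phi> * \<omega> (x + y)" by (rule wnorm_bound[OF assms])
  also have "\<dots> \<le> wnorm \<phi> * (\<omega> x * \<omega> y)"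
    by (intro mult_left_mono omega_add wnorm_nonneg assms)
  finally show "cmod (\<phi> (x + y)) \<le> wnorm \<phi> * \<omega> x * \<omega> y" by (simp add: mult.assoc)
qed

lemma act_closed:
  assumes a: "a \<in> vcarrier ZL1" and \<phi>: "\<phi> \<in> weighted_continuous"
  shows "(\<lambda>x. LINT y|completion \<mu>. rep a y * \<phi> (x + y)) \<in> weighted_continuous"
    "wnorm (\<lambda>x. LINT y|completion \<mu>. rep a y * \<phi> (x + y)) \<le> vnorm ZL1 a * wnorm \<phi>"
proof -
  note k = translate_kernel[OF \<phi>]
  have le: "cmod (LINT y|completion \<mu>. rep a y * \<phi> (x + y)) \<le> (vnorm ZL1 a * wnorm \<phi>) * \<omega> x" for x
    using integral_kernel_bound[OF k(1,3) a a, of x] by (simp add: mult_ac)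
  have "continuous_on UNIV (\<lambda>x. LINT y|completion \<mu>. rep a y * (\<lambda>p. \<phi> (fst p + snd p)) (x, y))"
    by (rule kernel_integral_continuous[OF w ZL1_rep(1)[OF a] k(2) wnorm_nonneg[OF \<phi>]]) (simp add: k)
  then show "(\<lambda>x. LINT y|completion \<mu>. rep a y * \<phi> (x + y)) \<in> weighted_continuous"
    using le by (intro weighted_continuousI) auto
  show "wnorm (\<lambda>x. LINT y|completion \<mu>. rep a y * \<phi> (x + y)) \<le> vnorm ZL1 a * wnorm \<phi>"
    using le by (rule wnorm_least)
qed

lemma act_mult:
  assumes a: "a \<in> vcarrier ZL1" and b: "b \<in> vcarrier ZL1" and S: "S \<in> vcarrier wspace"
  shows "act (vmult ZL1 a b) S = act a (act b S)"
proof -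
  obtain \<phi> where \<phi>: "\<phi> \<in> weighted_continuous" "S = enc \<phi>" using S by auto
  note k = translate_kernel[OF \<phi>(1)]
  have "(LINT y|completion \<mu>. rep (vmult ZL1 a b) y * \<phi> (x + y))
      = (LINT y|completion \<mu>. rep a y * (LINT z|completion \<mu>. rep b z * \<phi> (x + (y + z))))" for x
    using wnorm_nonneg[OF \<phi>(1)] by (intro integral_kernel_mult[OF k(1,3) _ a b]) simp
  then show ?thesis by (simp add: act_def \<phi>(2) add.assoc)
qed

lemma act_commute:
  assumes a: "a \<in> vcarrier ZL1" and b: "b \<in> vcarrier ZL1" and S: "S \<in> vcarrier wspace"
  shows "act a (act b S) = act b (act a S)"
proof -
  obtain \<phi> where \<phi>: "\<phi> \<in> weighted_continuous" "S = enc \<phi>" using S by auto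
  note k = translate_kernel[OF \<phi>(1)]
  have "(LINT y|completion \<mu>. rep a y * (LINT z|completion \<mu>. rep b z * \<phi> (x + y + z)))
      = (LINT z|completion \<mu>. rep b z * (LINT y|completion \<mu>. rep a y * \<phi> (x + z + y)))" for x
  proof -
    let ?K = "\<lambda>p. \<phi> (x + (snd p + fst p))"
    have "(LINT y|completion \<mu>. rep a y * (LINT z|completion \<mu>. rep b z * \<phi> (x + (y + z))))
        = (LINT y|completion \<mu>. rep a y * (LINT z|completion \<mu>. rep b z * \<phi> (x + (z + y))))"
      unfolding integral_central[OF w ZL1_rep(1)[OF b] ZL1_rep(2)[OF b] k(1)[of x]] ..
    also have "\<dots> = (LINT y|completion \<mu>. rep a y * (LINT z|completion \<mu>. rep b z * ?K (y, z)))" by simp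
    also have "\<dots> = (LINT z|completion \<mu>. rep b z * (LINT y|completion \<mu>. rep a y * ?K (y, z)))"
    proof (rule Fubini_beurling[OF w ZL1_rep(1)[OF a] ZL1_rep(1)[OF b]])
      show "continuous_on UNIV ?K"
        by (intro continuous_on_compose2[OF weighted_continuousD[OF \<phi>(1)]] continuous_intros) auto
      show "0 \<le> wnorm \<phi> * \<omega> x" using wnorm_nonneg[OF \<phi>(1)] by simp
      fix y z
      have "cmod (\<phi> (x + (z + y))) \<le> wnorm \<phi> * \<omega> x * \<omega> (z + y)" by (rule k(3))
      also have "\<dots> \<le> wnorm \<phi> * \<omega> x * (\<omega> z * \<omega> y)"
        using wnorm_nonneg[OF \<phi>(1)] by (intro mult_left_mono omega_add) simp
      finally show "cmod (?K (y, z)) \<le> wnorm \<phi> * \<omega> x * \<omega> y * \<omega> z" by (simp add: mult_ac)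
    qed
    finally show ?thesis by (simp add: add.assoc)
  qed
  then show ?thesis by (simp add: act_def \<phi>(2))
qed

lemma act_bilinear:
  "\<And>a. a \<in> vcarrier ZL1 \<Longrightarrow> clinear_on wspace wspace (act a)"
  "\<And>S. S \<in> vcarrier wspace \<Longrightarrow> clinear_on ZL1 wspace (\<lambda>a. act a S)"
  "\<And>a S. a \<in> vcarrier ZL1 \<Longrightarrow> S \<in> vcarrier wspace \<Longrightarrow> vnorm wspace (act a S) \<le> vnorm ZL1 a * vnorm wspace S"
proof -
  fix a assume a: "a \<in> vcarrier ZL1"
  have i: "integrable (completion \<mu>) (\<lambda>y. rep a y * \<phi> (x + y))" if "\<phi> \<in> weighted_continuous" for \<phi> x
    by (rule kernel_integrable(1)[OF w ZL1_rep(1)[OF a] translate_kernel(1,3)[OF that]])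
  show "clinear_on wspace wspace (act a)"
    unfolding clinear_on_def
    by (auto simp: enc_add enc_scale act_def act_closed[OF a] i distrib_left mult.left_commute)
next
  fix S assume "S \<in> vcarrier wspace"
  then obtain \<phi> where \<phi>: "\<phi> \<in> weighted_continuous" "S = enc \<phi>" by auto
  note k = translate_kernel(1,3)[OF \<phi>(1)]
  show "clinear_on ZL1 wspace (\<lambda>a. act a S)"
    unfolding clinear_on_def
    by (auto simp: enc_add enc_scale act_def act_closed \<phi> integral_kernel_add[OF k] integral_kernel_scale[OF k])
next
  fix a S assume "a \<in> vcarrier ZL1" "S \<in> vcarrier wspace"
  then show "vnorm wspace (act a S) \<le> vnorm ZL1 a * vnorm wspace S"
    by (auto simp: act_def act_closed)
qed

text \<open>One map serves on both sides, so the right module law and the compatibility of the two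
  actions come from \<open>act_commute\<close>.\<close>

lemma wspace_bimodule: "symmetric_banach_bimodule ZL1 wspace act (\<lambda>S a. act a S)"
proof -
  interpret complex_banach_space wspace by (rule wspace_banach)
  show ?thesis
  proof
    show "bounded_cbilinear_on ZL1 wspace wspace act"
      unfolding bounded_cbilinear_on_def using act_bilinear by (intro conjI exI[of _ 1]) auto
    show "bounded_cbilinear_on wspace ZL1 wspace (\<lambda>S a. act a S)"
      unfolding bounded_cbilinear_on_def using act_bilinear
      by (intro conjI exI[of _ 1]) (auto simp: mult.commute)
  qed (simp_all only: act_mult act_commute)
qed

subsection \<open>The derivation\<close>

text \<open>Multiplication by \<Phi> is formally a derivation of the algebra, but the product of
  \<Phi> and \<open>a\<close> may have infinite norm. This is the action of that product on \<phi>,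
  written out as an integral.\<close>

definition deriv_map :: "('g \<Rightarrow> complex) \<Rightarrow> ('g \<Rightarrow> complex) \<Rightarrow> ('g \<Rightarrow> complex) set \<Rightarrow> ('g \<Rightarrow> complex) set \<Rightarrow> complex" where
  "deriv_map \<Phi> \<phi> a = enc (\<lambda>x. LINT y|completion \<mu>. rep a y * (\<Phi> y * \<phi> (x + y)))"

text \<open>Additivity splits \<open>\<Phi> (y + z)\<close> in the double integral for a product.
  The \<open>\<Phi> z\<close> part is \<open>a\<close> acting on the image of \<open>b\<close>; the
  \<open>\<Phi> y\<close> part becomes \<open>b\<close> acting on the image of \<open>a\<close>
  after centrality of \<open>b\<close> and Fubini's theorem. The bound involves three points because
  in the latter part the variable of \<Phi> first stands between the other two in the argument of
  \<phi>.\<close>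

lemma deriv_map_derivation:
  fixes \<Phi> \<phi> :: "'g \<Rightarrow> complex"
  assumes \<Phi>: "continuous_on UNIV \<Phi>" "\<And>x y. \<Phi> (x + y) = \<Phi> x + \<Phi> y"
    and \<phi>: "continuous_on UNIV \<phi>"
    and C: "0 \<le> C" "\<And>x y z. cmod (\<Phi> y * \<phi> (x + y + z)) \<le> C * \<omega> x * \<omega> y * \<omega> z"
  shows "continuous_derivation ZL1 wspace act (\<lambda>S a. act a S) (deriv_map \<Phi> \<phi>)"
proof -
  \<comment> \<open>The constant of the case \<open>z = 0\<close> of the three-point bound;
    \<open>\<omega> 0\<close> is at least 1 and need not equal 1.\<close>
  define B where "B = C * \<omega> 0"
  have B: "0 \<le> B" using C(1) by (simp add: B_def)
  have C2: "cmod (\<Phi> y * \<phi> (x + y)) \<le> B * \<omega> x * \<omega> y" for x y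
    using C(2)[of y x 0] by (simp add: B_def mult_ac)
  note c = continuous_on_compose2[OF \<phi>] continuous_on_compose2[OF \<Phi>(1)]
  have k: "continuous_on UNIV (\<lambda>y. \<Phi> y * \<phi> (x + y))" for x
    by (intro continuous_intros c \<Phi>(1)) auto
  define d where "d a x = (LINT y|completion \<mu>. rep a y * (\<Phi> y * \<phi> (x + y)))" for a x
  have D: "deriv_map \<Phi> \<phi> a = enc (d a)" for a by (simp add: deriv_map_def d_def[abs_def])
  have dW: "d a \<in> weighted_continuous" "wnorm (d a) \<le> B * vnorm ZL1 a" if a: "a \<in> vcarrier ZL1" for a
  proof -
    have le: "cmod (d a x) \<le> (B * vnorm ZL1 a) * \<omega> x" for x
      using integral_kernel_bound[OF k C2 a a, of x] by (simp add: d_def mult_ac)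
    then show "wnorm (d a) \<le> B * vnorm ZL1 a" by (rule wnorm_least)
    have "continuous_on UNIV (\<lambda>x. LINT y|completion \<mu>. rep a y * (\<lambda>p. \<Phi> (snd p) * \<phi> (fst p + snd p)) (x, y))"
      by (rule kernel_integral_continuous[OF w ZL1_rep(1)[OF a] _ B])
         (auto simp: C2 intro!: continuous_intros c)
    then have "continuous_on UNIV (d a)" by (simp add: d_def)
    with le show "d a \<in> weighted_continuous" by (intro weighted_continuousI)
  qed
  have lin: "d (vadd ZL1 a b) = (\<lambda>x. d a x + d b x)" "d (vscale ZL1 t a) = (\<lambda>x. t * d a x)"
    if "a \<in> vcarrier ZL1" "b \<in> vcarrier ZL1" for a b t
    unfolding d_def using integral_kernel_add[OF k C2 that] integral_kernel_scale[OF k C2 that] by auto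
  have prod: "d (vmult ZL1 a b) x
      = (LINT y|completion \<mu>. rep a y * d b (x + y)) + (LINT z|completion \<mu>. rep b z * d a (x + z))"
    if a: "a \<in> vcarrier ZL1" and b: "b \<in> vcarrier ZL1" for a b x
  proof -
    let ?K = "\<lambda>p. \<Phi> (fst p) * \<phi> (x + (fst p + snd p))"
    \<comment> \<open>The kernel \<open>?K\<close> with the summands \<open>y\<close> and
      \<open>z\<close> exchanged, which is the effect of the centrality of \<open>b\<close>.\<close>
    let ?L = "\<lambda>p. \<Phi> (fst p) * \<phi> (x + (snd p + fst p))"
    have K: "continuous_on UNIV ?K" "continuous_on UNIV ?L"
      by (intro continuous_intros c; simp)+
    have Kb: "cmod (?K (y, z)) \<le> C * \<omega> x * \<omega> y * \<omega> z" for y z using C(2)[of y x z] by (simp add: add.assoc)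
    have Lb: "cmod (?L (y, z)) \<le> B * \<omega> x * \<omega> y * \<omega> z" for y z
    proof -
      have "cmod (?L (y, z)) \<le> B * \<omega> (x + z) * \<omega> y" using C2[of y "x + z"] by (simp add: add.assoc)
      also have "\<dots> \<le> B * (\<omega> x * \<omega> z) * \<omega> y"
        using B by (intro mult_right_mono mult_left_mono omega_add) auto
      finally show ?thesis by (simp add: mult_ac)
    qed
    have Cx: "0 \<le> C * \<omega> x" "0 \<le> B * \<omega> x" using C(1) B by auto
    have ks: "continuous_on UNIV (\<lambda>z. ?K (y, z))" for y by (intro continuous_intros c; simp)
    define I where "I y = (LINT z|completion \<mu>. rep b z * ?K (y, z))" for y
    have Ic: "continuous_on UNIV I"
      unfolding I_def by (rule kernel_integral_continuous[OF w ZL1_rep(1)[OF b] K(1) Cx(1) Kb])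
    have Ib: "cmod (I y) \<le> (C * \<omega> x * vnorm ZL1 b) * \<omega> y" for y
      using integral_kernel_bound[OF ks Kb b b, of y] by (simp add: I_def mult_ac)
    note dk = translate_kernel[OF dW(1)[OF b]]
    have split: "(LINT z|completion \<mu>. rep b z * (\<Phi> (y + z) * \<phi> (x + (y + z)))) = I y + d b (x + y)" for y
    proof -
      have "(LINT z|completion \<mu>. rep b z * (\<Phi> (y + z) * \<phi> (x + (y + z))))
          = (LINT z|completion \<mu>. rep b z * ?K (y, z) + rep b z * (\<Phi> z * \<phi> (x + y + z)))"
        by (simp add: \<Phi>(2) algebra_simps)
      also have "\<dots> = I y + d b (x + y)"
        unfolding I_def d_def
        by (rule Bochner_Integration.integral_add[OF kernel_integrable(1)[OF w ZL1_rep(1)[OF b] ks Kb]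
              kernel_integrable(1)[OF w ZL1_rep(1)[OF b] k C2]])
      finally show ?thesis .
    qed
    have "d (vmult ZL1 a b) x
        = (LINT y|completion \<mu>. rep a y * (LINT z|completion \<mu>. rep b z * (\<Phi> (y + z) * \<phi> (x + (y + z)))))"
      unfolding d_def by (rule integral_kernel_mult[OF k C2 Cx(2) a b])
    also have "\<dots> = (LINT y|completion \<mu>. rep a y * I y + rep a y * d b (x + y))"
      by (simp only: split distrib_left)
    also have "\<dots> = (LINT y|completion \<mu>. rep a y * I y) + (LINT y|completion \<mu>. rep a y * d b (x + y))"
      by (rule Bochner_Integration.integral_add[OF kernel_integrable(1)[OF w ZL1_rep(1)[OF a] Ic Ib]
            kernel_integrable(1)[OF w ZL1_rep(1)[OF a] dk(1,3)]])
    also have "(LINT y|completion \<mu>. rep a y * I y)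
        = (LINT y|completion \<mu>. rep a y * (LINT z|completion \<mu>. rep b z * ?L (y, z)))"
    proof -
      have "I y = (LINT z|completion \<mu>. rep b z * ?L (y, z))" for y
        using integral_central[OF w ZL1_rep(1)[OF b] ZL1_rep(2)[OF b], of "\<lambda>u. \<Phi> y * \<phi> (x + u)" y]
        by (simp add: I_def continuous_intros c)
      then show ?thesis by simp
    qed
    also have "\<dots> = (LINT z|completion \<mu>. rep b z * (LINT y|completion \<mu>. rep a y * ?L (y, z)))"
      by (rule Fubini_beurling[OF w ZL1_rep(1)[OF a] ZL1_rep(1)[OF b] K(2) Cx(2) Lb])
    also have "\<dots> = (LINT z|completion \<mu>. rep b z * d a (x + z))"
      by (simp add: d_def add.assoc)
    finally show ?thesis by simp
  qed
  show ?thesis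
    unfolding continuous_derivation_def bounded_clinear_on_def clinear_on_def
  proof (intro conjI ballI allI)
    show "\<exists>C. \<forall>a\<in>vcarrier ZL1. vnorm wspace (deriv_map \<Phi> \<phi> a) \<le> C * vnorm ZL1 a"
      using dW(2) by (intro exI[of _ B]) (simp add: D)
  next
    fix a b assume ab: "a \<in> vcarrier ZL1" "b \<in> vcarrier ZL1"
    show "deriv_map \<Phi> \<phi> (vmult ZL1 a b)
        = vadd wspace (act a (deriv_map \<Phi> \<phi> b)) (act b (deriv_map \<Phi> \<phi> a))"
    proof -
      have "d (vmult ZL1 a b) = (\<lambda>x. (LINT y|completion \<mu>. rep a y * d b (x + y))
          + (LINT z|completion \<mu>. rep b z * d a (x + z)))"
        by (rule ext) (rule prod[OF ab])
      then show ?thesis by (simp add: D act_def enc_add)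
    qed
  qed (simp_all add: D dW lin enc_add enc_scale)
qed

end

section \<open>A bounded derivation that does not vanish\<close>

theorem proposition2p8:
  fixes \<mu> :: "'g::locally_compact_group_add measure"
    and \<omega> :: "'g \<Rightarrow> real"
    and \<Phi> :: "'g \<Rightarrow> complex"
  assumes "FC_bar_group TYPE('g)"
    and "left_haar_measure \<mu>"
    and "weight \<omega>"
    and "continuous_on UNIV \<Phi>"
    and "\<And>x y. \<Phi> (x + y) = \<Phi> x + \<Phi> y"
    and "\<exists>x. \<Phi> x \<noteq> 0"
    and "bdd_above (range (\<lambda>t. cmod (\<Phi> t) / (\<omega> t * \<omega> (- t))))"
  shows "\<not> weakly_amenable (central_beurling_algebra \<mu> \<omega>)"
proof
  assume wa: "weakly_amenable (central_beurling_algebra \<mu> \<omega>)"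
  interpret FC_beurling \<mu> \<omega>
    by unfold_locales (rule assms)+
  note \<Phi> = assms(4,5)
  obtain x0 where x0: "\<Phi> x0 \<noteq> 0" using assms(6) by auto
  \<comment> \<open>An arbitrary invariant set could lie in the kernel of \<Phi>. A closed
    neighbourhood of \<open>x0\<close> on which \<Phi> stays away from 0 yields a point
    \<open>p\<close> of \<open>P\<close> with \<open>\<Phi> p \<noteq> 0\<close>.\<close>
  define F where "F = {x. cmod (\<Phi> x0) / 2 \<le> cmod (\<Phi> x)}"
  have "closed F" unfolding F_def by (intro closed_Collect_le continuous_intros \<Phi>)
  moreover have "x0 \<in> interior F"
  proof (rule interiorI[of "{x. cmod (\<Phi> x0) / 2 < cmod (\<Phi> x)}"])
    show "open {x. cmod (\<Phi> x0) / 2 < cmod (\<Phi> x)}" by (intro open_Collect_less continuous_intros \<Phi>)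
  qed (use x0 in \<open>auto simp: F_def\<close>)
  ultimately obtain P p where P: "open P" "p \<in> P" "p \<in> F" "compact (closure P)"
    "\<And>g x. x \<in> P \<Longrightarrow> g + x - g \<in> P"
    using FC_bar_invariant_open[OF assms(1), of F] by blast
  have p: "\<Phi> p \<noteq> 0" using P(3) x0 by (auto simp: F_def)
  \<comment> \<open>On \<open>W\<close> the quotient by \<open>\<Phi> p\<close> has positive real
    part, which rules out cancellation in the final integral; 1/2 stands for any number strictly
    between 0 and 1.\<close>
  define W where "W = {y \<in> P. 1/2 < Re (\<Phi> y / \<Phi> p)}"
  have "open {y. 1/2 < Re (\<Phi> y / \<Phi> p)}"
    using p by (intro open_Collect_less continuous_intros \<Phi>) auto
  then have oW: "open W" using P(1) by (simp add: W_def Collect_conj_eq open_Int)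
  have pW: "p \<in> W" using p P by (simp add: W_def)
  obtain h :: "'g \<Rightarrow> real" where h: "continuous_on UNIV h" "h p = 1" "\<And>y. y \<notin> W \<Longrightarrow> h y = 0"
    "\<And>y. h y \<in> {0..1}"
    using completely_regular_group[OF oW pW] by metis
  define \<phi> where "\<phi> = (\<lambda>y. complex_of_real (h y))"
  have \<phi>: "continuous_on UNIV \<phi>" unfolding \<phi>_def by (intro continuous_intros h)
  have WP: "W \<subseteq> closure P" using closure_subset by (auto simp: W_def)
  obtain B where B: "0 \<le> B" "\<And>t. cmod (\<Phi> t) \<le> B * (\<omega> t * \<omega> (- t))"
  proof -
    obtain B where B: "\<And>t. cmod (\<Phi> t) / (\<omega> t * \<omega> (- t)) \<le> B"
      using assms(7) unfolding bdd_above_def by auto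
    have "0 \<le> B" using B[of p] by (rule order_trans[rotated]) simp
    moreover have "cmod (\<Phi> t) \<le> B * (\<omega> t * \<omega> (- t))" for t using B[of t] by (simp add: divide_le_eq)
    ultimately show ?thesis by (rule that)
  qed
  have "compact (uminus ` closure P)" using P(4) by (intro compact_continuous_image continuous_intros)
  then obtain M where M: "0 < M" "\<And>x. x \<in> uminus ` closure P \<Longrightarrow> \<omega> x \<le> M"
    using weight_bounded[OF w] by metis
  have bound: "cmod (\<Phi> y * \<phi> (x + y + z)) \<le> B * M * \<omega> x * \<omega> y * \<omega> z" for x y z
  proof (cases "x + y + z \<in> W")
    case True
    \<comment> \<open>The middle summand is the negative of a point of \<open>closure P\<close>,
      where \<open>M\<close> bounds \<omega>.\<close>
    have "- y = z + (- (x + y + z)) + x" by (simp add: group_simps del: add_uminus_conv_diff)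
    then have "\<omega> (- y) \<le> \<omega> z * \<omega> (- (x + y + z)) * \<omega> x"
      by (metis omega_add omega_nonneg mult_right_mono order_trans)
    also have "\<dots> \<le> \<omega> z * M * \<omega> x"
      using True WP M by (intro mult_right_mono mult_left_mono) auto
    finally have 1: "\<omega> (- y) \<le> \<omega> z * M * \<omega> x" .
    have "cmod (\<Phi> y * \<phi> (x + y + z)) \<le> cmod (\<Phi> y)"
      using h(4)[of "x + y + z"] by (auto simp: norm_mult \<phi>_def mult_left_le)
    also have "\<dots> \<le> B * (\<omega> y * \<omega> (- y))" by (rule B)
    also have "\<dots> \<le> B * (\<omega> y * (\<omega> z * M * \<omega> x))" using B(1) 1 by (intro mult_left_mono) auto
    finally show ?thesis by (simp add: mult_ac)
  next
    case False
    then have "\<phi> (x + y + z) = 0" using h(3) by (simp add: \<phi>_def)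
    then show ?thesis using B(1) M(1) by simp
  qed
  have BM: "0 \<le> B * M" using B(1) M(1) by simp
  note der = deriv_map_derivation[OF \<Phi> \<phi> BM bound]
  have zero: "deriv_map \<Phi> \<phi> a = vzero wspace" if "a \<in> vcarrier ZL1" for a
    using wa wspace_bimodule der that unfolding weakly_amenable_def by blast

  \<comment> \<open>Invariance of \<open>P\<close> makes its indicator constant on conjugacy
    classes; its weighted norm is finite because \<omega> is bounded on the compact
    \<open>closure P\<close>.\<close>
  define f where "f = (indicator P :: 'g \<Rightarrow> complex)"
  have Pb: "P \<in> sets borel" using P(1) by simp
  have fm: "f \<in> borel_measurable (completion \<mu>)"
    unfolding f_def using Pb by (intro borel_imp_completion borel_measurable_indicator)
  obtain M' where M': "0 < M'" "\<And>x. x \<in> closure P \<Longrightarrow> \<omega> x \<le> M'" using weight_bounded[OF w P(4)] by metis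
  have Pfin: "emeasure \<mu> P < \<infinity>"
    using emeasure_mono[OF closure_subset, of P \<mu>] emeasure_compact_finite[OF P(4)] by (auto intro: le_less_trans)
  have iP: "integrable \<mu> (\<lambda>x. M' * indicator P x)"
    using Pb Pfin by (intro integrable_mult_right) (auto simp: integrable_indicator_iff)
  have "integrable \<mu> (\<lambda>x. cmod (f x) * \<omega> x)"
  proof (rule Bochner_Integration.integrable_bound[OF iP])
    show "(\<lambda>x. cmod (f x) * \<omega> x) \<in> borel_measurable \<mu>"
      unfolding f_def measurable_haar_eq using Pb weightD(1)[OF w] by measurable
    show "AE x in \<mu>. norm (cmod (f x) * \<omega> x) \<le> norm (M' * indicator P x)"
      using M' closure_subset[of P] by (intro AE_I2) (auto simp: f_def indicator_def)
  qed
  then have "integrable (completion \<mu>) (\<lambda>x. cmod (f x) * \<omega> x)"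
    by (subst integrable_completion) (simp_all add: borel_measurable_integrable)
  then have fB: "f \<in> beurling_fun \<mu> \<omega>" using fm by (simp add: beurling_fun_def)
  define a where "a = ae_class \<mu> f"
  have fc: "f (- g + x + g) = f x" for g x
  proof -
    have "- g + x + g \<in> P \<longleftrightarrow> x \<in> P"
      using P(5)[of x "- g"] P(5)[of "- g + x + g" g] by (auto simp: group_simps simp del: add_uminus_conv_diff)
    then show ?thesis by (simp add: f_def indicator_def)
  qed
  have "AE x in \<mu>. u (- g + x + g) = u x" if u: "u \<in> a" for u g
  proof -
    have ae: "AE x in \<mu>. u x = f x" using u by (simp add: a_def ae_class_def)
    have T: "(+) (- g) \<in> measurable borel (borel :: 'g measure)" "(\<lambda>x. x + g) \<in> measurable borel (borel :: 'g measure)"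
      by (intro borel_measurable_continuous_onI continuous_intros)+
    \<comment> \<open>Centrality is demanded of every member of the class, so null sets have to
      survive conjugation; left and right translations both preserve them.\<close>
    have "AE x in \<mu>. u (- g + (x + g)) = f (- g + (x + g))"
      by (rule AE_translate[OF T(2) distr_right AE_translate[OF T(1) distr_left ae]])
    with ae show ?thesis by eventually_elim (simp add: fc add.assoc[symmetric])
  qed
  then have aZ: "a \<in> vcarrier ZL1"
    using fB by (auto simp: central_beurling_algebra_def beurling_algebra_def a_def)
  have "(\<lambda>x. LINT y|completion \<mu>. rep a y * (\<Phi> y * \<phi> (x + y))) = (\<lambda>x. 0)"
    using zero[OF aZ] by (simp only: deriv_map_def wspace_simps enc_zero enc_inject)
  \<comment> \<open>At 0 the image of the indicator of \<open>P\<close> is the integral of the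
    product of \<Phi> and \<phi> over \<open>P\<close>.\<close>
  from fun_cong[OF this, of 0] have 0: "(LINT y|completion \<mu>. rep a y * (\<Phi> y * \<phi> y)) = 0" by simp
  have k: "continuous_on UNIV (\<lambda>y. \<Phi> y * \<phi> y)" by (intro continuous_intros \<Phi> \<phi>)
  have "(LINT y|completion \<mu>. rep a y * (\<Phi> y * \<phi> y)) = (\<integral>y. f y * (\<Phi> y * \<phi> y) \<partial>\<mu>)"
  proof (rule integral_completion_AE)
    show "(\<lambda>y. f y * (\<Phi> y * \<phi> y)) \<in> borel_measurable borel"
      unfolding f_def using Pb borel_measurable_continuous_onI[OF k] by measurable
    show "AE y in \<mu>. rep a y * (\<Phi> y * \<phi> y) = f y * (\<Phi> y * \<phi> y)"
      using ae_rep_class(3)[OF fm] by (auto simp: a_def elim!: eventually_mono)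
  qed
  \<comment> \<open>\<open>h\<close> vanishes off \<open>W \<subseteq> P\<close>, so the indicator
    of \<open>P\<close> drops out.\<close>
  also have "(\<lambda>y. f y * (\<Phi> y * \<phi> y)) = (\<lambda>y. \<Phi> p * (h y * (\<Phi> y / \<Phi> p)))"
    using p h(3) by (auto simp: f_def \<phi>_def W_def indicator_def fun_eq_iff)
  finally have "(\<integral>y. \<Phi> p * (h y * (\<Phi> y / \<Phi> p)) \<partial>\<mu>) = 0"
    unfolding 0 by (rule sym)
  then have int0: "(\<integral>y. h y * (\<Phi> y / \<Phi> p) \<partial>\<mu>) = 0"
    using p by (simp only: integral_mult_right_zero mult_eq_0_iff simp_thms)

  have cq: "continuous_on UNIV (\<lambda>y. \<Phi> y / \<Phi> p)" using p by (intro continuous_intros \<Phi>) auto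
  have "compact ((\<lambda>y. \<Phi> y / \<Phi> p) ` closure P)"
    using continuous_on_subset[OF cq] P(4) by (intro compact_continuous_image) auto
  then have "bounded ((\<lambda>y. \<Phi> y / \<Phi> p) ` closure P)" by (rule compact_imp_bounded)
  then obtain R where R: "0 < R" "\<forall>z\<in>(\<lambda>y. \<Phi> y / \<Phi> p) ` closure P. cmod z \<le> R"
    unfolding bounded_pos by blast
  have hm[measurable]: "h \<in> borel_measurable borel" by (rule borel_measurable_continuous_onI[OF h(1)])
  have int: "integrable \<mu> (\<lambda>y. h y * (\<Phi> y / \<Phi> p))"
  proof (rule Bochner_Integration.integrable_bound)
    show "integrable \<mu> (\<lambda>x. R * indicator P x :: real)"
      using Pb Pfin by (intro integrable_mult_right) (auto simp: integrable_indicator_iff)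
    show "(\<lambda>y. h y * (\<Phi> y / \<Phi> p)) \<in> borel_measurable \<mu>"
      unfolding measurable_haar_eq using borel_measurable_continuous_onI[OF cq] by measurable
    show "AE y in \<mu>. norm (h y * (\<Phi> y / \<Phi> p)) \<le> norm (R * indicator P y :: real)"
    proof (rule AE_I2)
      fix y
      show "norm (h y * (\<Phi> y / \<Phi> p)) \<le> norm (R * indicator P y :: real)"
      proof (cases "y \<in> W")
        case True
        then have "y \<in> P" "y \<in> closure P" using WP by (auto simp: W_def)
        then have "\<bar>h y\<bar> * cmod (\<Phi> y / \<Phi> p) \<le> 1 * R"
          using h(4)[of y] R by (intro mult_mono) (blast | simp)+
        moreover have "norm (h y * (\<Phi> y / \<Phi> p)) = \<bar>h y\<bar> * cmod (\<Phi> y / \<Phi> p)"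
          by (simp only: norm_mult norm_of_real)
        ultimately show ?thesis using \<open>y \<in> P\<close> R(1) by simp
      qed (simp add: h(3))
    qed
  qed
  \<comment> \<open>A nonnegative integrand with integral 0 vanishes almost everywhere, but this one
    is positive on the open set \<open>V\<close> below, which contains \<open>p\<close>.\<close>
  let ?r = "\<lambda>y. Re (h y * (\<Phi> y / \<Phi> p))"
  have r: "?r y = h y * Re (\<Phi> y / \<Phi> p)" for y 
    by (simp only: times_complex.sel Re_complex_of_real Im_complex_of_real mult_zero_left diff_zero)
  have rint: "integrable \<mu> ?r" by (rule integrable_Re[OF int])
  have rint0: "(\<integral>y. ?r y \<partial>\<mu>) = 0"
    by (simp only: integral_Re[OF int] int0 zero_complex.sel)
  have nonneg: "0 \<le> ?r y" for y
    unfolding r using h(4)[of y] h(3)[of y] by (cases "y \<in> W") (auto simp: W_def)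
  have "AE y in \<mu>. ?r y = 0"
    using integral_nonneg_eq_0_iff_AE[OF rint AE_I2[OF nonneg]] rint0 by (rule iffD1)
  define V where "V = {y \<in> W. 0 < h y}"
  have "open {y. 0 < h y}" by (intro open_Collect_less continuous_intros h)
  then have "open V" using oW by (simp add: V_def Collect_conj_eq open_Int)
  have "AE y in \<mu>. y \<notin> V"
    using \<open>AE y in \<mu>. ?r y = 0\<close>
  proof eventually_elim
    case (elim y)
    show ?case
    proof
      assume "y \<in> V"
      then have "0 < h y * Re (\<Phi> y / \<Phi> p)" by (intro mult_pos_pos) (auto simp: V_def W_def)
      then show False using elim unfolding r by linarith
    qed
  qed
  then have "emeasure \<mu> V = 0"
    using \<open>open V\<close> by (subst (asm) AE_iff_measurable[of V]) auto
  moreover have "p \<in> V" using pW h(2) by (simp add: V_def)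
  ultimately show False using emeasure_open_pos[OF \<open>open V\<close>] by auto
qed

end
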